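(* Assume $p(K)=0$. For every $r\in(0,r(K,\partial)]$ and every $M\in\mathcal C^f$, $F_{sp,[r,r]}M=F_{[r,r]}M$.
   Context: $K$ is a field of characteristic $0$, complete for a non-trivial non-archimedean absolute value $|\cdot|$, with a non-zero bounded derivation $\partial$. $p(K)$ is the residue characteristic, $\omega(K)=|p(K)|^{1/(p(K)-1)}$ if $p(K)>0$ (else $1$), $|\partial|_{sp,K}=\inf_{i\ge1}|\partial^i|_{op}^{1/i}$, $r(K,\partial)=\omega(K)/|\partial|_{sp,K}$. $K\langle T\rangle$ is the twisted polynomial ring with $Ta=aT+\partial(a)$; $\mathcal C^f$ is the category of left $K\langle T\rangle$-modules finite-dimensional over $K$. For irreducible $M\in\mathcal C^f$, choosing a norm on $M$, $m(M)(r)=\dim_KM$ if $r=\omega(K)/|T|_{sp,M}$ and $0$ otherwise; in general sum over Jordan–Hölder factors. $F_{sp,[r,r]}M$ is the largest submodule $N$ with $\{r':m(N)(r')\neq0\}\subseteq\{r\}$. $K[[X]]$ is a left $K\langle T\rangle$-module via $c\cdot F=(\sum_i\frac{\partial^i(c)}{i!}X^i)F$, $T\cdot F=dF/dX$. $K[[X/r]]_0=\{\sum a_iX^i:\sup|a_i|r^i<\infty\}$, $K\{X/r\}=\bigcap_{s<r}K[[X/s]]_0$, $K\{X/r+\}=\bigcup_{s>r}K[[X/s]]_0$ (submodules for $r\le r(K,\partial)$, resp. $r<r(K,\partial)$). $F_{[r,r(K,\partial)]}M=\{x: s(x)\in K\{X/r\}\ \forall s\in\mathrm{Hom}_{K\langle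 T\rangle}(M,K[[X]])\}$; for $r<r(K,\partial)$, $F_{(0,r]}M=\bigcap_{s\in\mathrm{Hom}(M,K\{X/r+\})}\ker s$; $F_{(0,r(K,\partial)]}M:=M$; $F_{[r,r]}M=F_{(0,r]}M\cap F_{[r,r(K,\partial)]}M$. *)

theory Defs
  imports
    "HOL-Analysis.Abstract_Metric_Spaces"
    "HOL-Computational_Algebra.Formal_Power_Series"
    "HOL-Algebra.QuotRing"
    "Jordan_Normal_Form.VS_Connect"
begin

section \<open>The base field\<close>

locale derivation =
  fixes \<delta> :: "'k::field_char_0 \<Rightarrow> 'k"
  assumes d_add: "\<delta> (x + y) = \<delta> x + \<delta> y"
    and d_mult: "\<delta> (x * y) = \<delta> x * y + x * \<delta> y"

locale complete_nonarch_diff_field = derivation \<delta>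
  for v :: "'k::field_char_0 \<Rightarrow> real" and \<delta> :: "'k \<Rightarrow> 'k" +
  assumes abs_nonneg: "0 \<le> v x"
    and abs_eq_0: "v x = 0 \<longleftrightarrow> x = 0"
    and abs_mult: "v (x * y) = v x * v y"
    and abs_ultrametric: "v (x + y) \<le> max (v x) (v y)"
    and abs_nontrivial: "\<exists>x. x \<noteq> 0 \<and> v x \<noteq> 1"
    and complete: "Metric_space.mcomplete UNIV (\<lambda>x y. v (x - y))"
    and d_bounded: "\<exists>C. \<forall>x. v (\<delta> x) \<le> C * v x"
    and d_nonzero: "\<exists>x. \<delta> x \<noteq> 0"

definition valuation_ring :: "('k::field \<Rightarrow> real) \<Rightarrow> 'k ring" where
  "valuation_ring v = \<lparr>carrier = {x. v x \<le> 1}, mult = (*), one = 1, zero = 0, add = (+)\<rparr>"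

definition residue_field :: "('k::field \<Rightarrow> real) \<Rightarrow> 'k set ring" where
  "residue_field v = valuation_ring v Quot {x. v x < 1}"

definition ring_char :: "('a, 'b) ring_scheme \<Rightarrow> nat" where
  "ring_char R = Gcd {n::nat. [n] \<cdot>\<^bsub>R\<^esub> \<one>\<^bsub>R\<^esub> = \<zero>\<^bsub>R\<^esub>}"

definition residue_char :: "('k::field \<Rightarrow> real) \<Rightarrow> nat" where
  "residue_char v = ring_char (residue_field v)"

definition omega :: "('k::field \<Rightarrow> real) \<Rightarrow> real" where
  "omega v = (let p = residue_char v in
     if p > 0 then v (of_nat p) powr (1 / (real p - 1)) else 1)"

definition op_norm :: "'a set \<Rightarrow> ('a \<Rightarrow> real) \<Rightarrow> ('a \<Rightarrow> 'a) \<Rightarrow> real" where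
  "op_norm A \<nu> f = (SUP x\<in>{x \<in> A. \<nu> x \<noteq> 0}. \<nu> (f x) / \<nu> x)"

definition spectral_norm :: "'a set \<Rightarrow> ('a \<Rightarrow> real) \<Rightarrow> ('a \<Rightarrow> 'a) \<Rightarrow> real" where
  "spectral_norm A \<nu> f = (INF i\<in>{1::nat..}. op_norm A \<nu> (f ^^ i) powr (1 / real i))"

text \<open>The denominator is positive whenever \<open>\<delta>\<close> is a nonzero bounded derivation: otherwise
  every Taylor series \<open>\<Sum>i. \<delta>\<^sup>i x / i! X\<^sup>i\<close> with \<open>x \<noteq> 0\<close> would be an invertible entire
  function, hence constant.\<close>

definition diff_radius :: "('k::field \<Rightarrow> real) \<Rightarrow> ('k \<Rightarrow> 'k) \<Rightarrow> real" where
  "diff_radius v \<delta> = omega v / spectral_norm UNIV v \<delta>"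


section \<open>The twisted polynomial ring\<close>

text \<open>The polynomial \<open>\<Sum>i. c\<^sub>i T\<^sup>i\<close> acts as \<open>\<Sum>i. c\<^sub>i L\<^sup>i\<close>, given the action \<open>sc\<close> of the
  constants and the action \<open>L\<close> of \<open>T\<close>.\<close>

definition twisted_act ::
  "('k::field_char_0 \<Rightarrow> 'v \<Rightarrow> 'v) \<Rightarrow> ('v \<Rightarrow> 'v) \<Rightarrow> 'k poly \<Rightarrow> 'v \<Rightarrow> 'v::ab_group_add" where
  "twisted_act sc L p x = (\<Sum>i\<le>degree p. sc (coeff p i) ((L ^^ i) x))"

text \<open>\<open>T (\<Sum>i. b\<^sub>i T\<^sup>i) = \<Sum>i. (b\<^sub>i T + \<delta> b\<^sub>i) T\<^sup>i\<close>\<close>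

definition T_mult :: "('k::field_char_0 \<Rightarrow> 'k) \<Rightarrow> 'k poly \<Rightarrow> 'k poly" where
  "T_mult \<delta> q = pCons 0 q + map_poly \<delta> q"

text \<open>A polynomial \<open>\<Sum>i. c\<^sub>i T\<^sup>i\<close>, coefficients on the left, is represented by an element of
  type \<^typ>\<open>'k poly\<close>; only the multiplication differs from the one of \<^typ>\<open>'k poly\<close>.\<close>

definition twisted_ring :: "('k::field_char_0 \<Rightarrow> 'k) \<Rightarrow> 'k poly ring" where
  "twisted_ring \<delta> = \<lparr>carrier = UNIV, mult = twisted_act Polynomial.smult (T_mult \<delta>),
     one = 1, zero = 0, add = (+)\<rparr>"

locale left_module = R?: ring R + M?: abelian_group M
  for R :: "('a, 'r) ring_scheme" (structure) and M :: "('a, 'b, 'm) module_scheme" (structure) +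
  assumes smult_closed: "\<lbrakk>a \<in> carrier R; x \<in> carrier M\<rbrakk> \<Longrightarrow> a \<odot>\<^bsub>M\<^esub> x \<in> carrier M"
    and smult_l_distr: "\<lbrakk>a \<in> carrier R; b \<in> carrier R; x \<in> carrier M\<rbrakk> \<Longrightarrow>
      (a \<oplus>\<^bsub>R\<^esub> b) \<odot>\<^bsub>M\<^esub> x = a \<odot>\<^bsub>M\<^esub> x \<oplus>\<^bsub>M\<^esub> b \<odot>\<^bsub>M\<^esub> x"
    and smult_r_distr: "\<lbrakk>a \<in> carrier R; x \<in> carrier M; y \<in> carrier M\<rbrakk> \<Longrightarrow>
      a \<odot>\<^bsub>M\<^esub> (x \<oplus>\<^bsub>M\<^esub> y) = a \<odot>\<^bsub>M\<^esub> x \<oplus>\<^bsub>M\<^esub> a \<odot>\<^bsub>M\<^esub> y"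
    and smult_assoc: "\<lbrakk>a \<in> carrier R; b \<in> carrier R; x \<in> carrier M\<rbrakk> \<Longrightarrow>
      (a \<otimes>\<^bsub>R\<^esub> b) \<odot>\<^bsub>M\<^esub> x = a \<odot>\<^bsub>M\<^esub> (b \<odot>\<^bsub>M\<^esub> x)"
    and smult_one: "x \<in> carrier M \<Longrightarrow> \<one>\<^bsub>R\<^esub> \<odot>\<^bsub>M\<^esub> x = x"

definition left_module_hom ::
  "('a, 'r) ring_scheme \<Rightarrow> ('a, 'b, 'm) module_scheme \<Rightarrow> ('a, 'c, 'n) module_scheme \<Rightarrow> ('b \<Rightarrow> 'c) set"
  where "left_module_hom R M N = {h \<in> hom (add_monoid M) (add_monoid N).
     \<forall>a\<in>carrier R. \<forall>x\<in>carrier M. h (a \<odot>\<^bsub>M\<^esub> x) = a \<odot>\<^bsub>N\<^esub> h x}"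

definition quotient_module :: "('a, 'b, 'm) module_scheme \<Rightarrow> 'b set \<Rightarrow> ('a, 'b set) module" where
  "quotient_module M N = \<lparr>carrier = a_rcosets\<^bsub>M\<^esub> N, mult = undefined, one = undefined, zero = N,
     add = set_add M, smult = (\<lambda>a X. \<Union>x\<in>X. N +>\<^bsub>M\<^esub> (a \<odot>\<^bsub>M\<^esub> x))\<rparr>"

definition irreducible_module :: "('a, 'r) ring_scheme \<Rightarrow> ('a, 'b, 'm) module_scheme \<Rightarrow> bool" where
  "irreducible_module R M \<longleftrightarrow> carrier M \<noteq> {\<zero>\<^bsub>M\<^esub>} \<and>
     (\<forall>N. Module.submodule N R M \<longrightarrow> N = {\<zero>\<^bsub>M\<^esub>} \<or> N = carrier M)"

definition composition_factor :: "('a, 'b, 'm) module_scheme \<Rightarrow> 'b set list \<Rightarrow> nat \<Rightarrow> ('a, 'b set) module" where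
  "composition_factor M Ns i = quotient_module (M\<lparr>carrier := Ns ! Suc i\<rparr>) (Ns ! i)"

definition composition_series ::
  "('a, 'r) ring_scheme \<Rightarrow> ('a, 'b, 'm) module_scheme \<Rightarrow> 'b set list \<Rightarrow> bool" where
  "composition_series R M Ns \<longleftrightarrow> Ns \<noteq> [] \<and> hd Ns = {\<zero>\<^bsub>M\<^esub>} \<and> last Ns = carrier M \<and>
     (\<forall>N\<in>set Ns. Module.submodule N R M) \<and>
     (\<forall>i. Suc i < length Ns \<longrightarrow>
        Ns ! i \<subseteq> Ns ! Suc i \<and> irreducible_module R (composition_factor M Ns i))"


section \<open>Finite-dimensional modules and the spectral filtration\<close>

definition base_space :: "('k::field_char_0 poly, 'b, 'm) module_scheme \<Rightarrow> ('k, 'b) module" where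
  "base_space M = \<lparr>carrier = carrier M, mult = mult M, one = one M, zero = zero M, add = add M,
     smult = (\<lambda>c x. [:c:] \<odot>\<^bsub>M\<^esub> x)\<rparr>"

definition fd_module :: "('k::field_char_0 \<Rightarrow> 'k) \<Rightarrow> ('k poly, 'b, 'm) module_scheme \<Rightarrow> bool" where
  "fd_module \<delta> M \<longleftrightarrow> left_module (twisted_ring \<delta>) M \<and>
     vectorspace.fin_dim class_ring (base_space M)"

definition module_norm ::
  "('k::field_char_0 \<Rightarrow> real) \<Rightarrow> ('k poly, 'b, 'm) module_scheme \<Rightarrow> ('b \<Rightarrow> real) \<Rightarrow> bool" where
  "module_norm v M \<nu> \<longleftrightarrow>
     (\<forall>x\<in>carrier M. 0 \<le> \<nu> x \<and> (\<nu> x = 0 \<longleftrightarrow> x = \<zero>\<^bsub>M\<^esub>)) \<and>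
     (\<forall>x\<in>carrier M. \<forall>y\<in>carrier M. \<nu> (x \<oplus>\<^bsub>M\<^esub> y) \<le> max (\<nu> x) (\<nu> y)) \<and>
     (\<forall>c. \<forall>x\<in>carrier M. \<nu> ([:c:] \<odot>\<^bsub>M\<^esub> x) = v c * \<nu> x)"

text \<open>All norms on a finite-dimensional space over the complete field are equivalent, so the
  value does not depend on the chosen one.\<close>

definition T_spectral_norm ::
  "('k::field_char_0 \<Rightarrow> real) \<Rightarrow> ('k poly, 'b, 'm) module_scheme \<Rightarrow> real" where
  "T_spectral_norm v M =
     spectral_norm (carrier M) (SOME \<nu>. module_norm v M \<nu>) (\<lambda>x. [:0, 1:] \<odot>\<^bsub>M\<^esub> x)"

definition mult_irreducible ::
  "('k::field_char_0 \<Rightarrow> real) \<Rightarrow> ('k poly, 'b, 'm) module_scheme \<Rightarrow> real \<Rightarrow> nat" where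
  "mult_irreducible v M r =
     (if r = omega v / T_spectral_norm v M
      then vectorspace.dim class_ring (base_space M) else 0)"

text \<open>By the Jordan-Hoelder theorem the value does not depend on the chosen series.\<close>

definition mult_function ::
  "('k::field_char_0 \<Rightarrow> real) \<Rightarrow> ('k \<Rightarrow> 'k) \<Rightarrow> ('k poly, 'b, 'm) module_scheme \<Rightarrow> real \<Rightarrow> nat" where
  "mult_function v \<delta> M r = (let Ns = (SOME Ns. composition_series (twisted_ring \<delta>) M Ns) in
     \<Sum>i<length Ns - 1. mult_irreducible v (composition_factor M Ns i) r)"

definition F_sp ::
  "('k::field_char_0 \<Rightarrow> real) \<Rightarrow> ('k \<Rightarrow> 'k) \<Rightarrow> real \<Rightarrow> ('k poly, 'b, 'm) module_scheme \<Rightarrow> 'b set" where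
  "F_sp v \<delta> r M = (GREATEST N. Module.submodule N (twisted_ring \<delta>) M \<and>
     {r'. mult_function v \<delta> (M\<lparr>carrier := N\<rparr>) r' \<noteq> 0} \<subseteq> {r})"


section \<open>Power series and the filtration by solutions\<close>

definition taylor :: "('k::field_char_0 \<Rightarrow> 'k) \<Rightarrow> 'k \<Rightarrow> 'k fps" where
  "taylor \<delta> c = Abs_fps (\<lambda>i. (\<delta> ^^ i) c / fact i)"

definition fps_module :: "('k::field_char_0 \<Rightarrow> 'k) \<Rightarrow> ('k poly, 'k fps) module" where
  "fps_module \<delta> = \<lparr>carrier = UNIV, mult = (*), one = 1, zero = 0, add = (+),
     smult = twisted_act (\<lambda>c F. taylor \<delta> c * F) fps_deriv\<rparr>"

definition fps_bounded :: "('k::field_char_0 \<Rightarrow> real) \<Rightarrow> real \<Rightarrow> 'k fps set" where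
  "fps_bounded v r = {F. bdd_above (range (\<lambda>i. v (fps_nth F i) * r ^ i))}"

definition fps_conv :: "('k::field_char_0 \<Rightarrow> real) \<Rightarrow> real \<Rightarrow> 'k fps set" where
  "fps_conv v r = (\<Inter>s\<in>{0<..<r}. fps_bounded v s)"

definition fps_overconv :: "('k::field_char_0 \<Rightarrow> real) \<Rightarrow> real \<Rightarrow> 'k fps set" where
  "fps_overconv v r = (\<Union>s\<in>{r<..}. fps_bounded v s)"

definition F_ge ::
  "('k::field_char_0 \<Rightarrow> real) \<Rightarrow> ('k \<Rightarrow> 'k) \<Rightarrow> real \<Rightarrow> ('k poly, 'b, 'm) module_scheme \<Rightarrow> 'b set" where
  "F_ge v \<delta> r M = {x \<in> carrier M.
     \<forall>s\<in>left_module_hom (twisted_ring \<delta>) M (fps_module \<delta>). s x \<in> fps_conv v r}"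

definition F_le ::
  "('k::field_char_0 \<Rightarrow> real) \<Rightarrow> ('k \<Rightarrow> 'k) \<Rightarrow> real \<Rightarrow> ('k poly, 'b, 'm) module_scheme \<Rightarrow> 'b set" where
  "F_le v \<delta> r M = (if r < diff_radius v \<delta> then {x \<in> carrier M.
     \<forall>s\<in>left_module_hom (twisted_ring \<delta>) M ((fps_module \<delta>)\<lparr>carrier := fps_overconv v r\<rparr>). s x = 0}
     else carrier M)"

definition F_sol ::
  "('k::field_char_0 \<Rightarrow> real) \<Rightarrow> ('k \<Rightarrow> 'k) \<Rightarrow> real \<Rightarrow> ('k poly, 'b, 'm) module_scheme \<Rightarrow> 'b set" where
  "F_sol v \<delta> r M = F_le v \<delta> r M \<inter> F_ge v \<delta> r M"


section \<open>Well-definedness of the ring and of the power series module\<close>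

lemma twisted_act_bound:
  assumes "degree p \<le> n" "\<And>x. sc 0 x = 0"
  shows "twisted_act sc L p x = (\<Sum>i\<le>n. sc (coeff p i) ((L ^^ i) x))"
  unfolding twisted_act_def
  by (rule sum.mono_neutral_left) (use assms in \<open>auto simp: coeff_eq_0\<close>)

locale twisted_action = derivation \<delta> for \<delta> :: "'k::field_char_0 \<Rightarrow> 'k" +
  fixes sc :: "'k \<Rightarrow> 'v::ab_group_add \<Rightarrow> 'v" and L :: "'v \<Rightarrow> 'v"
  assumes sc_add_left: "sc (a + b) x = sc a x + sc b x"
    and sc_add_right: "sc a (x + y) = sc a x + sc a y"
    and sc_mult: "sc (a * b) x = sc a (sc b x)"
    and sc_one: "sc 1 x = x"
    and L_add: "L (x + y) = L x + L y"
    and L_sc: "L (sc a x) = sc a (L x) + sc (\<delta> a) x"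
begin

lemma d_0: "\<delta> 0 = 0"
  using d_add[of 0 0] by simp

lemma sc_0_left: "sc 0 x = 0"
  using sc_add_left[of 0 0 x] by simp

lemma sc_0_right: "sc a 0 = 0"
  using sc_add_right[of a 0 0] by simp

lemma L_0: "L 0 = 0"
  using L_add[of 0 0] by simp

lemma sc_sum: "sc a (sum f A) = (\<Sum>i\<in>A. sc a (f i))"
  by (induction A rule: infinite_finite_induct) (simp_all add: sc_0_right sc_add_right)

lemma L_sum: "L (sum f A) = (\<Sum>i\<in>A. L (f i))"
  by (induction A rule: infinite_finite_induct) (simp_all add: L_0 L_add)

lemma Lpow_add: "(L ^^ i) (x + y) = (L ^^ i) x + (L ^^ i) y"
  by (induction i) (simp_all add: L_add)

abbreviation "act \<equiv> twisted_act sc L"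

lemma act_bound: "degree p \<le> n \<Longrightarrow> act p x = (\<Sum>i\<le>n. sc (coeff p i) ((L ^^ i) x))"
  by (rule twisted_act_bound) (simp_all add: sc_0_left)

lemma act_add_right: "act p (x + y) = act p x + act p y"
  by (simp add: twisted_act_def Lpow_add sc_add_right sum.distrib)

lemma act_add_left: "act (p + q) x = act p x + act q x"
proof -
  let ?n = "max (degree p) (degree q)"
  have "degree (p + q) \<le> ?n" by (rule degree_add_le_max)
  thus ?thesis
    by (simp add: act_bound[of _ ?n] sc_add_left sum.distrib)
qed

lemma act_smult: "act (Polynomial.smult c p) x = sc c (act p x)"
  unfolding act_bound[OF degree_smult_le] by (simp add: twisted_act_def sc_mult sc_sum)

lemma act_0: "act 0 x = 0"
  by (simp add: twisted_act_def sc_0_left)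

lemma act_sum: "act (sum f A) x = (\<Sum>i\<in>A. act (f i) x)"
  by (induction A rule: infinite_finite_induct) (simp_all add: act_0 act_add_left)

lemma act_one: "act 1 x = x"
  by (simp add: twisted_act_def sc_one)

lemma act_T_mult: "act (T_mult \<delta> q) x = L (act q x)"
proof -
  let ?n = "degree q"
  have "act (pCons 0 q) x = (\<Sum>i\<le>Suc ?n. sc (coeff (pCons 0 q) i) ((L ^^ i) x))"
    by (rule act_bound) (simp add: degree_pCons_le)
  also have "\<dots> = (\<Sum>i\<le>?n. sc (coeff q i) (L ((L ^^ i) x)))"
    by (subst sum.atMost_Suc_shift) (simp add: sc_0_left)
  finally have 1: "act (pCons 0 q) x = (\<Sum>i\<le>?n. sc (coeff q i) (L ((L ^^ i) x)))" .
  have "act (map_poly \<delta> q) x = (\<Sum>i\<le>?n. sc (coeff (map_poly \<delta> q) i) ((L ^^ i) x))"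
    by (rule act_bound) (rule degree_le, simp add: coeff_map_poly d_0 coeff_eq_0)
  hence 2: "act (map_poly \<delta> q) x = (\<Sum>i\<le>?n. sc (\<delta> (coeff q i)) ((L ^^ i) x))"
    by (simp add: coeff_map_poly d_0)
  show ?thesis
    by (simp add: T_mult_def act_add_left 1 2 act_bound[OF order.refl, of q] L_sum L_sc sum.distrib)
qed

lemma act_T_mult_pow: "act ((T_mult \<delta> ^^ i) q) x = (L ^^ i) (act q x)"
  by (induction i) (simp_all add: act_T_mult)

lemma act_mult: "act (twisted_act Polynomial.smult (T_mult \<delta>) p q) x = act p (act q x)"
  by (simp add: twisted_act_def[of Polynomial.smult] act_sum act_smult act_T_mult_pow)
     (simp add: twisted_act_def)

end

context derivation
begin

lemma d_zero: "\<delta> 0 = 0"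
  using d_add[of 0 0] by simp

lemma d_one: "\<delta> 1 = 0"
  using d_mult[of 1 1] by simp

lemma dpow_add: "(\<delta> ^^ i) (x + y) = (\<delta> ^^ i) x + (\<delta> ^^ i) y"
  by (induction i) (simp_all add: d_add)

lemma dpow_one: "(\<delta> ^^ i) 1 = (if i = 0 then 1 else 0)"
  by (induction i) (auto simp: d_one d_zero)

lemma twisted_action_poly: "twisted_action \<delta> Polynomial.smult (T_mult \<delta>)"
proof unfold_locales
  fix a :: 'k and p q :: "'k poly"
  show "T_mult \<delta> (p + q) = T_mult \<delta> p + T_mult \<delta> q"
    by (rule poly_eqI) (simp add: T_mult_def coeff_map_poly d_zero d_add coeff_pCons split: nat.split)
  show "T_mult \<delta> (Polynomial.smult a p) =
      Polynomial.smult a (T_mult \<delta> p) + Polynomial.smult (\<delta> a) p"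
    by (rule poly_eqI)
       (simp add: T_mult_def coeff_map_poly d_zero d_mult coeff_pCons algebra_simps split: nat.split)
qed (simp_all add: smult_add_left smult_add_right)

lemma T_mult_right: "twisted_act Polynomial.smult (T_mult \<delta>) [:0, 1:] [:a:] = [:\<delta> a, a:]"
  by (simp add: twisted_act_def T_mult_def map_poly_pCons d_zero)

lemma Lpow_T: "(T_mult \<delta> ^^ i) 1 = monom 1 i"
proof (induction i)
  case (Suc i)
  have "map_poly \<delta> (monom 1 i) = 0"
    by (rule poly_eqI) (simp add: coeff_map_poly d_zero d_one)
  with Suc show ?case by (simp add: T_mult_def monom_Suc)
qed simp

lemma ring_twisted_ring: "ring (twisted_ring \<delta>)"
proof -
  interpret twisted_action \<delta> Polynomial.smult "T_mult \<delta>" by (rule twisted_action_poly)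
  have one: "act p 1 = p" for p
    unfolding twisted_act_def Lpow_T
    by (simp add: smult_monom poly_as_sum_of_monoms)
  show ?thesis
  proof (rule ringI)
    show "abelian_group (twisted_ring \<delta>)"
      by (rule abelian_groupI)
         (auto simp: twisted_ring_def algebra_simps intro: exI[of _ "- _"] right_minus left_minus)
    show "monoid (twisted_ring \<delta>)"
      by (rule monoidI) (auto simp: twisted_ring_def act_mult act_one one)
  qed (auto simp: twisted_ring_def act_add_left act_add_right)
qed

lemma taylor_add: "taylor \<delta> (a + b) = taylor \<delta> a + taylor \<delta> b"
  by (rule fps_ext) (simp add: taylor_def dpow_add add_divide_distrib)

lemma taylor_one: "taylor \<delta> 1 = 1"
  by (rule fps_ext) (simp add: taylor_def dpow_one)

lemma fps_deriv_taylor: "fps_deriv (taylor \<delta> a) = taylor \<delta> (\<delta> a)"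
proof (rule fps_ext)
  fix n
  have "of_nat (Suc n) * (z / fact (Suc n)) = z / fact n" for z :: 'k
    by (simp add: fact_Suc del: of_nat_Suc)
  thus "fps_nth (fps_deriv (taylor \<delta> a)) n = fps_nth (taylor \<delta> (\<delta> a)) n"
    by (simp add: taylor_def funpow_swap1)
qed

lemma taylor_mult: "taylor \<delta> (a * b) = taylor \<delta> a * taylor \<delta> b"
proof (rule fps_ext)
  fix n
  show "fps_nth (taylor \<delta> (a * b)) n = fps_nth (taylor \<delta> a * taylor \<delta> b) n"
  proof (induction n arbitrary: a b)
    case 0
    show ?case by (simp add: taylor_def)
  next
    case (Suc n)
    have "of_nat (Suc n) * fps_nth (taylor \<delta> (a * b)) (Suc n) = fps_nth (taylor \<delta> (\<delta> (a * b))) n"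
      by (simp flip: fps_deriv_taylor)
    also have "\<dots> = fps_nth (fps_deriv (taylor \<delta> a * taylor \<delta> b)) n"
      by (simp add: d_mult taylor_add Suc.IH fps_deriv_taylor)
    also have "\<dots> = of_nat (Suc n) * fps_nth (taylor \<delta> a * taylor \<delta> b) (Suc n)"
      by (simp only: fps_deriv_nth Suc_eq_plus1)
    finally show ?case by (simp del: of_nat_Suc)
  qed
qed

lemma twisted_action_fps: "twisted_action \<delta> (\<lambda>c F. taylor \<delta> c * F) fps_deriv"
  by unfold_locales (simp_all add: taylor_add taylor_mult taylor_one fps_deriv_taylor algebra_simps)

lemma left_module_fps: "left_module (twisted_ring \<delta>) (fps_module \<delta>)"
proof -
  interpret twisted_action \<delta> "\<lambda>c F. taylor \<delta> c * F" fps_deriv by (rule twisted_action_fps)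
  interpret R: ring "twisted_ring \<delta>" by (rule ring_twisted_ring)
  have "abelian_group (fps_module \<delta>)"
    by (rule abelian_groupI)
       (auto simp: fps_module_def algebra_simps intro: exI[of _ "- _"] right_minus left_minus)
  then interpret M: abelian_group "fps_module \<delta>" .
  show ?thesis
    by unfold_locales
       (auto simp: twisted_ring_def fps_module_def act_add_left act_add_right act_mult act_one)
qed

end

end

theory Submission
  imports Defs "HOL-Analysis.Urysohn"
begin

text \<open>A nonzero twisted polynomial acts surjectively on the series that are overconvergent at a radius
  \<open>t\<close> below the radius of \<open>\<delta>\<close>: slightly above \<open>t\<close> one of its terms dominates, this term is inverted without
  loss of norm because Taylor series are isometric multipliers and nonzero integers have absolute
  value \<open>1\<close>, and the other terms are a contractive perturbation. Left ideals being principal,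
  overconvergent solutions on a submodule therefore extend to the whole module.

  Call \<open>M\<close> pure if \<open>F_sol M = M\<close>. By the extension property pure modules are closed under submodules,
  quotients and extensions, and \<open>F_sol M\<close> is the largest pure submodule of \<open>M\<close>. If \<open>M\<close> is irreducible,
  a nonzero overconvergent solution is injective and the Gauss norm pulls back to a norm on \<open>M\<close> that
  bounds the spectral norm of \<open>T\<close>; conversely a small spectral norm of \<open>T\<close> makes all solutions
  overconvergent. Hence an irreducible module is pure exactly if \<open>T\<close> has spectral norm \<open>1 / r\<close>, and
  purity of \<open>M\<close> is a condition on its composition factors, namely the one that defines \<open>F_sp\<close>.\<close>


section \<open>Spectral norms\<close>

locale bounded_operator =
  fixes A :: "'a set" and \<nu> :: "'a \<Rightarrow> real" and f :: "'a \<Rightarrow> 'a"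
  assumes nonneg: "x \<in> A \<Longrightarrow> 0 \<le> \<nu> x"
    and closed: "x \<in> A \<Longrightarrow> f x \<in> A"
    and nontrivial: "\<exists>x\<in>A. \<nu> x \<noteq> 0"
    and bounded: "\<exists>C. \<forall>x\<in>A. \<nu> (f x) \<le> C * \<nu> x"
begin

definition geometric_growth :: "real \<Rightarrow> bool" where
  "geometric_growth \<beta> \<longleftrightarrow> (\<exists>C>0. \<forall>i. \<forall>x\<in>A. \<nu> ((f ^^ i) x) \<le> C * \<beta> ^ i * \<nu> x)"

lemma pow_closed: "x \<in> A \<Longrightarrow> (f ^^ i) x \<in> A"
  by (induction i) (auto simp: closed)

lemma pow_le:
  assumes "0 \<le> B" "\<And>x. x \<in> A \<Longrightarrow> \<nu> (f x) \<le> B * \<nu> x" "x \<in> A"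
  shows "\<nu> ((f ^^ i) x) \<le> B ^ i * \<nu> x"
proof (induction i)
  case (Suc i)
  have "\<nu> ((f ^^ Suc i) x) \<le> B * \<nu> ((f ^^ i) x)"
    using assms(2)[OF pow_closed[OF assms(3)]] by simp
  also have "\<dots> \<le> B * (B ^ i * \<nu> x)"
    using Suc assms(1) by (rule mult_left_mono)
  finally show ?case by (simp add: mult_ac)
qed simp

lemma pow_bounded:
  obtains B where "b \<le> B" "0 < B" "\<And>i x. x \<in> A \<Longrightarrow> \<nu> ((f ^^ i) x) \<le> B ^ i * \<nu> x"
proof -
  obtain C where C: "\<forall>x\<in>A. \<nu> (f x) \<le> C * \<nu> x" using bounded by blast
  define B where "B = max (max C b) 1"
  have "\<nu> (f x) \<le> B * \<nu> x" if "x \<in> A" for x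
    using C that mult_right_mono[of C B "\<nu> x"] nonneg[OF that] by (fastforce simp: B_def)
  moreover have "b \<le> B" "0 < B" by (auto simp: B_def)
  ultimately show ?thesis using that pow_le by (meson less_imp_le)
qed

lemma op_norm_upper:
  assumes "x \<in> A"
  shows "\<nu> ((f ^^ i) x) \<le> op_norm A \<nu> (f ^^ i) * \<nu> x"
proof -
  obtain B where B: "B > 0" "\<And>i x. x \<in> A \<Longrightarrow> \<nu> ((f ^^ i) x) \<le> B ^ i * \<nu> x"
    using pow_bounded by blast
  show ?thesis
  proof (cases "\<nu> x = 0")
    case True
    thus ?thesis using B(2)[OF assms, of i] by simp
  next
    case False
    have "bdd_above ((\<lambda>x. \<nu> ((f ^^ i) x) / \<nu> x) ` {x \<in> A. \<nu> x \<noteq> 0})"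
      using B nonneg
      by (intro bdd_aboveI2[where M = "B ^ i"]) (fastforce simp: field_simps order.strict_iff_order)
    hence "\<nu> ((f ^^ i) x) / \<nu> x \<le> op_norm A \<nu> (f ^^ i)"
      unfolding op_norm_def using assms False by (intro cSUP_upper) auto
    moreover have "\<nu> x > 0" using nonneg[OF assms] False by simp
    ultimately show ?thesis by (simp add: field_simps)
  qed
qed

lemma op_norm_nonneg: "0 \<le> op_norm A \<nu> (f ^^ i)"
proof -
  obtain x where x: "x \<in> A" "\<nu> x > 0"
    using nontrivial nonneg by (metis order.not_eq_order_implies_strict)
  have "0 \<le> op_norm A \<nu> (f ^^ i) * \<nu> x"
    using nonneg[OF pow_closed[OF x(1)]] op_norm_upper[OF x(1)] by (meson order.trans)
  thus ?thesis using x(2) by (simp add: zero_le_mult_iff)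
qed

lemma op_norm_least:
  assumes "\<And>x. x \<in> A \<Longrightarrow> \<nu> ((f ^^ i) x) \<le> C * \<nu> x"
  shows "op_norm A \<nu> (f ^^ i) \<le> C"
  unfolding op_norm_def
proof (rule cSUP_least)
  fix x assume x: "x \<in> {x \<in> A. \<nu> x \<noteq> 0}"
  hence "\<nu> x > 0" using nonneg[of x] by (auto simp: less_le)
  thus "\<nu> ((f ^^ i) x) / \<nu> x \<le> C" using assms[of x] x by (auto simp: divide_le_eq)
qed (use nontrivial in auto)

lemma spectral_norm_le_root:
  assumes "i \<ge> 1"
  shows "spectral_norm A \<nu> f \<le> op_norm A \<nu> (f ^^ i) powr (1 / real i)"
  unfolding spectral_norm_def
  by (rule cINF_lower) (use assms in \<open>auto intro!: bdd_belowI2[where m = 0]\<close>)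

lemma spectral_norm_nonneg: "0 \<le> spectral_norm A \<nu> f"
  unfolding spectral_norm_def by (rule cINF_greatest) auto

lemma spectral_norm_le_if_geometric_growth:
  assumes "0 \<le> \<beta>" and "geometric_growth \<beta>"
  shows "spectral_norm A \<nu> f \<le> \<beta>"
proof -
  obtain C where C: "C > 0" "\<And>i x. x \<in> A \<Longrightarrow> \<nu> ((f ^^ i) x) \<le> C * \<beta> ^ i * \<nu> x"
    using assms(2) by (auto simp: geometric_growth_def)
  have "(\<lambda>n. C powr (1 / real n) * \<beta>) \<longlonglongrightarrow> C powr 0 * \<beta>"
    by (intro tendsto_intros lim_1_over_n) (use C in auto)
  hence lim: "(\<lambda>n. C powr (1 / real n) * \<beta>) \<longlonglongrightarrow> \<beta>" using C(1) by simp
  have "spectral_norm A \<nu> f \<le> C powr (1 / real n) * \<beta>" if n: "n \<ge> 1" for n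
  proof -
    have "spectral_norm A \<nu> f \<le> op_norm A \<nu> (f ^^ n) powr (1 / real n)"
      by (rule spectral_norm_le_root[OF n])
    also have "\<dots> \<le> (C * \<beta> ^ n) powr (1 / real n)"
      using op_norm_least[OF C(2)] op_norm_nonneg by (intro powr_mono2) auto
    also have "\<dots> = C powr (1 / real n) * \<beta>"
    proof (cases "\<beta> = 0")
      case False
      hence "(\<beta> ^ n) powr (1 / real n) = \<beta>"
        using assms(1) n by (simp add: powr_powr flip: powr_realpow)
      thus ?thesis using assms(1) C(1) by (simp add: powr_mult)
    qed (use n in \<open>simp add: zero_power\<close>)
    finally show ?thesis .
  qed
  thus ?thesis by (intro LIMSEQ_le_const[OF lim]) blast
qed

lemma geometric_growth_if_power_le:
  assumes k: "1 \<le> k" and \<beta>: "0 < \<beta>" and step: "\<And>x. x \<in> A \<Longrightarrow> \<nu> ((f ^^ k) x) \<le> \<beta> ^ k * \<nu> x"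
  shows "geometric_growth \<beta>"
proof -
  obtain B where B: "\<beta> \<le> B" "0 < B" "\<And>i x. x \<in> A \<Longrightarrow> \<nu> ((f ^^ i) x) \<le> B ^ i * \<nu> x"
    using pow_bounded by blast
  interpret k: bounded_operator A \<nu> "f ^^ k"
    by unfold_locales (use nonneg pow_closed nontrivial step in blast)+
  have blocks: "\<nu> ((f ^^ (q * k)) x) \<le> \<beta> ^ (q * k) * \<nu> x" if "x \<in> A" for q x
    using k.pow_le[OF _ step that, of q] \<beta>
    by (simp add: funpow_mult mult.commute[of q] power_mult)
  have "\<nu> ((f ^^ i) x) \<le> (B / \<beta>) ^ k * \<beta> ^ i * \<nu> x" if x: "x \<in> A" for i x
  proof -
    define m where "m = i mod k"
    have i: "i = m + i div k * k" by (simp add: m_def)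
    have m: "m < k" using k by (simp add: m_def)
    have "\<nu> ((f ^^ i) x) \<le> B ^ m * \<nu> ((f ^^ (i div k * k)) x)"
      using B(3)[OF pow_closed[OF x], of m "i div k * k"] i by (metis comp_apply funpow_add)
    also have "\<dots> \<le> B ^ m * (\<beta> ^ (i div k * k) * \<nu> x)"
      using blocks[OF x] B by (intro mult_left_mono) auto
    also have "B ^ m = (B / \<beta>) ^ m * \<beta> ^ m" using \<beta> by (simp add: field_simps)
    also have "(B / \<beta>) ^ m * \<beta> ^ m * (\<beta> ^ (i div k * k) * \<nu> x) = (B / \<beta>) ^ m * (\<beta> ^ i * \<nu> x)"
      using i by (metis (no_types, lifting) mult.assoc power_add)
    also have "\<dots> \<le> (B / \<beta>) ^ k * (\<beta> ^ i * \<nu> x)"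
      using B \<beta> m nonneg[OF x] by (intro mult_right_mono power_increasing) auto
    finally show ?thesis by (simp add: mult_ac)
  qed
  moreover have "(B / \<beta>) ^ k > 0" using B \<beta> by simp
  ultimately show ?thesis unfolding geometric_growth_def by blast
qed

lemma geometric_growth_if_spectral_norm_less:
  assumes "spectral_norm A \<nu> f < \<beta>"
  shows "geometric_growth \<beta>"
proof -
  have \<beta>: "\<beta> > 0" using spectral_norm_nonneg assms by linarith
  obtain k where k: "k \<ge> 1" "op_norm A \<nu> (f ^^ k) powr (1 / real k) < \<beta>"
    using assms unfolding spectral_norm_def
    by (subst (asm) cINF_less_iff) (auto intro!: bdd_belowI2[where m = 0])
  have "op_norm A \<nu> (f ^^ k) \<le> \<beta> ^ k"
  proof (cases "op_norm A \<nu> (f ^^ k) = 0")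
    case False
    hence "op_norm A \<nu> (f ^^ k) > 0" using op_norm_nonneg[of k] by linarith
    hence "op_norm A \<nu> (f ^^ k) = (op_norm A \<nu> (f ^^ k) powr (1 / real k)) ^ k"
      using k(1) by (simp add: powr_powr flip: powr_realpow)
    also have "\<dots> \<le> \<beta> ^ k" using k(2) by (intro power_mono) auto
    finally show ?thesis .
  qed (use \<beta> in simp)
  hence "\<nu> ((f ^^ k) x) \<le> \<beta> ^ k * \<nu> x" if "x \<in> A" for x
    using op_norm_upper[OF that, of k] mult_right_mono[OF _ nonneg[OF that]] by (meson order.trans)
  thus ?thesis by (rule geometric_growth_if_power_le[OF k(1) \<beta>])
qed

end


section \<open>Non-archimedean fields\<close>

locale nonarch_field =
  fixes v :: "'k::field \<Rightarrow> real"
  assumes v_nonneg: "0 \<le> v x"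
    and v_eq_0_iff [simp]: "v x = 0 \<longleftrightarrow> x = 0"
    and v_mult: "v (x * y) = v x * v y"
    and v_ultrametric: "v (x + y) \<le> max (v x) (v y)"
begin

lemma v_0 [simp]: "v 0 = 0"
  by simp

lemma v_pos: "x \<noteq> 0 \<Longrightarrow> v x > 0"
  using v_nonneg[of x] v_eq_0_iff[of x] by linarith

lemma v_1 [simp]: "v 1 = 1"
proof -
  have "v 1 * v 1 = v 1" by (simp flip: v_mult)
  moreover have "v 1 \<noteq> 0" by simp
  ultimately show ?thesis by (metis mult_cancel_left1)
qed

lemma v_minus [simp]: "v (- x) = v x"
proof -
  have "(v (- 1))\<^sup>2 = 1" by (simp add: power2_eq_square flip: v_mult)
  hence "v (- 1) = 1" using v_nonneg[of "- 1"] by (simp add: power2_eq_1_iff)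
  thus ?thesis using v_mult[of "- 1" x] by simp
qed

lemma v_add_le: "v x \<le> B \<Longrightarrow> v y \<le> B \<Longrightarrow> v (x + y) \<le> B"
  using v_ultrametric[of x y] by linarith

lemma v_add_less: "v x < B \<Longrightarrow> v y < B \<Longrightarrow> v (x + y) < B"
  using v_ultrametric[of x y] by linarith

lemma v_diff_commute: "v (x - y) = v (y - x)"
  using v_minus[of "x - y"] by simp

lemma v_inverse: "v (inverse x) = inverse (v x)"
proof (cases "x = 0")
  case False
  hence "v x * v (inverse x) = 1" by (simp flip: v_mult)
  thus ?thesis by (metis inverse_unique)
qed simp

lemma v_divide: "v (x / y) = v x / v y"
  by (simp add: divide_inverse v_mult v_inverse)

lemma v_sum_le:
  assumes "\<And>i. i \<in> I \<Longrightarrow> v (f i) \<le> B" "0 \<le> B"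
  shows "v (sum f I) \<le> B"
  using assms by (induction I rule: infinite_finite_induct) (auto intro: v_add_le)

lemma v_sum_less:
  assumes "finite I" "\<And>i. i \<in> I \<Longrightarrow> v (f i) < B" "0 < B"
  shows "v (sum f I) < B"
  using assms by (induction I rule: finite_induct) (auto intro: v_add_less)

lemma v_of_nat_le_1: "v (of_nat n) \<le> 1"
  by (induction n) (auto intro: v_add_le)

lemma Metric_space_v: "Metric_space UNIV (\<lambda>x y. v (x - y))"
proof
  fix x y z
  show "v (x - z) \<le> v (x - y) + v (y - z)"
    using v_ultrametric[of "x - y" "y - z"] v_nonneg[of "x - y"] v_nonneg[of "y - z"] by simp
qed (simp_all add: v_nonneg v_diff_commute)

lemma one_residue_field: "\<one>\<^bsub>residue_field v\<^esub> = {x. v (x - 1) < 1}"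
proof -
  have "\<one>\<^bsub>residue_field v\<^esub> = (\<lambda>h. h + 1) ` {x. v x < 1}"
    by (auto simp: residue_field_def FactRing_def a_r_coset_def r_coset_def valuation_ring_def)
  also have "\<dots> = {x. v (x - 1) < 1}"
    by (auto intro!: image_eqI[of _ _ "_ - 1"])
  finally show ?thesis .
qed

lemma residue_field_add_one:
  "{x. v (x - a) < 1} \<oplus>\<^bsub>residue_field v\<^esub> {x. v (x - 1) < 1} = {x. v (x - (a + 1)) < 1}"
proof -
  have "{x. v (x - a) < 1} \<oplus>\<^bsub>residue_field v\<^esub> {x. v (x - 1) < 1}
      = (\<Union>h\<in>{x. v (x - a) < 1}. \<Union>k\<in>{x. v (x - 1) < 1}. {h + k})"
    by (simp add: residue_field_def FactRing_def set_add_def set_mult_def valuation_ring_def)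
  also have "\<dots> = {x. v (x - (a + 1)) < 1}"
  proof (intro equalityI subsetI)
    fix x assume "x \<in> (\<Union>h\<in>{x. v (x - a) < 1}. \<Union>k\<in>{x. v (x - 1) < 1}. {h + k})"
    then obtain h k where "v (h - a) < 1" "v (k - 1) < 1" "x = h + k" by auto
    thus "x \<in> {x. v (x - (a + 1)) < 1}"
      using v_add_less[of "h - a" 1 "k - 1"] by (simp add: algebra_simps)
  next
    fix x assume "x \<in> {x. v (x - (a + 1)) < 1}"
    thus "x \<in> (\<Union>h\<in>{x. v (x - a) < 1}. \<Union>k\<in>{x. v (x - 1) < 1}. {h + k})"
      by (intro UN_I[of "x - 1"] UN_I[of 1]) (auto simp: algebra_simps simp del: one_add_one)
  qed
  finally show ?thesis .
qed

lemma residue_field_of_nat: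
  "add_pow (residue_field v) n \<one>\<^bsub>residue_field v\<^esub> = {x. v (x - of_nat n) < 1}"
proof (induction n)
  case 0
  show ?case by (auto simp: add_pow_def nat_pow_def residue_field_def FactRing_def)
next
  case (Suc n)
  have "add_pow (residue_field v) (Suc n) \<one>\<^bsub>residue_field v\<^esub>
      = add_pow (residue_field v) n \<one>\<^bsub>residue_field v\<^esub> \<oplus>\<^bsub>residue_field v\<^esub> \<one>\<^bsub>residue_field v\<^esub>"
    by (simp add: add_pow_def nat_pow_def)
  thus ?case unfolding Suc by (simp add: one_residue_field residue_field_add_one add.commute)
qed

lemma v_of_nat_residue_char_0:
  assumes "residue_char v = 0" "0 < n"
  shows "v (of_nat n) = 1"
proof (rule ccontr)
  assume "v (of_nat n) \<noteq> 1"
  hence less: "v (of_nat n) < 1" using v_of_nat_le_1[of n] by simp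
  have "{x. v (x - of_nat n) < 1} = {x. v x < 1}"
    using v_add_less[OF _ less] v_add_less[of _ 1 "- of_nat n"] less by fastforce
  hence "add_pow (residue_field v) n \<one>\<^bsub>residue_field v\<^esub> = \<zero>\<^bsub>residue_field v\<^esub>"
    unfolding residue_field_of_nat by (simp add: residue_field_def FactRing_def)
  hence "residue_char v dvd n" unfolding residue_char_def ring_char_def by (intro Gcd_dvd) simp
  with assms show False by simp
qed

end

locale complete_nonarch_field = nonarch_field v for v :: "'k::field \<Rightarrow> real" +
  assumes v_complete: "Metric_space.mcomplete UNIV (\<lambda>x y. v (x - y))"
begin

lemma Cauchy_convergent:
  fixes x :: "nat \<Rightarrow> 'k"
  assumes "\<And>e. e > 0 \<Longrightarrow> \<exists>N. \<forall>m\<ge>N. \<forall>n\<ge>N. v (x m - x n) < e"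
  obtains l where "(\<lambda>n. v (x n - l)) \<longlonglongrightarrow> 0"
proof -
  interpret Metric_space UNIV "\<lambda>x y. v (x - y)" by (rule Metric_space_v)
  have "MCauchy x" unfolding MCauchy_def using assms by fastforce
  then obtain l where "limitin mtopology x l sequentially"
    using v_complete unfolding mcomplete_def by blast
  thus ?thesis using that by (simp add: limitin_metric_dist_null)
qed

end

sublocale complete_nonarch_diff_field \<subseteq> complete_nonarch_field v
  by unfold_locales (use abs_nonneg abs_eq_0 abs_mult abs_ultrametric complete in auto)

context complete_nonarch_diff_field
begin

lemma bounded_operator_derivation: "bounded_operator UNIV v \<delta>"
  by unfold_locales (use v_nonneg d_bounded in \<open>auto intro: exI[of _ 1]\<close>)

sublocale derivation: bounded_operator UNIV v \<delta>
  by (rule bounded_operator_derivation)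

abbreviation \<sigma> :: real where "\<sigma> \<equiv> spectral_norm UNIV v \<delta>"

lemma derivation_pow_growth:
  assumes "0 < t" "t * \<sigma> < 1"
  obtains q C where "0 < q" "q < 1" "\<And>i x. v ((\<delta> ^^ i) x) * t ^ i \<le> C * q ^ i * v x"
proof -
  have "\<sigma> < 1 / t" using assms by (simp add: field_simps)
  then obtain \<beta> where \<beta>: "\<sigma> < \<beta>" "\<beta> < 1 / t" using dense by blast
  have pos: "\<beta> > 0" using derivation.spectral_norm_nonneg \<beta> by linarith
  obtain C where C: "C > 0" "\<And>i x. v ((\<delta> ^^ i) x) \<le> C * \<beta> ^ i * v x"
    using derivation.geometric_growth_if_spectral_norm_less[OF \<beta>(1)]
    by (auto simp: derivation.geometric_growth_def)
  have "v ((\<delta> ^^ i) x) * t ^ i \<le> C * (\<beta> * t) ^ i * v x" for i x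
    using mult_right_mono[OF C(2)[of i x], of "t ^ i"] assms(1)
    by (simp add: power_mult_distrib mult_ac)
  moreover have "0 < \<beta> * t" "\<beta> * t < 1" using pos assms(1) \<beta>(2) by (auto simp: field_simps)
  ultimately show ?thesis using that by blast
qed

lemma radius_margin:
  assumes "t * \<sigma> < 1" "t < s'"
  obtains s where "t < s" "s < s'" "s * \<sigma> < 1"
proof (cases "\<sigma> = 0")
  case True
  thus ?thesis using dense[OF assms(2)] that by auto
next
  case False
  hence pos: "\<sigma> > 0" using derivation.spectral_norm_nonneg by simp
  hence "t < 1 / \<sigma>" using assms by (simp add: field_simps)
  then obtain s where "t < s" "s < min s' (1 / \<sigma>)"
    using assms(2) dense[of t "min s' (1 / \<sigma>)"] by auto
  thus ?thesis using that pos by (simp add: field_simps)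
qed

end


section \<open>Gauss norms of power series\<close>

definition gauss_bound :: "('k::zero \<Rightarrow> real) \<Rightarrow> real \<Rightarrow> real \<Rightarrow> 'k fps \<Rightarrow> bool" where
  "gauss_bound v s C F \<longleftrightarrow> (\<forall>i. v (fps_nth F i) * s ^ i \<le> C)"

definition gauss_norm :: "('k::zero \<Rightarrow> real) \<Rightarrow> real \<Rightarrow> 'k fps \<Rightarrow> real" where
  "gauss_norm v s F = (if \<exists>C. gauss_bound v s C F then SUP i. v (fps_nth F i) * s ^ i else 0)"

lemma gauss_boundD: "gauss_bound v s C F \<Longrightarrow> v (fps_nth F i) * s ^ i \<le> C"
  by (simp add: gauss_bound_def)

lemma gauss_bound_mono: "gauss_bound v s C F \<Longrightarrow> C \<le> D \<Longrightarrow> gauss_bound v s D F"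
  unfolding gauss_bound_def by (meson order.trans)

lemma gauss_bound_gauss_norm:
  assumes "gauss_bound v s C F"
  shows "gauss_bound v s (gauss_norm v s F) F"
proof -
  have "bdd_above (range (\<lambda>i. v (fps_nth F i) * s ^ i))"
    using assms by (auto simp: gauss_bound_def bdd_above_def)
  thus ?thesis using assms by (auto simp: gauss_norm_def gauss_bound_def intro: cSUP_upper)
qed

lemma gauss_norm_le: "gauss_bound v s C F \<Longrightarrow> gauss_norm v s F \<le> C"
  by (auto simp: gauss_norm_def gauss_bound_def intro: cSUP_least)

lemma fps_bounded_iff: "F \<in> fps_bounded v s \<longleftrightarrow> (\<exists>C. gauss_bound v s C F)"
  by (auto simp: fps_bounded_def gauss_bound_def bdd_above_def)

lemma fps_overconv_iff: "F \<in> fps_overconv v t \<longleftrightarrow> (\<exists>s>t. \<exists>C. gauss_bound v s C F)"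
  by (auto simp: fps_overconv_def fps_bounded_iff)

context nonarch_field
begin

lemma gauss_bound_nonneg: "gauss_bound v s C F \<Longrightarrow> 0 \<le> C"
  using gauss_boundD[of v s C F 0] v_nonneg[of "fps_nth F 0"] by simp

lemma gauss_norm_nonneg: "0 \<le> gauss_norm v s F"
proof (cases "\<exists>C. gauss_bound v s C F")
  case True
  thus ?thesis using gauss_bound_nonneg[OF gauss_bound_gauss_norm] by blast
qed (simp add: gauss_norm_def)

lemma gauss_bound_0: "gauss_bound v s 0 0"
  by (simp add: gauss_bound_def)

lemma gauss_bound_coeff_le: "0 < s \<Longrightarrow> gauss_bound v s C F \<longleftrightarrow> (\<forall>i. v (fps_nth F i) \<le> C / s ^ i)"
  by (simp add: gauss_bound_def field_simps)

lemma gauss_bound_0_iff: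
  assumes "0 < s"
  shows "gauss_bound v s 0 F \<longleftrightarrow> F = 0"
proof
  assume "gauss_bound v s 0 F"
  hence "v (fps_nth F i) \<le> 0" for i using assms by (simp add: gauss_bound_coeff_le)
  hence "fps_nth F i = 0" for i using v_nonneg[of "fps_nth F i"] by (metis antisym v_eq_0_iff)
  thus "F = 0" by (simp add: fps_ext)
qed (simp add: gauss_bound_0)

lemma gauss_bound_add:
  assumes "0 < s" "gauss_bound v s C F" "gauss_bound v s D G"
  shows "gauss_bound v s (max C D) (F + G)"
  using gauss_bound_mono[OF assms(2) max.cobounded1] gauss_bound_mono[OF assms(3) max.cobounded2]
  unfolding gauss_bound_coeff_le[OF assms(1)] by (simp add: v_add_le)

lemma gauss_bound_uminus: "gauss_bound v s C F \<Longrightarrow> gauss_bound v s C (- F)"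
  by (simp add: gauss_bound_def)

lemma gauss_norm_uminus: "gauss_norm v s (- F) = gauss_norm v s F"
  by (auto simp: gauss_norm_def gauss_bound_def)

lemma gauss_bound_diff:
  assumes "0 < s" "gauss_bound v s C F" "gauss_bound v s D G"
  shows "gauss_bound v s (max C D) (F - G)"
  using gauss_bound_add[OF assms(1,2) gauss_bound_uminus[OF assms(3)]] by simp

lemma gauss_bound_sum:
  assumes "0 < s" "0 \<le> C" "\<And>i. i \<in> I \<Longrightarrow> gauss_bound v s C (f i)"
  shows "gauss_bound v s C (sum f I)"
  using assms(3)
proof (induction I rule: infinite_finite_induct)
  case (insert i I)
  thus ?case using gauss_bound_add[OF assms(1), of C "f i" C] by simp
qed (use assms(2) in \<open>auto intro: gauss_bound_mono[OF gauss_bound_0]\<close>)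

lemma gauss_bound_mult:
  assumes s: "0 < s" and F: "gauss_bound v s C F" and G: "gauss_bound v s D G"
  shows "gauss_bound v s (C * D) (F * G)"
  unfolding gauss_bound_coeff_le[OF s]
proof
  fix n
  have "v (fps_nth F i * fps_nth G (n - i)) \<le> C * D / s ^ n" if "i \<in> {0..n}" for i
  proof -
    have "v (fps_nth F i * fps_nth G (n - i)) * s ^ n
        = (v (fps_nth F i) * s ^ i) * (v (fps_nth G (n - i)) * s ^ (n - i))"
      using that power_add[of s i "n - i"] by (simp add: v_mult mult_ac)
    also have "\<dots> \<le> C * D"
      using F G s gauss_bound_nonneg[OF F] by (intro mult_mono gauss_boundD) (auto simp: v_nonneg)
    finally show ?thesis using s by (simp add: field_simps)
  qed
  thus "v (fps_nth (F * G) n) \<le> C * D / s ^ n"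
    unfolding fps_mult_nth using s gauss_bound_nonneg[OF F] gauss_bound_nonneg[OF G]
    by (intro v_sum_le) auto
qed

lemma gauss_bound_deriv:
  assumes "0 < s" "gauss_bound v s C F"
  shows "gauss_bound v s (C / s) (fps_deriv F)"
  unfolding gauss_bound_def
proof
  fix i
  have "v (of_nat (Suc i)) * v (fps_nth F (Suc i)) \<le> v (fps_nth F (Suc i))"
    using mult_right_mono[OF v_of_nat_le_1 v_nonneg] by (metis mult_1)
  also have "\<dots> \<le> C / s ^ Suc i"
    using assms gauss_bound_coeff_le by blast
  finally show "v (fps_nth (fps_deriv F) i) * s ^ i \<le> C / s"
    using assms(1) by (simp add: v_mult field_simps del: of_nat_Suc)
qed

lemma gauss_bound_deriv_pow:
  assumes "0 < s" "gauss_bound v s C F"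
  shows "gauss_bound v s (C / s ^ k) ((fps_deriv ^^ k) F)"
proof (induction k)
  case (Suc k)
  thus ?case using gauss_bound_deriv[OF assms(1) Suc] by (simp add: field_simps)
qed (use assms in auto)

lemma gauss_bound_antimono:
  assumes "0 < s" "s \<le> s'" "gauss_bound v s' C F"
  shows "gauss_bound v s C F"
  unfolding gauss_bound_def
proof
  fix i
  have "v (fps_nth F i) * s ^ i \<le> v (fps_nth F i) * s' ^ i"
    using assms by (intro mult_left_mono power_mono v_nonneg) auto
  also have "\<dots> \<le> C" using assms(3) by (rule gauss_boundD)
  finally show "v (fps_nth F i) * s ^ i \<le> C" .
qed

lemma gauss_bound_diff_gauss_norm:
  assumes "0 < s" "gauss_bound v s C F" "gauss_bound v s D G"
  shows "gauss_bound v s (gauss_norm v s (F - G)) (F - G)"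
  by (rule gauss_bound_gauss_norm[OF gauss_bound_diff[OF assms]])

lemma Metric_space_gauss_norm:
  assumes s: "0 < s"
  shows "Metric_space {F. \<exists>C. gauss_bound v s C F} (\<lambda>F G. gauss_norm v s (F - G))"
proof
  show "gauss_norm v s (F - G) = gauss_norm v s (G - F)" for F G :: "'k fps"
    using gauss_norm_uminus[of s "F - G"] by simp
  fix F G H :: "'k fps"
  assume "F \<in> {F. \<exists>C. gauss_bound v s C F}" "G \<in> {F. \<exists>C. gauss_bound v s C F}"
  then obtain C D where F: "gauss_bound v s C F" and G: "gauss_bound v s D G" by blast
  note FG = gauss_bound_diff_gauss_norm[OF s F G]
  show "gauss_norm v s (F - G) = 0 \<longleftrightarrow> F = G"
    using FG gauss_norm_le[OF gauss_bound_0, of s] gauss_norm_nonneg[of s 0]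
    by (auto simp: gauss_bound_0_iff[OF s])
  assume "H \<in> {F. \<exists>C. gauss_bound v s C F}"
  then obtain E where H: "gauss_bound v s E H" by blast
  have "gauss_bound v s (gauss_norm v s (F - G) + gauss_norm v s (G - H)) ((F - G) + (G - H))"
    using gauss_norm_nonneg
    by (intro gauss_bound_mono[OF gauss_bound_add[OF s FG gauss_bound_diff_gauss_norm[OF s G H]]]) auto
  thus "gauss_norm v s (F - H) \<le> gauss_norm v s (F - G) + gauss_norm v s (G - H)"
    using gauss_norm_le by fastforce
qed (rule gauss_norm_nonneg)

end

context complete_nonarch_field
begin

lemma gauss_Cauchy_limit:
  fixes S :: "nat \<Rightarrow> 'k fps"
  assumes s: "0 < s"
    and Cauchy: "\<And>e. e > 0 \<Longrightarrow> \<exists>N. \<forall>m\<ge>N. \<forall>n\<ge>N. gauss_bound v s e (S m - S n)"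
  obtains F where "\<And>e. e > 0 \<Longrightarrow> \<exists>N. \<forall>n\<ge>N. gauss_bound v s e (S n - F)"
proof -
  have "\<exists>l. (\<lambda>n. v (fps_nth (S n) i - l)) \<longlonglongrightarrow> 0" for i
  proof (rule Cauchy_convergent[of "\<lambda>n. fps_nth (S n) i"])
    fix e :: real assume "e > 0"
    hence "e / 2 * s ^ i > 0" using s by simp
    then obtain N where "\<forall>m\<ge>N. \<forall>n\<ge>N. gauss_bound v s (e / 2 * s ^ i) (S m - S n)"
      using Cauchy by blast
    hence "v (fps_nth (S m) i - fps_nth (S n) i) \<le> e / 2" if "m \<ge> N" "n \<ge> N" for m n
      using gauss_boundD[of v s "e / 2 * s ^ i" "S m - S n" i] that s by simp
    moreover have "e / 2 < e" using \<open>e > 0\<close> by simp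
    ultimately show "\<exists>N. \<forall>m\<ge>N. \<forall>n\<ge>N. v (fps_nth (S m) i - fps_nth (S n) i) < e"
      by (meson le_less_trans)
  qed blast
  then obtain l where l: "\<And>i. (\<lambda>n. v (fps_nth (S n) i - l i)) \<longlonglongrightarrow> 0" by metis
  have "\<exists>N. \<forall>n\<ge>N. gauss_bound v s e (S n - Abs_fps l)" if e: "e > 0" for e
  proof -
    obtain N where N: "\<forall>m\<ge>N. \<forall>n\<ge>N. gauss_bound v s e (S m - S n)" using Cauchy[OF e] by blast
    have "v (fps_nth (S m) i - l i) \<le> e / s ^ i" if m: "m \<ge> N" for m i
    proof -
      have "e / s ^ i > 0" using e s by simp
      from order_tendstoD(2)[OF l this] obtain n where n: "n \<ge> N" "v (fps_nth (S n) i - l i) < e / s ^ i"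
        unfolding eventually_sequentially by (meson nle_le)
      have "v (fps_nth (S m) i - fps_nth (S n) i) \<le> e / s ^ i"
        using N m n(1) gauss_bound_coeff_le[OF s, of e "S m - S n"] by simp
      from v_add_le[OF this less_imp_le[OF n(2)]] show ?thesis by simp
    qed
    thus ?thesis by (auto simp: gauss_bound_coeff_le[OF s])
  qed
  thus ?thesis using that by blast
qed

lemma mcomplete_gauss_norm:
  assumes s: "0 < s"
  shows "Metric_space.mcomplete {F. \<exists>C. gauss_bound v s C F} (\<lambda>F G. gauss_norm v s (F - G))"
proof -
  interpret Metric_space "{F. \<exists>C. gauss_bound v s C F}" "\<lambda>F G. gauss_norm v s (F - G)"
    by (rule Metric_space_gauss_norm[OF s])
  show ?thesis
    unfolding mcomplete_def
  proof (intro allI impI)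
    fix S assume S: "MCauchy S"
    have S_bounded: "\<exists>C. gauss_bound v s C (S n)" for n
      using S by (auto simp: MCauchy_def)
    have "\<exists>N. \<forall>m\<ge>N. \<forall>n\<ge>N. gauss_bound v s e (S m - S n)" if "e > 0" for e
      using S that S_bounded gauss_bound_diff_gauss_norm[OF s] unfolding MCauchy_def
      by (meson gauss_bound_mono less_imp_le)
    then obtain F where F: "\<And>e. e > 0 \<Longrightarrow> \<exists>N. \<forall>n\<ge>N. gauss_bound v s e (S n - F)"
      using gauss_Cauchy_limit[OF s] by blast
    obtain n where n: "gauss_bound v s 1 (S n - F)" using F[of 1] by auto
    obtain C where "gauss_bound v s C (S n)" using S_bounded by blast
    hence "gauss_bound v s (max C 1) (S n - (S n - F))"
      using n by (intro gauss_bound_diff[OF s])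
    hence "gauss_bound v s (max C 1) F" by simp
    moreover have "\<exists>N. \<forall>n\<ge>N. gauss_norm v s (S n - F) < e" if "e > 0" for e
      using F[of "e / 2"] gauss_norm_le that
      by (metis field_sum_of_halves half_gt_zero less_add_same_cancel1 order.strict_trans1)
    ultimately have "limitin mtopology S F sequentially"
      using S_bounded by (auto simp: limitin_metric eventually_sequentially)
    thus "\<exists>F. limitin mtopology S F sequentially" by blast
  qed
qed

lemma gauss_contraction_fixpoint:
  assumes s: "0 < s" and "\<theta> < 1"
    and L_diff: "\<And>F G. L (F - G) = L F - L G"
    and L: "\<And>C F. gauss_bound v s C F \<Longrightarrow> gauss_bound v s (\<theta> * C) (L F)"
    and H: "gauss_bound v s C H"
  obtains D F where "gauss_bound v s D F" "F = H + L F"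
proof -
  let ?B = "{F. \<exists>C. gauss_bound v s C F}"
  interpret Metric_space ?B "\<lambda>F G. gauss_norm v s (F - G)" by (rule Metric_space_gauss_norm[OF s])
  obtain F where "F \<in> ?B" "H + L F = F"
  proof (rule Banach_fixedpoint_thm[OF mcomplete_gauss_norm[OF s] _ _ assms(2)])
    show "?B \<noteq> {}" using H by blast
    show "(\<lambda>F. H + L F) \<in> ?B \<rightarrow> ?B"
    proof
      fix F assume "F \<in> ?B"
      then obtain D where "gauss_bound v s D F" by blast
      hence "gauss_bound v s (max C (\<theta> * D)) (H + L F)"
        by (intro gauss_bound_add[OF s H] L)
      thus "H + L F \<in> ?B" by blast
    qed
    fix F G assume "F \<in> ?B" "G \<in> ?B"
    hence "gauss_bound v s (\<theta> * gauss_norm v s (F - G)) (L (F - G))"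
      using L gauss_bound_diff_gauss_norm[OF s] by blast
    thus "gauss_norm v s (H + L F - (H + L G)) \<le> \<theta> * gauss_norm v s (F - G)"
      by (simp add: L_diff gauss_norm_le)
  qed
  thus ?thesis using that by auto
qed

lemma gauss_perturbation_surj:
  fixes A R B :: "'k fps \<Rightarrow> 'k fps"
  assumes s: "0 < s" and \<theta>: "\<theta> < 1"
    and right_inverse: "\<And>F. A (R F) = F"
    and R_diff: "\<And>F G. R (F - G) = R F - R G" and B_diff: "\<And>F G. B (F - G) = B F - B G"
    and RB: "\<And>C F. gauss_bound v s C F \<Longrightarrow> gauss_bound v s (\<theta> * C) (R (B F))"
    and RG: "gauss_bound v s C (R G)"
  obtains D F where "gauss_bound v s D F" "A F + B F = G"
proof -
  obtain D F where F: "gauss_bound v s D F" "F = R G + - R (B F)"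
  proof (rule gauss_contraction_fixpoint[OF s \<theta> _ _ RG, of "\<lambda>F. - R (B F)"])
    show "- R (B (F - G)) = - R (B F) - - R (B G)" for F G by (simp add: B_diff R_diff)
  qed (simp_all add: RB gauss_bound_uminus)
  have "F = R (G - B F)" using F(2) by (simp add: R_diff)
  hence "A F = G - B F" using right_inverse by metis
  thus ?thesis using that F(1) by simp
qed

end

lemma null_sequence_first_max:
  fixes a :: "nat \<Rightarrow> real"
  assumes "a \<longlonglongrightarrow> 0" "a 0 > 0"
  obtains i where "\<And>j. a j \<le> a i" "\<And>j. j < i \<Longrightarrow> a j < a i"
proof -
  obtain N where N: "\<And>n. n \<ge> N \<Longrightarrow> a n < a 0"
    using order_tendstoD(2)[OF assms] by (auto simp: eventually_sequentially)
  define m where "m = Max (a ` {..N})"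
  have m_in: "m \<in> a ` {..N}" unfolding m_def by (rule Max_in) auto
  have m_ge: "a j \<le> m" for j
  proof (cases "j \<le> N")
    case False
    hence "a j < a 0" by (simp add: N)
    also have "a 0 \<le> m" unfolding m_def by (rule Max_ge) auto
    finally show ?thesis by simp
  qed (simp add: m_def)
  define i where "i = (LEAST i. a i = m)"
  have i: "a i = m" unfolding i_def by (rule LeastI_ex) (use m_in in auto)
  show ?thesis
  proof (rule that)
    show "a j \<le> a i" for j using m_ge i by simp
    show "a j < a i" if "j < i" for j
      using m_ge[of j] not_less_Least[OF that[unfolded i_def]] i by linarith
  qed
qed

lemma mult_less_mult_at_first_max:
  fixes a b :: "nat \<Rightarrow> real"
  assumes a: "0 < a i" "\<And>k. 0 \<le> a k" "\<And>k. a k \<le> a i" "\<And>k. k < i \<Longrightarrow> a k < a i"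
    and b: "0 < b j" "\<And>k. 0 \<le> b k" "\<And>k. b k \<le> b j" "\<And>k. k < j \<Longrightarrow> b k < b j"
    and k: "k \<le> i + j" "k \<noteq> i"
  shows "a k * b (i + j - k) < a i * b j"
proof (cases "k < i")
  case True
  have "a k * b (i + j - k) \<le> a k * b j" by (rule mult_left_mono[OF b(3) a(2)])
  also have "\<dots> < a i * b j" by (rule mult_strict_right_mono[OF a(4)[OF True] b(1)])
  finally show ?thesis .
next
  case False
  have "a k * b (i + j - k) \<le> a i * b (i + j - k)" by (rule mult_right_mono[OF a(3) b(2)])
  also have "\<dots> < a i * b j" by (rule mult_strict_left_mono[OF b(4) a(1)]) (use k False in auto)
  finally show ?thesis .
qed

context nonarch_field
begin

lemma fps_mult_nth_nonzero:
  fixes F G :: "'k fps"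
  assumes t: "0 < t"
    and F: "fps_nth F i \<noteq> 0" "\<And>k. v (fps_nth F k) * t ^ k \<le> v (fps_nth F i) * t ^ i"
      "\<And>k. k < i \<Longrightarrow> v (fps_nth F k) * t ^ k < v (fps_nth F i) * t ^ i"
    and G: "fps_nth G j \<noteq> 0" "\<And>k. v (fps_nth G k) * t ^ k \<le> v (fps_nth G j) * t ^ j"
      "\<And>k. k < j \<Longrightarrow> v (fps_nth G k) * t ^ k < v (fps_nth G j) * t ^ j"
  shows "fps_nth (F * G) (i + j) \<noteq> 0"
proof
  let ?a = "\<lambda>k. v (fps_nth F k) * t ^ k" and ?b = "\<lambda>k. v (fps_nth G k) * t ^ k"
  let ?term = "\<lambda>k. fps_nth F k * fps_nth G (i + j - k)"
  have pos: "0 < ?a i" "0 < ?b j" using F(1) G(1) t by (simp_all add: v_pos)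
  have nonneg: "0 \<le> ?a k" "0 \<le> ?b k" for k using t by (simp_all add: v_nonneg)
  have v_term: "v (?term k) * t ^ (i + j) = ?a k * ?b (i + j - k)" if "k \<le> i + j" for k
    using that power_add[of t k "i + j - k"] by (simp add: v_mult mult_ac)
  have small: "v (?term k) < v (?term i)" if k: "k \<in> {0..i + j} - {i}" for k
  proof -
    have "?a k * ?b (i + j - k) < ?a i * ?b j"
      using k by (intro mult_less_mult_at_first_max pos nonneg F(2,3) G(2,3)) auto
    hence "v (?term k) * t ^ (i + j) < v (?term i) * t ^ (i + j)"
      using v_term[of k] v_term[of i] k by simp
    thus ?thesis using t by simp
  qed
  assume "fps_nth (F * G) (i + j) = 0"
  hence "(\<Sum>k\<in>{0..i + j} - {i}. ?term k) = - ?term i"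
    unfolding fps_mult_nth
    by (subst (asm) sum.remove[of _ i]) (auto simp: eq_neg_iff_add_eq_0 add.commute)
  moreover have "v (\<Sum>k\<in>{0..i + j} - {i}. ?term k) < v (?term i)"
    by (rule v_sum_less) (use small F(1) G(1) in \<open>auto intro: v_pos\<close>)
  ultimately show False by simp
qed

lemma fps_unit_dominated_by_constant_term:
  fixes F G :: "'k fps"
  assumes t: "0 < t" and FG: "F * G = 1"
    and F: "(\<lambda>i. v (fps_nth F i) * t ^ i) \<longlonglongrightarrow> 0"
    and G: "(\<lambda>i. v (fps_nth G i) * t ^ i) \<longlonglongrightarrow> 0"
  shows "gauss_bound v t (v (fps_nth F 0)) F"
proof -
  let ?a = "\<lambda>i. v (fps_nth F i) * t ^ i" and ?b = "\<lambda>i. v (fps_nth G i) * t ^ i"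
  have "fps_nth F 0 * fps_nth G 0 = 1" using FG by (metis fps_mult_nth_0 fps_one_nth)
  hence pos: "?a 0 > 0" "?b 0 > 0" by (auto intro!: v_pos)
  obtain i where i: "\<And>j. ?a j \<le> ?a i" "\<And>j. j < i \<Longrightarrow> ?a j < ?a i"
    using null_sequence_first_max[OF F pos(1)] by blast
  obtain j where j: "\<And>k. ?b k \<le> ?b j" "\<And>k. k < j \<Longrightarrow> ?b k < ?b j"
    using null_sequence_first_max[OF G pos(2)] by blast
  have "?a i > 0" "?b j > 0" using i(1)[of 0] j(1)[of 0] pos by linarith+
  hence "fps_nth F i \<noteq> 0" "fps_nth G j \<noteq> 0" by auto
  hence "fps_nth (F * G) (i + j) \<noteq> 0" using fps_mult_nth_nonzero[OF t _ i _ j] by blast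
  hence "i + j = 0" unfolding FG fps_one_nth by meson
  thus ?thesis using i(1) by (simp add: gauss_bound_def)
qed

end

lemma dominant_index_at_generic_radius:
  fixes a :: "nat \<Rightarrow> real"
  assumes I: "finite I" "I \<noteq> {}" and a: "\<And>i. i \<in> I \<Longrightarrow> 0 < a i" and t: "0 < t" "t < u"
  obtains s k where "t < s" "s < u" "k \<in> I" "\<And>i. i \<in> I \<Longrightarrow> i \<noteq> k \<Longrightarrow> a i / s ^ i < a k / s ^ k"
proof -
  define ties where "ties = (\<lambda>(i, j). root (j - i) (a j / a i)) ` (I \<times> I)"
  have "finite ties" using I(1) by (simp add: ties_def)
  hence "infinite ({t<..<u} - ties)" using t by (simp add: infinite_Ioo)
  then obtain s where s: "t < s" "s < u" "s \<notin> ties"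
    by (metis Diff_iff finite.emptyI greaterThanLessThan_iff ex_in_conv)
  have no_tie: "a i / s ^ i \<noteq> a j / s ^ j" if ij: "i \<in> I" "j \<in> I" "i < j" for i j
  proof
    assume "a i / s ^ i = a j / s ^ j"
    moreover have "s ^ j = s ^ i * s ^ (j - i)" using ij(3) by (simp flip: power_add)
    ultimately have "a j / a i = s ^ (j - i)"
      using a[OF ij(1)] s t by (simp add: field_simps)
    hence "s = root (j - i) (a j / a i)" using ij(3) s t by (simp add: real_root_power_cancel)
    thus False using s(3) ij by (auto simp: ties_def)
  qed
  have "Max ((\<lambda>i. a i / s ^ i) ` I) \<in> (\<lambda>i. a i / s ^ i) ` I" using I by (intro Max_in) auto
  then obtain k where k: "k \<in> I" "a k / s ^ k = Max ((\<lambda>i. a i / s ^ i) ` I)" by auto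
  have "a i / s ^ i < a k / s ^ k" if i: "i \<in> I" "i \<noteq> k" for i
  proof -
    have "a i / s ^ i \<le> a k / s ^ k" unfolding k(2) using I(1) i(1) by (intro Max_ge) auto
    moreover have "a i / s ^ i \<noteq> a k / s ^ k"
      using no_tie[OF i(1) k(1)] no_tie[OF k(1) i(1)] i(2) by (metis nat_neq_iff)
    ultimately show ?thesis by simp
  qed
  thus ?thesis using that s k(1) by blast
qed

lemma (in nonarch_field) dominant_coeff_at_generic_radius:
  fixes P :: "'k poly"
  assumes "P \<noteq> 0" "0 < t" "t < u"
  obtains s k \<theta> where "t < s" "s < u" "coeff P k \<noteq> 0" "0 \<le> \<theta>" "\<theta> < 1"
    "\<And>i. i \<noteq> k \<Longrightarrow> v (coeff P i) / s ^ i \<le> \<theta> * (v (coeff P k) / s ^ k)"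
proof -
  let ?I = "{i. coeff P i \<noteq> 0}"
  have fin: "finite ?I" by (rule finite_subset[of _ "{..degree P}"]) (auto intro: le_degree)
  have "?I \<noteq> {}" using assms(1) by (auto simp: poly_eq_iff)
  then obtain s k where s: "t < s" "s < u" "k \<in> ?I"
    and dom: "\<And>i. i \<in> ?I \<Longrightarrow> i \<noteq> k \<Longrightarrow> v (coeff P i) / s ^ i < v (coeff P k) / s ^ k"
    using dominant_index_at_generic_radius[OF fin _ _ assms(2,3), of "\<lambda>i. v (coeff P i)"]
    by (auto simp: v_pos)
  have pos: "0 < v (coeff P k) / s ^ k" using s assms(2) by (simp add: v_pos)
  define ratio where "ratio i = (v (coeff P i) / s ^ i) / (v (coeff P k) / s ^ k)" for i
  define \<theta> where "\<theta> = Max (insert 0 (ratio ` (?I - {k})))"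
  have "ratio i \<le> \<theta>" if "i \<noteq> k" for i
  proof (cases "coeff P i = 0")
    case True
    thus ?thesis using fin by (simp add: ratio_def \<theta>_def)
  next
    case False
    thus ?thesis unfolding \<theta>_def using fin that by (intro Max_ge) auto
  qed
  hence "v (coeff P i) / s ^ i \<le> \<theta> * (v (coeff P k) / s ^ k)" if "i \<noteq> k" for i
    using that pos unfolding ratio_def by (simp only: pos_divide_le_eq)
  moreover have "ratio i < 1" if "i \<in> ?I - {k}" for i
    using dom[of i] that pos unfolding ratio_def by (simp only: divide_less_eq_1_pos) simp
  hence "\<theta> < 1" unfolding \<theta>_def using fin by (subst Max_less_iff) auto
  moreover have "0 \<le> \<theta>" unfolding \<theta>_def using fin by (intro Max_ge) auto
  ultimately show ?thesis using that s by blast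
qed

lemma fps_deriv_pow_diff: "(fps_deriv ^^ m) (F - G) = (fps_deriv ^^ m) F - (fps_deriv ^^ m) G"
  for F G :: "'k::comm_ring_1 fps"
  by (induction m) auto

lemma fps_integral0_pow_diff:
  "(fps_integral0 ^^ m) (F - G) = (fps_integral0 ^^ m) F - (fps_integral0 ^^ m) G"
  for F G :: "'k::field_char_0 fps"
proof (induction m)
  case (Suc m)
  have "fps_integral0 (X - Y) = fps_integral0 X - fps_integral0 Y" for X Y :: "'k fps"
    by (rule fps_ext) (simp add: fps_integral_def algebra_simps)
  thus ?case by (simp add: Suc)
qed simp

lemma fps_deriv_pow_integral0_pow: "(fps_deriv ^^ m) ((fps_integral0 ^^ m) F) = F"
  for F :: "'k::field_char_0 fps"
proof (induction m arbitrary: F)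
  case (Suc m)
  have "(fps_deriv ^^ Suc m) ((fps_integral0 ^^ Suc m) F)
      = (fps_deriv ^^ m) (fps_deriv (fps_integral0 ((fps_integral0 ^^ m) F)))"
    by (simp add: funpow_swap1)
  thus ?case by (simp add: fps_deriv_fps_integral Suc)
qed simp


section \<open>Overconvergent series in residue characteristic zero\<close>

context derivation
begin

lemma taylor_zero [simp]: "taylor \<delta> 0 = 0"
  using taylor_add[of 0 0] by simp

lemma taylor_inverse:
  assumes "c \<noteq> 0"
  shows "taylor \<delta> c * taylor \<delta> (1 / c) = 1"
  using assms by (simp add: taylor_one flip: taylor_mult)

abbreviation fps_act :: "'k poly \<Rightarrow> 'k fps \<Rightarrow> 'k fps" where
  "fps_act \<equiv> twisted_act (\<lambda>c F. taylor \<delta> c * F) fps_deriv"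

end

locale residue_char_0_diff_field = complete_nonarch_diff_field v \<delta>
  for v :: "'k::field_char_0 \<Rightarrow> real" and \<delta> :: "'k \<Rightarrow> 'k" +
  assumes residue_char_0: "residue_char v = 0"
begin

lemma v_of_nat: "0 < n \<Longrightarrow> v (of_nat n) = 1"
  by (rule v_of_nat_residue_char_0[OF residue_char_0])

lemma v_fact [simp]: "v (fact n) = 1"
  by (induction n) (simp_all add: v_mult v_of_nat del: of_nat_Suc)

lemma gauss_bound_integral0:
  assumes "0 < s" "gauss_bound v s C F"
  shows "gauss_bound v s (C * s) (fps_integral0 F)"
  unfolding gauss_bound_def
proof
  fix i
  show "v (fps_nth (fps_integral0 F) i) * s ^ i \<le> C * s"
  proof (cases i)
    case 0
    thus ?thesis using assms gauss_bound_nonneg[OF assms(2)] by (simp add: fps_integral_def)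
  next
    case (Suc j)
    thus ?thesis using gauss_boundD[OF assms(2), of j] assms(1) v_of_nat[of "Suc j"]
      by (simp add: fps_integral_def v_mult v_inverse mult_ac del: of_nat_Suc)
  qed
qed

lemma gauss_bound_integral0_pow:
  assumes "0 < s" "gauss_bound v s C F"
  shows "gauss_bound v s (C * s ^ k) ((fps_integral0 ^^ k) F)"
proof (induction k)
  case (Suc k)
  thus ?case using gauss_bound_integral0[OF assms(1) Suc] by (simp add: mult_ac)
qed (use assms in auto)

text \<open>A Taylor series tends to \<open>0\<close> at every radius below the radius of \<open>\<delta>\<close>, and so does its inverse,
  which is a Taylor series as well.\<close>

lemma gauss_bound_taylor:
  assumes t: "0 < t" "t * \<sigma> < 1"
  shows "gauss_bound v t (v c) (taylor \<delta> c)"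
proof (cases "c = 0")
  case True
  thus ?thesis by (simp add: gauss_bound_0)
next
  case False
  obtain q C where q: "0 < q" "q < 1" "\<And>i x. v ((\<delta> ^^ i) x) * t ^ i \<le> C * q ^ i * v x"
    using derivation_pow_growth[OF t] by blast
  have lim: "(\<lambda>i. v (fps_nth (taylor \<delta> x) i) * t ^ i) \<longlonglongrightarrow> 0" for x
  proof (rule tendsto_sandwich[of "\<lambda>_. 0" _ _ "\<lambda>i. C * q ^ i * v x"])
    have "(\<lambda>i. C * q ^ i * v x) \<longlonglongrightarrow> C * 0 * v x"
      using q by (intro tendsto_intros LIMSEQ_realpow_zero) auto
    thus "(\<lambda>i. C * q ^ i * v x) \<longlonglongrightarrow> 0" by simp
  qed (use q t in \<open>auto simp: taylor_def v_divide v_nonneg\<close>)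
  from fps_unit_dominated_by_constant_term[OF t(1) taylor_inverse[OF False] lim lim]
  show ?thesis by (simp add: taylor_def)
qed

lemma gauss_bound_taylor_mult:
  assumes "0 < s" "s * \<sigma> < 1" "gauss_bound v s C F"
  shows "gauss_bound v s (v c * C) (taylor \<delta> c * F)"
  by (intro gauss_bound_mult gauss_bound_taylor assms)

lemma gauss_bound_twisted_terms:
  assumes s: "0 < s" "s * \<sigma> < 1" and F: "gauss_bound v s C F"
    and B: "0 \<le> B" "\<And>i. i \<in> I \<Longrightarrow> v (a i) / s ^ i \<le> B"
  shows "gauss_bound v s (B * C) (\<Sum>i\<in>I. taylor \<delta> (a i) * (fps_deriv ^^ i) F)"
proof (rule gauss_bound_sum[OF s(1)])
  note C = gauss_bound_nonneg[OF F]
  show "0 \<le> B * C" using B(1) C by simp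
  fix i assume "i \<in> I"
  hence "v (a i) / s ^ i * C \<le> B * C" using B(2) C by (intro mult_right_mono)
  thus "gauss_bound v s (B * C) (taylor \<delta> (a i) * (fps_deriv ^^ i) F)"
    by (intro gauss_bound_mono[OF gauss_bound_taylor_mult[OF s gauss_bound_deriv_pow[OF s(1) F]]]) simp
qed

lemma twisted_poly_surj_gauss:
  fixes P :: "'k poly"
  assumes s: "0 < s" "s * \<sigma> < 1" and k: "coeff P k \<noteq> 0" and \<theta>: "0 \<le> \<theta>" "\<theta> < 1"
    and dom: "\<And>i. i \<noteq> k \<Longrightarrow> v (coeff P i) / s ^ i \<le> \<theta> * (v (coeff P k) / s ^ k)"
    and G: "gauss_bound v s C G"
  obtains D F where "gauss_bound v s D F" "fps_act P F = G"
proof -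
  let ?a = "coeff P" and ?I = "{..degree P} - {k}"
  define main where "main F = taylor \<delta> (?a k) * (fps_deriv ^^ k) F" for F
  define integ where "integ F = (fps_integral0 ^^ k) (taylor \<delta> (1 / ?a k) * F)" for F
  define rest where "rest F = (\<Sum>i\<in>?I. taylor \<delta> (?a i) * (fps_deriv ^^ i) F)" for F
  have integ_bound: "gauss_bound v s (C / v (?a k) * s ^ k) (integ F)" if "gauss_bound v s C F" for C F
    using gauss_bound_integral0_pow[OF s(1) gauss_bound_taylor_mult[OF s that], of "1 / ?a k" k]
    by (simp add: integ_def v_divide)
  have rest_bound: "gauss_bound v s (\<theta> * (v (?a k) / s ^ k) * C) (rest F)"
    if F: "gauss_bound v s C F" for C F
    unfolding rest_def
    by (rule gauss_bound_twisted_terms[OF s F]) (use \<theta> s(1) v_nonneg dom in auto)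
  obtain D F where F: "gauss_bound v s D F" "main F + rest F = G"
  proof (rule gauss_perturbation_surj[OF s(1) \<theta>(2), of main integ rest])
    show "main (integ F) = F" for F
      using taylor_inverse[OF k]
      by (simp add: main_def integ_def fps_deriv_pow_integral0_pow flip: mult.assoc)
    show "integ (F - G) = integ F - integ G" for F G
      by (simp add: integ_def right_diff_distrib fps_integral0_pow_diff)
    show "rest (F - G) = rest F - rest G" for F G
      by (simp add: rest_def fps_deriv_pow_diff right_diff_distrib sum_subtractf)
    show "gauss_bound v s (\<theta> * C) (integ (rest F))" if "gauss_bound v s C F" for C F
      using integ_bound[OF rest_bound[OF that]] k s(1) by simp
  qed (use integ_bound[OF G] in auto)
  moreover have "fps_act P F = main F + rest F"
    unfolding twisted_act_def main_def rest_def
    using le_degree[OF k] by (subst sum.remove[of _ k]) auto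
  ultimately show ?thesis using that by simp
qed

lemma twisted_poly_surj_overconv:
  assumes P: "P \<noteq> 0" and t: "0 < t" "t * \<sigma> < 1"
    and G: "G \<in> fps_overconv v t"
  obtains F where "F \<in> fps_overconv v t" "fps_act P F = G"
proof -
  obtain s' C where s': "t < s'" "gauss_bound v s' C G" using G fps_overconv_iff by blast
  obtain u where u: "t < u" "u < s'" "u * \<sigma> < 1"
    using radius_margin[OF t(2) s'(1)] by blast
  obtain s k \<theta> where s: "t < s" "s < u" and dom: "coeff P k \<noteq> 0" "0 \<le> \<theta>" "\<theta> < 1"
    "\<And>i. i \<noteq> k \<Longrightarrow> v (coeff P i) / s ^ i \<le> \<theta> * (v (coeff P k) / s ^ k)"
    using dominant_coeff_at_generic_radius[OF P t(1) u(1)] by metis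
  have "s * \<sigma> \<le> u * \<sigma>"
    using s derivation.spectral_norm_nonneg by (intro mult_right_mono) auto
  hence "0 < s" "s * \<sigma> < 1" using s t u(3) by auto
  moreover have "gauss_bound v s C G"
    by (rule gauss_bound_antimono[OF _ _ s'(2)]) (use s t u in auto)
  ultimately obtain D F where "gauss_bound v s D F" "fps_act P F = G"
    using twisted_poly_surj_gauss[OF _ _ dom] by blast
  thus ?thesis using that s(1) fps_overconv_iff by blast
qed

end


section \<open>Left modules\<close>

lemma (in abelian_group) a_comm_cancel:
  assumes "x \<in> carrier G" "y \<in> carrier G" "z \<in> carrier G"
  shows "x \<oplus> (y \<oplus> (\<ominus> x \<oplus> z)) = y \<oplus> z" "x \<oplus> (y \<oplus> \<ominus> x) = y"
  using assms a_lcomm[of x y "\<ominus> x \<oplus> z"] a_lcomm[of x y "\<ominus> x"] by (simp_all add: r_neg2 r_neg)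

lemmas (in abelian_group) abelian_group_simps =
  a_comm_cancel minus_eq minus_add minus_minus a_ac r_neg l_neg r_neg1 r_neg2

lemma (in abelian_group) minus_eq_minus_iff:
  assumes "a \<in> carrier G" "b \<in> carrier G" "c \<in> carrier G" "d \<in> carrier G"
  shows "a \<ominus> b = c \<ominus> d \<longleftrightarrow> a \<oplus> d = c \<oplus> b"
proof -
  have "(a \<ominus> b) \<oplus> (b \<oplus> d) = a \<oplus> d" "(c \<ominus> d) \<oplus> (b \<oplus> d) = c \<oplus> b"
    using assms by (simp_all add: abelian_group_simps)
  thus ?thesis using assms by (metis a_closed add.right_cancel minus_closed)
qed

lemma (in abelian_group) minus_add_cancel: "a \<in> carrier G \<Longrightarrow> b \<in> carrier G \<Longrightarrow> (a \<ominus> b) \<oplus> b = a"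
  by (simp add: minus_eq a_assoc l_neg)

lemma (in abelian_group) add_minus_cancel: "a \<in> carrier G \<Longrightarrow> b \<in> carrier G \<Longrightarrow> (a \<oplus> b) \<ominus> b = a"
  by (simp add: minus_eq a_assoc r_neg)

lemma (in abelian_group) minus_zero_right: "a \<in> carrier G \<Longrightarrow> a \<ominus> \<zero> = a"
  using add_minus_cancel[of a \<zero>] by simp

definition adjoin ::
  "('a, 'r) ring_scheme \<Rightarrow> ('a, 'b, 'm) module_scheme \<Rightarrow> 'b set \<Rightarrow> 'b \<Rightarrow> 'b set" where
  "adjoin R M U e = {u \<oplus>\<^bsub>M\<^esub> q \<odot>\<^bsub>M\<^esub> e | u q. u \<in> U \<and> q \<in> carrier R}"

lemma left_module_homI:
  assumes "\<And>x. x \<in> carrier M \<Longrightarrow> h x \<in> carrier N"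
    and "\<And>x y. x \<in> carrier M \<Longrightarrow> y \<in> carrier M \<Longrightarrow> h (x \<oplus>\<^bsub>M\<^esub> y) = h x \<oplus>\<^bsub>N\<^esub> h y"
    and "\<And>a x. a \<in> carrier R \<Longrightarrow> x \<in> carrier M \<Longrightarrow> h (a \<odot>\<^bsub>M\<^esub> x) = a \<odot>\<^bsub>N\<^esub> h x"
  shows "h \<in> left_module_hom R M N"
  using assms by (auto simp: left_module_hom_def hom_def)

lemma
  assumes "h \<in> left_module_hom R M N" "x \<in> carrier M"
  shows left_module_hom_closed: "h x \<in> carrier N"
    and left_module_hom_add: "y \<in> carrier M \<Longrightarrow> h (x \<oplus>\<^bsub>M\<^esub> y) = h x \<oplus>\<^bsub>N\<^esub> h y"
    and left_module_hom_smult: "a \<in> carrier R \<Longrightarrow> h (a \<odot>\<^bsub>M\<^esub> x) = a \<odot>\<^bsub>N\<^esub> h x"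
  using assms by (auto simp: left_module_hom_def hom_def)

lemma left_module_hom_restrict:
  "h \<in> left_module_hom R M N \<Longrightarrow> U \<subseteq> carrier M \<Longrightarrow> h \<in> left_module_hom R (M\<lparr>carrier := U\<rparr>) N"
  by (auto simp: left_module_hom_def hom_def subset_iff)

lemma left_module_hom_codomain_iff:
  assumes "D \<subseteq> carrier N"
  shows "h \<in> left_module_hom R M (N\<lparr>carrier := D\<rparr>) \<longleftrightarrow>
    h \<in> left_module_hom R M N \<and> (\<forall>x\<in>carrier M. h x \<in> D)"
  using assms by (auto simp: left_module_hom_def hom_def)

lemma left_module_hom_compose:
  "h \<in> left_module_hom R M N \<Longrightarrow> g \<in> left_module_hom R N P \<Longrightarrow> (\<lambda>x. g (h x)) \<in> left_module_hom R M P"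
  by (simp add: left_module_hom_def hom_def Pi_iff)

context left_module
begin

abbreviation submod :: "'b set \<Rightarrow> bool" where
  "submod N \<equiv> Module.submodule N R M"

lemma smult_l_zero [simp]: "x \<in> carrier M \<Longrightarrow> \<zero>\<^bsub>R\<^esub> \<odot>\<^bsub>M\<^esub> x = \<zero>\<^bsub>M\<^esub>"
  using smult_l_distr[of "\<zero>\<^bsub>R\<^esub>" "\<zero>\<^bsub>R\<^esub>" x] smult_closed by (simp add: M.add.r_cancel_one')

lemma smult_r_zero [simp]: "a \<in> carrier R \<Longrightarrow> a \<odot>\<^bsub>M\<^esub> \<zero>\<^bsub>M\<^esub> = \<zero>\<^bsub>M\<^esub>"
  using smult_r_distr[of a "\<zero>\<^bsub>M\<^esub>" "\<zero>\<^bsub>M\<^esub>"] smult_closed by (simp add: M.add.r_cancel_one')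

lemma smult_l_minus:
  "a \<in> carrier R \<Longrightarrow> x \<in> carrier M \<Longrightarrow> (\<ominus>\<^bsub>R\<^esub> a) \<odot>\<^bsub>M\<^esub> x = \<ominus>\<^bsub>M\<^esub> (a \<odot>\<^bsub>M\<^esub> x)"
  using smult_l_distr[of "\<ominus>\<^bsub>R\<^esub> a" a x] smult_closed by (simp add: R.l_neg M.minus_equality)

lemma smult_r_minus:
  "a \<in> carrier R \<Longrightarrow> x \<in> carrier M \<Longrightarrow> a \<odot>\<^bsub>M\<^esub> (\<ominus>\<^bsub>M\<^esub> x) = \<ominus>\<^bsub>M\<^esub> (a \<odot>\<^bsub>M\<^esub> x)"
  using smult_r_distr[of a "\<ominus>\<^bsub>M\<^esub> x" x] smult_closed by (simp add: M.l_neg M.minus_equality)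

lemma smult_l_diff:
  "a \<in> carrier R \<Longrightarrow> b \<in> carrier R \<Longrightarrow> x \<in> carrier M \<Longrightarrow>
    (a \<ominus>\<^bsub>R\<^esub> b) \<odot>\<^bsub>M\<^esub> x = a \<odot>\<^bsub>M\<^esub> x \<ominus>\<^bsub>M\<^esub> b \<odot>\<^bsub>M\<^esub> x"
  by (simp add: R.minus_eq M.minus_eq smult_l_distr smult_l_minus)

lemma smult_r_diff:
  "a \<in> carrier R \<Longrightarrow> x \<in> carrier M \<Longrightarrow> y \<in> carrier M \<Longrightarrow>
    a \<odot>\<^bsub>M\<^esub> (x \<ominus>\<^bsub>M\<^esub> y) = a \<odot>\<^bsub>M\<^esub> x \<ominus>\<^bsub>M\<^esub> a \<odot>\<^bsub>M\<^esub> y"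
  by (simp add: M.minus_eq smult_r_distr smult_r_minus)

lemma
  assumes "submod N"
  shows submodule_subset: "N \<subseteq> carrier M"
    and submodule_zero: "\<zero>\<^bsub>M\<^esub> \<in> N"
    and submodule_add: "x \<in> N \<Longrightarrow> y \<in> N \<Longrightarrow> x \<oplus>\<^bsub>M\<^esub> y \<in> N"
    and submodule_minus: "x \<in> N \<Longrightarrow> \<ominus>\<^bsub>M\<^esub> x \<in> N"
    and submodule_diff: "x \<in> N \<Longrightarrow> y \<in> N \<Longrightarrow> x \<ominus>\<^bsub>M\<^esub> y \<in> N"
    and submodule_smult: "a \<in> carrier R \<Longrightarrow> x \<in> N \<Longrightarrow> a \<odot>\<^bsub>M\<^esub> x \<in> N"
proof -
  interpret N: Module.submodule N R M by fact
  show "N \<subseteq> carrier M" "\<zero>\<^bsub>M\<^esub> \<in> N" using N.subset N.one_closed by simp_all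
  show add: "x \<oplus>\<^bsub>M\<^esub> y \<in> N" if "x \<in> N" "y \<in> N" for x y using N.m_closed[OF that] by simp
  show minus: "\<ominus>\<^bsub>M\<^esub> x \<in> N" if "x \<in> N" for x using N.m_inv_closed[OF that] by (simp add: a_inv_def)
  show "x \<ominus>\<^bsub>M\<^esub> y \<in> N" if "x \<in> N" "y \<in> N" for x y using that add minus by (simp add: M.minus_eq)
  show "a \<odot>\<^bsub>M\<^esub> x \<in> N" if "a \<in> carrier R" "x \<in> N" for a x using that by simp
qed

lemma submoduleI:
  assumes N: "N \<subseteq> carrier M" "\<zero>\<^bsub>M\<^esub> \<in> N" "\<And>x y. x \<in> N \<Longrightarrow> y \<in> N \<Longrightarrow> x \<oplus>\<^bsub>M\<^esub> y \<in> N"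
    and smult: "\<And>a x. a \<in> carrier R \<Longrightarrow> x \<in> N \<Longrightarrow> a \<odot>\<^bsub>M\<^esub> x \<in> N"
  shows "submod N"
proof unfold_locales
  fix x assume "x \<in> N"
  hence "(\<ominus>\<^bsub>R\<^esub> \<one>\<^bsub>R\<^esub>) \<odot>\<^bsub>M\<^esub> x \<in> N" "x \<in> carrier M" using smult N(1) by auto
  hence "\<ominus>\<^bsub>M\<^esub> x \<in> N" by (simp add: smult_l_minus smult_one)
  thus "inv\<^bsub>add_monoid M\<^esub> x \<in> N" by (simp add: a_inv_def)
qed (use N smult in auto)

lemma submodule_carrier: "submod (carrier M)"
  by (rule submoduleI) (auto intro: smult_closed)

lemma submodule_trivial: "submod {\<zero>\<^bsub>M\<^esub>}"
  by (rule submoduleI) auto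

lemma adjoin_add:
  assumes "u \<in> carrier M" "u' \<in> carrier M" "e \<in> carrier M" "q \<in> carrier R" "q' \<in> carrier R"
  shows "(u \<oplus>\<^bsub>M\<^esub> q \<odot>\<^bsub>M\<^esub> e) \<oplus>\<^bsub>M\<^esub> (u' \<oplus>\<^bsub>M\<^esub> q' \<odot>\<^bsub>M\<^esub> e)
    = (u \<oplus>\<^bsub>M\<^esub> u') \<oplus>\<^bsub>M\<^esub> (q \<oplus>\<^bsub>R\<^esub> q') \<odot>\<^bsub>M\<^esub> e"
  using assms by (simp add: smult_l_distr smult_closed M.a_ac)

lemma adjoin_smult:
  assumes "u \<in> carrier M" "e \<in> carrier M" "p \<in> carrier R" "q \<in> carrier R"
  shows "p \<odot>\<^bsub>M\<^esub> (u \<oplus>\<^bsub>M\<^esub> q \<odot>\<^bsub>M\<^esub> e) = p \<odot>\<^bsub>M\<^esub> u \<oplus>\<^bsub>M\<^esub> (p \<otimes>\<^bsub>R\<^esub> q) \<odot>\<^bsub>M\<^esub> e"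
  using assms by (simp add: smult_r_distr smult_assoc smult_closed)

lemma adjoinI: "u \<in> U \<Longrightarrow> q \<in> carrier R \<Longrightarrow> u \<oplus>\<^bsub>M\<^esub> q \<odot>\<^bsub>M\<^esub> e \<in> adjoin R M U e"
  by (auto simp: adjoin_def)

lemma adjoinE:
  assumes "submod U" "x \<in> adjoin R M U e"
  obtains u q where "u \<in> U" "u \<in> carrier M" "q \<in> carrier R" "x = u \<oplus>\<^bsub>M\<^esub> q \<odot>\<^bsub>M\<^esub> e"
  using assms submodule_subset[OF assms(1)] by (auto simp: adjoin_def)

lemma adjoin_superset:
  assumes "submod U" "e \<in> carrier M"
  shows "U \<subseteq> adjoin R M U e"
proof
  fix u assume "u \<in> U"
  thus "u \<in> adjoin R M U e"
    using adjoinI[of u U "\<zero>\<^bsub>R\<^esub>" e] submodule_subset[OF assms(1)] assms(2) by auto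
qed

lemma adjoin_self: "submod U \<Longrightarrow> e \<in> carrier M \<Longrightarrow> e \<in> adjoin R M U e"
  using adjoinI[of "\<zero>\<^bsub>M\<^esub>" U "\<one>\<^bsub>R\<^esub>" e] submodule_zero by (simp add: smult_one)

lemma submodule_adjoin:
  assumes U: "submod U" and e: "e \<in> carrier M"
  shows "submod (adjoin R M U e)"
proof (rule submoduleI)
  show "adjoin R M U e \<subseteq> carrier M" using submodule_subset[OF U] e by (auto simp: adjoin_def smult_closed)
  show "\<zero>\<^bsub>M\<^esub> \<in> adjoin R M U e" using adjoin_superset[OF U e] submodule_zero[OF U] by blast
  fix x assume "x \<in> adjoin R M U e"
  then obtain u q where x: "u \<in> U" "u \<in> carrier M" "q \<in> carrier R" "x = u \<oplus>\<^bsub>M\<^esub> q \<odot>\<^bsub>M\<^esub> e"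
    by (rule adjoinE[OF U])
  show "p \<odot>\<^bsub>M\<^esub> x \<in> adjoin R M U e" if "p \<in> carrier R" for p
    unfolding x(4) adjoin_smult[OF x(2) e that x(3)] using U x(1,3) that
    by (intro adjoinI submodule_smult) auto
  fix y assume "y \<in> adjoin R M U e"
  then obtain u' q' where y: "u' \<in> U" "u' \<in> carrier M" "q' \<in> carrier R" "y = u' \<oplus>\<^bsub>M\<^esub> q' \<odot>\<^bsub>M\<^esub> e"
    by (rule adjoinE[OF U])
  show "x \<oplus>\<^bsub>M\<^esub> y \<in> adjoin R M U e"
    unfolding x(4) y(4) adjoin_add[OF x(2) y(2) e x(3) y(3)] using U x(1,3) y(1,3)
    by (intro adjoinI submodule_add) auto
qed

lemma left_module_submodule:
  assumes N: "submod N"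
  shows "left_module R (M\<lparr>carrier := N\<rparr>)"
proof -
  have M: "x \<in> carrier M" if "x \<in> N" for x using submodule_subset[OF N] that by blast
  have "abelian_group (M\<lparr>carrier := N\<rparr>)"
  proof (rule abelian_groupI)
    fix x assume "x \<in> carrier (M\<lparr>carrier := N\<rparr>)"
    thus "\<exists>y\<in>carrier (M\<lparr>carrier := N\<rparr>). y \<oplus>\<^bsub>M\<lparr>carrier := N\<rparr>\<^esub> x = \<zero>\<^bsub>M\<lparr>carrier := N\<rparr>\<^esub>"
      using submodule_minus[OF N] M by (auto intro!: bexI[of _ "\<ominus>\<^bsub>M\<^esub> x"] simp: M.l_neg)
  qed (use submodule_zero[OF N] submodule_add[OF N] M in \<open>auto simp: M.a_ac\<close>)
  thus ?thesis
    using submodule_smult[OF N] M R.ring_axioms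
    by (intro left_module.intro left_module_axioms.intro)
       (auto simp: smult_l_distr smult_r_distr smult_assoc smult_one)
qed

lemma submodule_restrict_iff:
  assumes N: "submod N"
  shows "Module.submodule U R (M\<lparr>carrier := N\<rparr>) \<longleftrightarrow> submod U \<and> U \<subseteq> N"
proof -
  interpret N: left_module R "M\<lparr>carrier := N\<rparr>" by (rule left_module_submodule[OF N])
  show ?thesis
  proof
    assume U: "N.submod U"
    show "submod U \<and> U \<subseteq> N"
      using N.submodule_subset[OF U] N.submodule_zero[OF U] N.submodule_add[OF U] N.submodule_smult[OF U]
        submodule_subset[OF N] by (auto intro!: submoduleI)
  next
    assume U: "submod U \<and> U \<subseteq> N"
    thus "N.submod U"
      using submodule_zero submodule_add submodule_smult by (intro N.submoduleI) auto
  qed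
qed

subsection \<open>Homomorphisms\<close>

context
  fixes N :: "('a, 'c, 'n) module_scheme"
  assumes N: "left_module R N"
begin

interpretation N: left_module R N by (rule N)

lemma hom_zero:
  assumes "h \<in> left_module_hom R M N"
  shows "h \<zero>\<^bsub>M\<^esub> = \<zero>\<^bsub>N\<^esub>"
  using left_module_hom_smult[OF assms M.zero_closed R.zero_closed] left_module_hom_closed[OF assms] by simp

lemma hom_diff:
  assumes "h \<in> left_module_hom R M N" "x \<in> carrier M" "y \<in> carrier M"
  shows "h (x \<ominus>\<^bsub>M\<^esub> y) = h x \<ominus>\<^bsub>N\<^esub> h y"
  using left_module_hom_add[OF assms(1), of "x \<ominus>\<^bsub>M\<^esub> y" y] left_module_hom_closed[OF assms(1)] assms(2,3)
  by (metis M.minus_add_cancel M.minus_closed N.add_minus_cancel)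

lemma left_module_hom_difference:
  assumes h: "h \<in> left_module_hom R M N" and g: "g \<in> left_module_hom R M N"
  shows "(\<lambda>x. h x \<ominus>\<^bsub>N\<^esub> g x) \<in> left_module_hom R M N"
proof (rule left_module_homI)
  note closed = left_module_hom_closed[OF h] left_module_hom_closed[OF g]
  fix x assume x: "x \<in> carrier M"
  show "h x \<ominus>\<^bsub>N\<^esub> g x \<in> carrier N" using closed x by simp
  show "h (a \<odot>\<^bsub>M\<^esub> x) \<ominus>\<^bsub>N\<^esub> g (a \<odot>\<^bsub>M\<^esub> x) = a \<odot>\<^bsub>N\<^esub> (h x \<ominus>\<^bsub>N\<^esub> g x)" if "a \<in> carrier R" for a
    using closed x that left_module_hom_smult[OF h] left_module_hom_smult[OF g]
    by (simp add: N.smult_r_diff)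
  show "h (x \<oplus>\<^bsub>M\<^esub> y) \<ominus>\<^bsub>N\<^esub> g (x \<oplus>\<^bsub>M\<^esub> y) = (h x \<ominus>\<^bsub>N\<^esub> g x) \<oplus>\<^bsub>N\<^esub> (h y \<ominus>\<^bsub>N\<^esub> g y)"
    if "y \<in> carrier M" for y
    using closed x that left_module_hom_add[OF h] left_module_hom_add[OF g]
    by (simp add: N.minus_eq N.minus_add N.a_ac)
qed

lemma submodule_kernel:
  assumes h: "h \<in> left_module_hom R M N"
  shows "submod {x \<in> carrier M. h x = \<zero>\<^bsub>N\<^esub>}"
  using hom_zero[OF h] left_module_hom_add[OF h] left_module_hom_smult[OF h]
  by (intro submoduleI) (auto simp: smult_closed)

lemma submodule_preimage:
  assumes h: "h \<in> left_module_hom R M N" and S: "N.submod S"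
  shows "submod {x \<in> carrier M. h x \<in> S}"
  using hom_zero[OF h] left_module_hom_add[OF h] left_module_hom_smult[OF h]
    N.submodule_zero[OF S] N.submodule_add[OF S] N.submodule_smult[OF S]
  by (intro submoduleI) (auto simp: smult_closed)

lemma adjoin_hom_well_defined:
  assumes U: "submod U" and e: "e \<in> carrier M"
    and h: "h \<in> left_module_hom R (M\<lparr>carrier := U\<rparr>) N" and y: "y \<in> carrier N"
    and compat: "\<And>q. q \<in> carrier R \<Longrightarrow> q \<odot>\<^bsub>M\<^esub> e \<in> U \<Longrightarrow> h (q \<odot>\<^bsub>M\<^esub> e) = q \<odot>\<^bsub>N\<^esub> y"
    and u: "u \<in> U" "u' \<in> U" and q: "q \<in> carrier R" "q' \<in> carrier R"
    and eq: "u \<oplus>\<^bsub>M\<^esub> q \<odot>\<^bsub>M\<^esub> e = u' \<oplus>\<^bsub>M\<^esub> q' \<odot>\<^bsub>M\<^esub> e"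
  shows "h u \<oplus>\<^bsub>N\<^esub> q \<odot>\<^bsub>N\<^esub> y = h u' \<oplus>\<^bsub>N\<^esub> q' \<odot>\<^bsub>N\<^esub> y"
proof -
  interpret U: left_module R "M\<lparr>carrier := U\<rparr>" by (rule left_module_submodule[OF U])
  have uM: "u \<in> carrier M" "u' \<in> carrier M" using u submodule_subset[OF U] by auto
  have hu: "h u \<in> carrier N" "h u' \<in> carrier N" using left_module_hom_closed[OF h] u by simp_all
  have "(q' \<ominus>\<^bsub>R\<^esub> q) \<odot>\<^bsub>M\<^esub> e = u \<ominus>\<^bsub>M\<^esub> u'"
    using eq uM q e M.minus_eq_minus_iff[of "q' \<odot>\<^bsub>M\<^esub> e" "q \<odot>\<^bsub>M\<^esub> e" u u']
    by (simp add: smult_l_diff smult_closed M.a_comm)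
  hence "h (u \<ominus>\<^bsub>M\<^esub> u') = (q' \<ominus>\<^bsub>R\<^esub> q) \<odot>\<^bsub>N\<^esub> y"
    using compat[of "q' \<ominus>\<^bsub>R\<^esub> q"] submodule_diff[OF U u] q by simp
  moreover have "h u = h (u \<ominus>\<^bsub>M\<^esub> u') \<oplus>\<^bsub>N\<^esub> h u'"
    using left_module_hom_add[OF h, of "u \<ominus>\<^bsub>M\<^esub> u'" u'] submodule_diff[OF U u] u uM
    by (simp add: M.minus_add_cancel)
  ultimately show ?thesis
    using hu q y by (simp add: N.smult_l_diff N.smult_closed N.abelian_group_simps)
qed

lemma adjoin_map_exists:
  assumes U: "submod U" and e: "e \<in> carrier M"
    and h: "h \<in> left_module_hom R (M\<lparr>carrier := U\<rparr>) N" and y: "y \<in> carrier N"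
    and compat: "\<And>q. q \<in> carrier R \<Longrightarrow> q \<odot>\<^bsub>M\<^esub> e \<in> U \<Longrightarrow> h (q \<odot>\<^bsub>M\<^esub> e) = q \<odot>\<^bsub>N\<^esub> y"
  obtains g where "\<And>u q. u \<in> U \<Longrightarrow> q \<in> carrier R \<Longrightarrow> g (u \<oplus>\<^bsub>M\<^esub> q \<odot>\<^bsub>M\<^esub> e) = h u \<oplus>\<^bsub>N\<^esub> q \<odot>\<^bsub>N\<^esub> y"
proof -
  define g where
    "g x = (THE z. \<exists>u q. u \<in> U \<and> q \<in> carrier R \<and> x = u \<oplus>\<^bsub>M\<^esub> q \<odot>\<^bsub>M\<^esub> e \<and> z = h u \<oplus>\<^bsub>N\<^esub> q \<odot>\<^bsub>N\<^esub> y)" for x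
  have g: "g (u \<oplus>\<^bsub>M\<^esub> q \<odot>\<^bsub>M\<^esub> e) = h u \<oplus>\<^bsub>N\<^esub> q \<odot>\<^bsub>N\<^esub> y" if "u \<in> U" "q \<in> carrier R" for u q
    unfolding g_def
  proof (rule the_equality)
    fix z assume "\<exists>u' q'. u' \<in> U \<and> q' \<in> carrier R \<and> u \<oplus>\<^bsub>M\<^esub> q \<odot>\<^bsub>M\<^esub> e = u' \<oplus>\<^bsub>M\<^esub> q' \<odot>\<^bsub>M\<^esub> e \<and>
      z = h u' \<oplus>\<^bsub>N\<^esub> q' \<odot>\<^bsub>N\<^esub> y"
    then obtain u' q' where "u' \<in> U" "q' \<in> carrier R" "u \<oplus>\<^bsub>M\<^esub> q \<odot>\<^bsub>M\<^esub> e = u' \<oplus>\<^bsub>M\<^esub> q' \<odot>\<^bsub>M\<^esub> e"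
      and z: "z = h u' \<oplus>\<^bsub>N\<^esub> q' \<odot>\<^bsub>N\<^esub> y" by blast
    from adjoin_hom_well_defined[OF U e h y compat that(1) this(1) that(2) this(2,3)] z
    show "z = h u \<oplus>\<^bsub>N\<^esub> q \<odot>\<^bsub>N\<^esub> y" by simp
  qed (use that in blast)
  show ?thesis by (rule that[OF g])
qed

lemma hom_extend_adjoin:
  assumes U: "submod U" and e: "e \<in> carrier M"
    and h: "h \<in> left_module_hom R (M\<lparr>carrier := U\<rparr>) N" and y: "y \<in> carrier N"
    and compat: "\<And>q. q \<in> carrier R \<Longrightarrow> q \<odot>\<^bsub>M\<^esub> e \<in> U \<Longrightarrow> h (q \<odot>\<^bsub>M\<^esub> e) = q \<odot>\<^bsub>N\<^esub> y"
  obtains g where "g \<in> left_module_hom R (M\<lparr>carrier := adjoin R M U e\<rparr>) N"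
    "\<And>x. x \<in> U \<Longrightarrow> g x = h x" "g e = y"
proof -
  have hU: "h u \<in> carrier N" if "u \<in> U" for u using left_module_hom_closed[OF h] that by simp
  obtain g where g: "\<And>u q. u \<in> U \<Longrightarrow> q \<in> carrier R \<Longrightarrow> g (u \<oplus>\<^bsub>M\<^esub> q \<odot>\<^bsub>M\<^esub> e) = h u \<oplus>\<^bsub>N\<^esub> q \<odot>\<^bsub>N\<^esub> y"
    by (rule adjoin_map_exists[OF U e h y compat]) (assumption+, rule that)
  have "g \<in> left_module_hom R (M\<lparr>carrier := adjoin R M U e\<rparr>) N"
  proof (rule left_module_homI; simp)
    fix x assume "x \<in> adjoin R M U e"
    then obtain u q where x: "u \<in> U" "u \<in> carrier M" "q \<in> carrier R" "x = u \<oplus>\<^bsub>M\<^esub> q \<odot>\<^bsub>M\<^esub> e"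
      by (rule adjoinE[OF U])
    have gx: "g x = h u \<oplus>\<^bsub>N\<^esub> q \<odot>\<^bsub>N\<^esub> y" unfolding x(4) by (rule g[OF x(1,3)])
    thus "g x \<in> carrier N" using hU x y by (simp add: N.smult_closed)
    show "g (p \<odot>\<^bsub>M\<^esub> x) = p \<odot>\<^bsub>N\<^esub> g x" if p: "p \<in> carrier R" for p
      unfolding gx unfolding x(4) adjoin_smult[OF x(2) e p x(3)] N.adjoin_smult[OF hU[OF x(1)] y p x(3)]
      using g[OF submodule_smult[OF U p x(1)] R.m_closed[OF p x(3)]]
        left_module_hom_smult[OF h _ p, of u] x(1)
      by simp
    fix x' assume "x' \<in> adjoin R M U e"
    then obtain u' q' where x': "u' \<in> U" "u' \<in> carrier M" "q' \<in> carrier R" "x' = u' \<oplus>\<^bsub>M\<^esub> q' \<odot>\<^bsub>M\<^esub> e"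
      by (rule adjoinE[OF U])
    have gx': "g x' = h u' \<oplus>\<^bsub>N\<^esub> q' \<odot>\<^bsub>N\<^esub> y" unfolding x'(4) by (rule g[OF x'(1,3)])
    show "g (x \<oplus>\<^bsub>M\<^esub> x') = g x \<oplus>\<^bsub>N\<^esub> g x'"
      unfolding gx gx' unfolding x(4) x'(4) adjoin_add[OF x(2) x'(2) e x(3) x'(3)]
        N.adjoin_add[OF hU[OF x(1)] hU[OF x'(1)] y x(3) x'(3)]
      using g[OF submodule_add[OF U x(1) x'(1)] R.a_closed[OF x(3) x'(3)]]
        left_module_hom_add[OF h, of u u'] x(1) x'(1)
      by simp
  qed
  moreover have "g x = h x" if "x \<in> U" for x
    using g[OF that R.zero_closed] hU[OF that] submodule_subset[OF U] that e y by (auto simp: subset_iff)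
  moreover have "h \<zero>\<^bsub>M\<^esub> = \<zero>\<^bsub>N\<^esub>"
    using compat[OF R.zero_closed] submodule_zero[OF U] e y by simp
  hence "g e = y"
    using g[OF submodule_zero[OF U] R.one_closed] e y by (simp add: smult_one N.smult_one)
  ultimately show ?thesis using that by blast
qed

end

end

subsection \<open>Modules of finite length\<close>

locale finite_length_module = left_module R M
  for R :: "('a, 'r) ring_scheme" and M :: "('a, 'b, 'm) module_scheme" +
  assumes finite_length: "\<exists>rank :: 'b set \<Rightarrow> nat.
    \<forall>U U'. Module.submodule U R M \<longrightarrow> Module.submodule U' R M \<longrightarrow> U \<subset> U' \<longrightarrow> rank U < rank U'"
begin

lemma maximal_submodule:
  assumes "P U0" "\<And>U. P U \<Longrightarrow> submod U"
  obtains U where "P U" "\<And>U'. P U' \<Longrightarrow> U \<subseteq> U' \<Longrightarrow> U' = U"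
proof -
  obtain rank :: "'b set \<Rightarrow> nat"
    where rank: "\<And>U U'. submod U \<Longrightarrow> submod U' \<Longrightarrow> U \<subset> U' \<Longrightarrow> rank U < rank U'"
    using finite_length by blast
  have "rank U < Suc (rank (carrier M))" if "P U" for U
    using rank[OF assms(2)[OF that] submodule_carrier] submodule_subset[OF assms(2)[OF that]]
    by (cases "U = carrier M") (auto simp: psubset_eq)
  then obtain U where U: "P U" "\<And>U'. P U' \<Longrightarrow> rank U' \<le> rank U"
    using ex_has_greatest_nat[of P U0 rank] assms(1) by metis
  have "U' = U" if "P U'" "U \<subseteq> U'" for U'
    using rank[of U U'] U(2)[OF that(1)] assms(2) U(1) that by fastforce
  thus ?thesis using that U(1) by blast
qed

lemma adjoin_induct [consumes 2, case_names adjoin]: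
  assumes U: "submod U" "P U"
    and step: "\<And>W e. submod W \<Longrightarrow> U \<subseteq> W \<Longrightarrow> P W \<Longrightarrow> e \<in> carrier M \<Longrightarrow> e \<notin> W \<Longrightarrow> P (adjoin R M W e)"
  shows "P (carrier M)"
proof -
  obtain W where W: "submod W \<and> U \<subseteq> W \<and> P W"
    and max: "\<And>W'. submod W' \<and> U \<subseteq> W' \<and> P W' \<Longrightarrow> W \<subseteq> W' \<Longrightarrow> W' = W"
    by (rule maximal_submodule[of "\<lambda>W. submod W \<and> U \<subseteq> W \<and> P W" U]) (use U in auto)
  have "e \<in> W" if e: "e \<in> carrier M" for e
  proof (rule ccontr)
    assume "e \<notin> W"
    hence "P (adjoin R M W e)" using step W e by blast
    hence "adjoin R M W e = W"
      using max[of "adjoin R M W e"] submodule_adjoin[of W e] adjoin_superset[of W e] W e by blast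
    thus False using adjoin_self[of W e] W e \<open>e \<notin> W\<close> by blast
  qed
  hence "W = carrier M" using submodule_subset W by blast
  thus ?thesis using W by simp
qed

text \<open>As in Baer's criterion, it suffices to extend homomorphisms along cyclic extensions.\<close>

lemma hom_extends:
  assumes N: "left_module R N"
    and divisible: "\<And>W g e. submod W \<Longrightarrow> g \<in> left_module_hom R (M\<lparr>carrier := W\<rparr>) N \<Longrightarrow> e \<in> carrier M \<Longrightarrow>
      \<exists>y\<in>carrier N. \<forall>q\<in>carrier R. q \<odot>\<^bsub>M\<^esub> e \<in> W \<longrightarrow> g (q \<odot>\<^bsub>M\<^esub> e) = q \<odot>\<^bsub>N\<^esub> y"
    and U: "submod U" and h: "h \<in> left_module_hom R (M\<lparr>carrier := U\<rparr>) N"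
  obtains g where "g \<in> left_module_hom R M N" "\<And>x. x \<in> U \<Longrightarrow> g x = h x"
proof -
  have "\<exists>g \<in> left_module_hom R (M\<lparr>carrier := carrier M\<rparr>) N. \<forall>x\<in>U. g x = h x"
    using U
  proof (rule adjoin_induct)
    show "\<exists>g \<in> left_module_hom R (M\<lparr>carrier := U\<rparr>) N. \<forall>x\<in>U. g x = h x" using h by blast
    fix W e
    assume W: "submod W" "U \<subseteq> W" and e: "e \<in> carrier M"
      and "\<exists>g \<in> left_module_hom R (M\<lparr>carrier := W\<rparr>) N. \<forall>x\<in>U. g x = h x"
    then obtain g where g: "g \<in> left_module_hom R (M\<lparr>carrier := W\<rparr>) N" "\<forall>x\<in>U. g x = h x" by blast
    obtain y where "y \<in> carrier N" "\<forall>q\<in>carrier R. q \<odot>\<^bsub>M\<^esub> e \<in> W \<longrightarrow> g (q \<odot>\<^bsub>M\<^esub> e) = q \<odot>\<^bsub>N\<^esub> y"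
      using divisible[OF W(1) g(1) e] by blast
    then obtain g' where "g' \<in> left_module_hom R (M\<lparr>carrier := adjoin R M W e\<rparr>) N" "\<And>x. x \<in> W \<Longrightarrow> g' x = g x"
      using hom_extend_adjoin[OF N W(1) e g(1)] by metis
    thus "\<exists>g \<in> left_module_hom R (M\<lparr>carrier := adjoin R M W e\<rparr>) N. \<forall>x\<in>U. g x = h x"
      using g(2) W(2) by (metis subsetD)
  qed
  thus ?thesis using that by auto
qed

lemma finite_length_submodule:
  assumes N: "submod N"
  shows "finite_length_module R (M\<lparr>carrier := N\<rparr>)"
proof -
  obtain rank :: "'b set \<Rightarrow> nat"
    where "\<And>U U'. submod U \<Longrightarrow> submod U' \<Longrightarrow> U \<subset> U' \<Longrightarrow> rank U < rank U'"
    using finite_length by blast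
  thus ?thesis
    using left_module_submodule[OF N]
    by (intro finite_length_module.intro finite_length_module_axioms.intro)
       (auto simp: submodule_restrict_iff[OF N] intro!: exI[of _ rank])
qed

end

subsection \<open>Quotients and composition series\<close>

context left_module
begin

context
  fixes N assumes N: "submod N"
begin

interpretation abelian_subgroup N M
  by (intro abelian_subgroupI3 additive_subgroupI M.abelian_group_axioms)
     (rule Module.submodule.axioms(1)[OF N])

lemma coset_eq_iff:
  assumes "x \<in> carrier M" "y \<in> carrier M"
  shows "N +>\<^bsub>M\<^esub> x = N +>\<^bsub>M\<^esub> y \<longleftrightarrow> x \<ominus>\<^bsub>M\<^esub> y \<in> N"
  using a_rcos_module[OF assms(2,1)] a_rcos_self[OF assms(1)] a_repr_independence'[OF _ assms(2)]
  by (auto simp: M.minus_eq)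

lemma quotient_carrier: "carrier (quotient_module M N) = (\<lambda>x. N +>\<^bsub>M\<^esub> x) ` carrier M"
  by (auto simp: quotient_module_def A_RCOSETS_def RCOSETS_def a_r_coset_def)

lemma quotient_zero: "\<zero>\<^bsub>quotient_module M N\<^esub> = N +>\<^bsub>M\<^esub> \<zero>\<^bsub>M\<^esub>"
  using a_rcos_const[OF submodule_zero[OF N]] by (simp add: quotient_module_def)

lemma quotient_add:
  "x \<in> carrier M \<Longrightarrow> y \<in> carrier M \<Longrightarrow>
    (N +>\<^bsub>M\<^esub> x) \<oplus>\<^bsub>quotient_module M N\<^esub> (N +>\<^bsub>M\<^esub> y) = N +>\<^bsub>M\<^esub> (x \<oplus>\<^bsub>M\<^esub> y)"
  using a_rcos_sum by (simp add: quotient_module_def)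

lemma quotient_smult:
  assumes a: "a \<in> carrier R" and x: "x \<in> carrier M"
  shows "a \<odot>\<^bsub>quotient_module M N\<^esub> (N +>\<^bsub>M\<^esub> x) = N +>\<^bsub>M\<^esub> (a \<odot>\<^bsub>M\<^esub> x)"
proof -
  have "N +>\<^bsub>M\<^esub> (a \<odot>\<^bsub>M\<^esub> y) = N +>\<^bsub>M\<^esub> (a \<odot>\<^bsub>M\<^esub> x)" if "y \<in> N +>\<^bsub>M\<^esub> x" for y
  proof -
    have y: "y \<in> carrier M" using a_elemrcos_carrier[OF x that] .
    have "y \<ominus>\<^bsub>M\<^esub> x \<in> N" using a_rcos_module_imp[OF x that] by (simp add: M.minus_eq)
    hence "a \<odot>\<^bsub>M\<^esub> y \<ominus>\<^bsub>M\<^esub> a \<odot>\<^bsub>M\<^esub> x \<in> N" using submodule_smult[OF N a, of "y \<ominus>\<^bsub>M\<^esub> x"] smult_r_diff[OF a y x] by simp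
    thus ?thesis using a x y by (simp add: coset_eq_iff smult_closed)
  qed
  moreover have "x \<in> N +>\<^bsub>M\<^esub> x" using x by (rule a_rcos_self)
  ultimately have "(\<Union>y\<in>N +>\<^bsub>M\<^esub> x. N +>\<^bsub>M\<^esub> (a \<odot>\<^bsub>M\<^esub> y)) = N +>\<^bsub>M\<^esub> (a \<odot>\<^bsub>M\<^esub> x)" by blast
  thus ?thesis by (simp add: quotient_module_def)
qed

lemma coset_eq_zero_iff: "x \<in> carrier M \<Longrightarrow> N +>\<^bsub>M\<^esub> x = \<zero>\<^bsub>quotient_module M N\<^esub> \<longleftrightarrow> x \<in> N"
  unfolding quotient_zero by (simp add: coset_eq_iff M.minus_zero_right)

lemma left_module_quotient: "left_module R (quotient_module M N)"
proof -
  let ?Q = "quotient_module M N"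
  note Q = quotient_carrier quotient_zero quotient_add quotient_smult
  have "abelian_group ?Q"
  proof (rule abelian_groupI)
    fix X assume "X \<in> carrier ?Q"
    then obtain x where x: "x \<in> carrier M" "X = N +>\<^bsub>M\<^esub> x" by (auto simp: Q)
    have "(N +>\<^bsub>M\<^esub> \<ominus>\<^bsub>M\<^esub> x) \<oplus>\<^bsub>?Q\<^esub> X = \<zero>\<^bsub>?Q\<^esub>" using x by (simp add: Q M.l_neg)
    thus "\<exists>Y\<in>carrier ?Q. Y \<oplus>\<^bsub>?Q\<^esub> X = \<zero>\<^bsub>?Q\<^esub>" using x by (auto simp: Q(1))
  qed (auto simp: Q M.a_ac)
  thus ?thesis
    using R.ring_axioms
    by (intro left_module.intro left_module_axioms.intro)
       (auto simp: Q smult_closed smult_l_distr smult_r_distr smult_assoc smult_one)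
qed

lemma quotient_projection_hom: "(\<lambda>x. N +>\<^bsub>M\<^esub> x) \<in> left_module_hom R M (quotient_module M N)"
  by (rule left_module_homI) (auto simp: quotient_carrier quotient_add quotient_smult)

lemma hom_descends:
  assumes P: "left_module R P" and h: "h \<in> left_module_hom R M P"
    and ker: "\<And>x. x \<in> N \<Longrightarrow> h x = \<zero>\<^bsub>P\<^esub>"
  obtains g where "g \<in> left_module_hom R (quotient_module M N) P"
    "\<And>x. x \<in> carrier M \<Longrightarrow> g (N +>\<^bsub>M\<^esub> x) = h x"
proof -
  interpret P: left_module R P by (rule P)
  define g where "g X = h (SOME x. x \<in> carrier M \<and> N +>\<^bsub>M\<^esub> x = X)" for X
  have g: "g (N +>\<^bsub>M\<^esub> x) = h x" if x: "x \<in> carrier M" for x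
  proof -
    define y where "y = (SOME y. y \<in> carrier M \<and> N +>\<^bsub>M\<^esub> y = N +>\<^bsub>M\<^esub> x)"
    have y: "y \<in> carrier M" "N +>\<^bsub>M\<^esub> y = N +>\<^bsub>M\<^esub> x"
      using someI[of "\<lambda>y. y \<in> carrier M \<and> N +>\<^bsub>M\<^esub> y = N +>\<^bsub>M\<^esub> x" x] x by (simp_all add: y_def)
    hence "h (y \<ominus>\<^bsub>M\<^esub> x) = \<zero>\<^bsub>P\<^esub>" using coset_eq_iff x ker by blast
    hence "h y \<ominus>\<^bsub>P\<^esub> h x = \<zero>\<^bsub>P\<^esub>" using hom_diff[OF P h] x y(1) by simp
    hence "h y = h x" using left_module_hom_closed[OF h] x y(1) by simp
    thus ?thesis by (simp add: g_def y_def)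
  qed
  have "g \<in> left_module_hom R (quotient_module M N) P"
    using left_module_hom_closed[OF h] left_module_hom_add[OF h] left_module_hom_smult[OF h]
    by (intro left_module_homI) (auto simp: quotient_carrier quotient_add quotient_smult g smult_closed)
  thus ?thesis using that g by blast
qed

lemma quotient_submodule_is_image:
  assumes S: "Module.submodule S R (quotient_module M N)"
  obtains N' where "submod N'" "N \<subseteq> N'" "S = (\<lambda>x. N +>\<^bsub>M\<^esub> x) ` N'"
proof
  interpret Q: left_module R "quotient_module M N" by (rule left_module_quotient)
  let ?N' = "{x \<in> carrier M. N +>\<^bsub>M\<^esub> x \<in> S}"
  show "submod ?N'" by (rule submodule_preimage[OF left_module_quotient quotient_projection_hom S])
  show "N \<subseteq> ?N'"
  proof
    fix x assume x: "x \<in> N"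
    hence "x \<in> carrier M" using submodule_subset[OF N] by blast
    moreover from this x have "N +>\<^bsub>M\<^esub> x = \<zero>\<^bsub>quotient_module M N\<^esub>" by (simp add: coset_eq_zero_iff)
    ultimately show "x \<in> ?N'" using Q.submodule_zero[OF S] by simp
  qed
  show "S = (\<lambda>x. N +>\<^bsub>M\<^esub> x) ` ?N'"
    using Q.submodule_subset[OF S] by (auto simp: quotient_carrier)
qed

lemma irreducible_quotient:
  assumes proper: "N \<noteq> carrier M"
    and max: "\<And>N'. submod N' \<Longrightarrow> N \<subseteq> N' \<Longrightarrow> N' = N \<or> N' = carrier M"
  shows "irreducible_module R (quotient_module M N)"
  unfolding irreducible_module_def
proof (intro conjI allI impI)
  let ?Q = "quotient_module M N"
  obtain x where "x \<in> carrier M" "x \<notin> N" using submodule_subset[OF N] proper by blast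
  hence "N +>\<^bsub>M\<^esub> x \<in> carrier ?Q" "N +>\<^bsub>M\<^esub> x \<noteq> \<zero>\<^bsub>?Q\<^esub>"
    by (simp_all add: quotient_carrier coset_eq_zero_iff)
  thus "carrier ?Q \<noteq> {\<zero>\<^bsub>?Q\<^esub>}" by blast
  have coset_N: "N +>\<^bsub>M\<^esub> x = \<zero>\<^bsub>?Q\<^esub>" if "x \<in> N" for x
    using that submodule_subset[OF N] coset_eq_zero_iff[of x] by blast
  fix S assume S: "Module.submodule S R ?Q"
  obtain N' where N': "submod N'" "N \<subseteq> N'" and image: "S = (\<lambda>x. N +>\<^bsub>M\<^esub> x) ` N'"
    by (rule quotient_submodule_is_image[OF S])
  consider (zero) "N' = N" | (all) "N' = carrier M" using max[OF N'] by blast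
  thus "S = {\<zero>\<^bsub>?Q\<^esub>} \<or> S = carrier ?Q"
  proof cases
    case zero
    hence "S = (\<lambda>_. \<zero>\<^bsub>?Q\<^esub>) ` N" unfolding image using coset_N by (simp cong: image_cong)
    also have "\<dots> = {\<zero>\<^bsub>?Q\<^esub>}" using submodule_zero[OF N] by blast
    finally show ?thesis ..
  next
    case all
    thus ?thesis by (simp add: image quotient_carrier)
  qed
qed

end

lemma composition_series_step:
  assumes Ns: "composition_series R M Ns" and i: "Suc i < length Ns"
  shows "submod (Ns ! i)" "submod (Ns ! Suc i)" "Ns ! i \<subseteq> Ns ! Suc i"
    "irreducible_module R (composition_factor M Ns i)"
  using Ns i nth_mem[OF i] nth_mem[of i Ns] unfolding composition_series_def by auto

lemma composition_series_trivial: "carrier M = {\<zero>\<^bsub>M\<^esub>} \<Longrightarrow> composition_series R M [carrier M]"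
  using submodule_carrier by (simp add: composition_series_def)

lemma composition_series_snoc:
  assumes U: "submod U" and Ns: "composition_series R (M\<lparr>carrier := U\<rparr>) Ns"
    and irr: "irreducible_module R (quotient_module M U)"
  shows "composition_series R M (Ns @ [carrier M])"
proof -
  have Ns': "Ns \<noteq> []" "hd Ns = {\<zero>\<^bsub>M\<^esub>}" "last Ns = U"
    "\<And>N. N \<in> set Ns \<Longrightarrow> submod N"
    "\<And>i. Suc i < length Ns \<Longrightarrow> Ns ! i \<subseteq> Ns ! Suc i \<and>
       irreducible_module R (quotient_module (M\<lparr>carrier := Ns ! Suc i\<rparr>) (Ns ! i))"
    using Ns submodule_restrict_iff[OF U] by (auto simp: composition_series_def composition_factor_def)
  have "(Ns @ [carrier M]) ! i \<subseteq> (Ns @ [carrier M]) ! Suc i \<and>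
      irreducible_module R (composition_factor M (Ns @ [carrier M]) i)"
    if i: "Suc i < length (Ns @ [carrier M])" for i
  proof (cases "Suc i < length Ns")
    case True
    thus ?thesis using Ns'(5)[OF True] by (simp add: nth_append composition_factor_def)
  next
    case False
    hence "i = length Ns - 1" "Suc i = length Ns" using i by simp_all
    hence "(Ns @ [carrier M]) ! i = U" "(Ns @ [carrier M]) ! Suc i = carrier M"
      using Ns'(1,3) by (simp_all add: nth_append last_conv_nth)
    thus ?thesis using irr submodule_subset[OF U] by (simp add: composition_factor_def)
  qed
  thus ?thesis using Ns'(1,2,4) submodule_carrier by (auto simp: composition_series_def)
qed

end

lemma (in finite_length_module) composition_series_exists:
  "\<exists>Ns. composition_series R M Ns"
proof -
  obtain rank :: "'b set \<Rightarrow> nat"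
    where rank: "\<And>U U'. submod U \<Longrightarrow> submod U' \<Longrightarrow> U \<subset> U' \<Longrightarrow> rank U < rank U'"
    using finite_length by blast
  have "\<exists>Ns. composition_series R (M\<lparr>carrier := N\<rparr>) Ns" if "submod N" for N
    using that
  proof (induction "rank N" arbitrary: N rule: less_induct)
    case less
    interpret N: finite_length_module R "M\<lparr>carrier := N\<rparr>" by (rule finite_length_submodule[OF less.prems])
    note sub_iff = submodule_restrict_iff[OF less.prems]
    show ?case
    proof (cases "N = {\<zero>\<^bsub>M\<^esub>}")
      case True
      thus ?thesis using N.composition_series_trivial by auto
    next
      case False
      let ?proper = "\<lambda>U. N.submod U \<and> U \<noteq> N"
      obtain U where U: "?proper U" and max: "\<And>U'. ?proper U' \<Longrightarrow> U \<subseteq> U' \<Longrightarrow> U' = U"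
        by (rule N.maximal_submodule[of ?proper "{\<zero>\<^bsub>M\<^esub>}"]) (use False N.submodule_trivial in auto)
      have "irreducible_module R (quotient_module (M\<lparr>carrier := N\<rparr>) U)"
        using U max by (intro N.irreducible_quotient) auto
      moreover have "submod U" "U \<subset> N" using U sub_iff by auto
      then obtain Ns where "composition_series R (M\<lparr>carrier := U\<rparr>) Ns"
        using less.hyps rank less.prems by metis
      ultimately show ?thesis using N.composition_series_snoc[of U Ns] U by auto
    qed
  qed
  from this[OF submodule_carrier] show ?thesis by simp
qed


section \<open>Vector spaces\<close>

definition regular_module :: "('a, 'r) ring_scheme \<Rightarrow> ('a, 'a) module" where
  "regular_module R = \<lparr>carrier = carrier R, mult = mult R, one = \<one>\<^bsub>R\<^esub>, zero = \<zero>\<^bsub>R\<^esub>, add = add R,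
     smult = mult R\<rparr>"

lemma regular_module_simps [simp]:
  "carrier (regular_module R) = carrier R" "add (regular_module R) = add R"
  "\<zero>\<^bsub>regular_module R\<^esub> = \<zero>\<^bsub>R\<^esub>" "smult (regular_module R) = mult R"
  by (simp_all add: regular_module_def)

lemma (in ring) left_module_regular: "left_module R (regular_module R)"
proof -
  have "abelian_group (regular_module R)"
    by (rule abelian_groupI) (auto simp: a_ac intro: bexI[of _ "\<ominus> _"] l_neg)
  thus ?thesis
    using ring_axioms
    by (intro left_module.intro left_module_axioms.intro) (auto simp: l_distr r_distr m_assoc)
qed

sublocale vectorspace \<subseteq> left: left_module K V
  by unfold_locales (auto simp: smult_l_distr smult_r_distr smult_assoc1)

context vectorspace
begin

lemma submodule_iff: "left.submod W \<longleftrightarrow> LinearCombinations.submodule K W V"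
proof
  assume W: "left.submod W"
  show "LinearCombinations.submodule K W V"
    using left.submodule_subset[OF W] left.submodule_zero[OF W] left.submodule_add[OF W]
      left.submodule_smult[OF W] module_axioms
    by (intro LinearCombinations.submodule.intro) auto
next
  assume "LinearCombinations.submodule K W V"
  then interpret W: LinearCombinations.submodule K W V .
  show "left.submod W" using W.subset by (intro left.submoduleI) auto
qed

lemma submodule_smult_cancel:
  assumes W: "left.submod W" and x: "x \<in> carrier V" and c: "c \<in> carrier K" "c \<noteq> \<zero>\<^bsub>K\<^esub>" "c \<odot>\<^bsub>V\<^esub> x \<in> W"
  shows "x \<in> W"
proof -
  have inv: "inv\<^bsub>K\<^esub> c \<in> carrier K" "inv\<^bsub>K\<^esub> c \<otimes>\<^bsub>K\<^esub> c = \<one>\<^bsub>K\<^esub>"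
    using c(1,2) field_Units by (auto intro: Units_l_inv)
  hence "inv\<^bsub>K\<^esub> c \<odot>\<^bsub>V\<^esub> (c \<odot>\<^bsub>V\<^esub> x) = x"
    using x c(1) smult_assoc1[of "inv\<^bsub>K\<^esub> c" c x] by simp
  thus ?thesis using left.submodule_smult[OF W inv(1) c(3)] by simp
qed

lemma maximal_lin_indpt_subset:
  assumes fin_dim and "W \<subseteq> carrier V"
  obtains A where "A \<subseteq> W" "lin_indpt A" "finite A" "\<And>B. B \<subseteq> W \<Longrightarrow> lin_indpt B \<Longrightarrow> card B \<le> card A"
proof -
  let ?P = "\<lambda>A. A \<subseteq> W \<and> lin_indpt A"
  have "?P {}" by (auto simp: lin_dep_def)
  moreover have "card A < Suc dim" if "?P A" for A
    using li_le_dim(2)[OF assms(1)] that assms(2) by (metis less_Suc_eq_le subset_trans)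
  ultimately obtain A where "?P A" "\<And>B. ?P B \<Longrightarrow> card B \<le> card A"
    using ex_has_greatest_nat[of ?P "{}" card "Suc dim"] by blast
  thus ?thesis using that li_le_dim(1)[OF assms(1)] assms(2) by (metis subset_trans)
qed

lemma lin_indpt_insert:
  assumes "A \<subseteq> carrier V" "lin_indpt A" "x \<in> carrier V" "x \<notin> span A"
  shows "x \<notin> A" "lin_indpt (insert x A)"
proof -
  show "x \<notin> A" using in_own_span[OF assms(1)] assms(4) by blast
  thus "lin_indpt (insert x A)" using lin_dep_iff_in_span[of A x] assms by simp
qed

lemma finite_length_if_fin_dim:
  assumes fin_dim
  shows "finite_length_module K V"
proof -
  have "\<exists>A. U \<subseteq> carrier V \<longrightarrow> A \<subseteq> U \<and> lin_indpt A \<and> finite A \<and>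
      (\<forall>B. B \<subseteq> U \<longrightarrow> lin_indpt B \<longrightarrow> card B \<le> card A)" for U
    using maximal_lin_indpt_subset[OF assms, of U] by metis
  then obtain basis where basis: "\<And>U. U \<subseteq> carrier V \<Longrightarrow> basis U \<subseteq> U \<and> lin_indpt (basis U) \<and>
      finite (basis U) \<and> (\<forall>B. B \<subseteq> U \<longrightarrow> lin_indpt B \<longrightarrow> card B \<le> card (basis U))"
    by metis
  have "card (basis U) < card (basis U')"
    if U: "left.submod U" "left.submod U'" "U \<subset> U'" for U U'
  proof -
    note sub = left.submodule_subset[OF U(1)] left.submodule_subset[OF U(2)]
    obtain x where x: "x \<in> U'" "x \<notin> U" using U(3) by blast
    have "span (basis U) \<subseteq> U"
      using basis[OF sub(1)] U(1) by (intro span_is_subset) (simp_all add: submodule_iff)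
    hence "x \<notin> basis U" "lin_indpt (insert x (basis U))"
      using lin_indpt_insert[of "basis U" x] basis[OF sub(1)] sub x by blast+
    moreover have "insert x (basis U) \<subseteq> U'" using basis[OF sub(1)] U(3) x(1) by blast
    ultimately have "card (insert x (basis U)) \<le> card (basis U')" using basis[OF sub(2)] by blast
    thus ?thesis using \<open>x \<notin> basis U\<close> basis[OF sub(1)] by simp
  qed
  thus ?thesis by unfold_locales (intro exI[of _ "\<lambda>U. card (basis U)"], blast)
qed

lemma fin_dim_submodule:
  assumes fin_dim and W: "left.submod W"
  shows "vectorspace.fin_dim K (V\<lparr>carrier := W\<rparr>)"
proof -
  have W': "LinearCombinations.submodule K W V" using W by (simp add: submodule_iff)
  interpret W: vectorspace K "V\<lparr>carrier := W\<rparr>"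
    by (intro vectorspace.intro submodule_is_module W' field_axioms)
  note WV = left.submodule_subset[OF W]
  obtain A where A: "A \<subseteq> W" "lin_indpt A" "finite A"
    and max: "\<And>B. B \<subseteq> W \<Longrightarrow> lin_indpt B \<Longrightarrow> card B \<le> card A"
    using maximal_lin_indpt_subset[OF assms(1) WV] by blast
  have "x \<in> span A" if x: "x \<in> W" for x
  proof (rule ccontr)
    assume "x \<notin> span A"
    hence ins: "x \<notin> A" "lin_indpt (insert x A)" using lin_indpt_insert[of A x] A WV x by blast+
    hence "card (insert x A) \<le> card A" using max[of "insert x A"] A(1) x by blast
    thus False using ins(1) A(3) by simp
  qed
  hence "span A = W" using span_is_subset[OF A(1) W'] by blast
  hence "W.span A = W" using span_li_not_depend(1)[OF A(1) W'] by simp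
  thus ?thesis using A unfolding W.fin_dim_def by auto
qed

lemma dim_nonzero:
  assumes fin_dim "carrier V \<noteq> {\<zero>\<^bsub>V\<^esub>}"
  shows "dim \<noteq> 0"
proof
  obtain B where B: "finite B" "basis B" using finite_basis_exists[OF assms(1)] by blast
  assume "dim = 0"
  hence "B = {}" using dim_basis[OF B] B(1) by simp
  thus False using B(2) assms(2) span_empty by (simp add: basis_def)
qed

lemma functional_extends:
  assumes fd: fin_dim and W: "left.submod W"
    and h: "h \<in> left_module_hom K (V\<lparr>carrier := W\<rparr>) (regular_module K)"
  obtains \<phi> where "\<phi> \<in> left_module_hom K V (regular_module K)" "\<And>x. x \<in> W \<Longrightarrow> \<phi> x = h x"
proof -
  interpret finite_length_module K V by (rule finite_length_if_fin_dim[OF fd])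
  show ?thesis
  proof (rule hom_extends[OF left_module_regular _ W h])
    fix U g e
    assume U: "left.submod U" and g: "g \<in> left_module_hom K (V\<lparr>carrier := U\<rparr>) (regular_module K)"
      and e: "e \<in> carrier V"
    interpret U: left_module K "V\<lparr>carrier := U\<rparr>" by (rule left.left_module_submodule[OF U])
    show "\<exists>y\<in>carrier (regular_module K). \<forall>q\<in>carrier K. q \<odot>\<^bsub>V\<^esub> e \<in> U \<longrightarrow>
      g (q \<odot>\<^bsub>V\<^esub> e) = q \<odot>\<^bsub>regular_module K\<^esub> y"
    proof (cases "e \<in> U")
      case True
      thus ?thesis
        using left_module_hom_closed[OF g] left_module_hom_smult[OF g] by (intro bexI[of _ "g e"]) auto
    next
      case False
      have "g (q \<odot>\<^bsub>V\<^esub> e) = \<zero>\<^bsub>K\<^esub>" if "q \<in> carrier K" "q \<odot>\<^bsub>V\<^esub> e \<in> U" for q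
      proof -
        have "q = \<zero>\<^bsub>K\<^esub>" using submodule_smult_cancel[OF U e that(1)] that(2) False by blast
        thus ?thesis using U.hom_zero[OF left_module_regular g] e by simp
      qed
      thus ?thesis by (intro bexI[of _ "\<zero>\<^bsub>K\<^esub>"]) auto
    qed
  qed (use that in blast)
qed

lemma separating_functional:
  assumes fd: fin_dim and W: "left.submod W" and x: "x \<in> carrier V" "x \<notin> W"
  obtains \<phi> where "\<phi> \<in> left_module_hom K V (regular_module K)" "\<And>w. w \<in> W \<Longrightarrow> \<phi> w = \<zero>\<^bsub>K\<^esub>" "\<phi> x = \<one>\<^bsub>K\<^esub>"
proof -
  have zero: "(\<lambda>_. \<zero>\<^bsub>K\<^esub>) \<in> left_module_hom K (V\<lparr>carrier := W\<rparr>) (regular_module K)"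
    by (rule left_module_homI) auto
  have "\<zero>\<^bsub>K\<^esub> = q \<odot>\<^bsub>regular_module K\<^esub> \<one>\<^bsub>K\<^esub>" if "q \<in> carrier K" "q \<odot>\<^bsub>V\<^esub> x \<in> W" for q
    using submodule_smult_cancel[OF W x(1) that(1)] that x(2) by auto
  then obtain h where h: "h \<in> left_module_hom K (V\<lparr>carrier := adjoin K V W x\<rparr>) (regular_module K)"
    "\<And>w. w \<in> W \<Longrightarrow> h w = \<zero>\<^bsub>K\<^esub>" "h x = \<one>\<^bsub>K\<^esub>"
    using left.hom_extend_adjoin[OF left_module_regular W x(1) zero, of "\<one>\<^bsub>K\<^esub>"] by auto
  obtain \<phi> where \<phi>: "\<phi> \<in> left_module_hom K V (regular_module K)"
    "\<And>w. w \<in> adjoin K V W x \<Longrightarrow> \<phi> w = h w"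
    by (rule functional_extends[OF fd left.submodule_adjoin[OF W x(1)] h(1)]) blast
  show ?thesis
    using that[OF \<phi>(1)] \<phi>(2) h(2,3) left.adjoin_superset[OF W x(1)] left.adjoin_self[OF W x(1)]
    by (metis subsetD)
qed

end


section \<open>Normed spaces over a complete non-archimedean field\<close>

definition nonarch_seminorm :: "('k::field \<Rightarrow> real) \<Rightarrow> ('k, 'b, 'm) module_scheme \<Rightarrow> ('b \<Rightarrow> real) \<Rightarrow> bool" where
  "nonarch_seminorm v V \<nu> \<longleftrightarrow> (\<forall>x\<in>carrier V. 0 \<le> \<nu> x) \<and>
     (\<forall>x\<in>carrier V. \<forall>y\<in>carrier V. \<nu> (x \<oplus>\<^bsub>V\<^esub> y) \<le> max (\<nu> x) (\<nu> y)) \<and>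
     (\<forall>c. \<forall>x\<in>carrier V. \<nu> (c \<odot>\<^bsub>V\<^esub> x) = v c * \<nu> x)"

locale nonarch_vector_space = nonarch_field v + vectorspace "class_ring :: 'k ring" V
  for v :: "'k::field \<Rightarrow> real" and V :: "('k, 'b, 'm) module_scheme"
begin

lemma scale_0 [simp]: "x \<in> carrier V \<Longrightarrow> 0 \<odot>\<^bsub>V\<^esub> x = \<zero>\<^bsub>V\<^esub>"
  using left.smult_l_zero by simp

lemma scale_1 [simp]: "x \<in> carrier V \<Longrightarrow> 1 \<odot>\<^bsub>V\<^esub> x = x"
  using smult_one by simp

lemma scale_diff: "x \<in> carrier V \<Longrightarrow> (a - b) \<odot>\<^bsub>V\<^esub> x = a \<odot>\<^bsub>V\<^esub> x \<ominus>\<^bsub>V\<^esub> b \<odot>\<^bsub>V\<^esub> x"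
  using left.smult_l_diff[of a b x] by (simp add: class_ring_simps)

lemma nonarch_seminorm_max_functional:
  assumes \<nu>: "nonarch_seminorm v V \<nu>" and e: "e \<in> carrier V"
    and \<phi>: "\<phi> \<in> left_module_hom class_ring V (regular_module class_ring)"
  shows "nonarch_seminorm v V (\<lambda>x. max (\<nu> (x \<ominus>\<^bsub>V\<^esub> \<phi> x \<odot>\<^bsub>V\<^esub> e)) (v (\<phi> x)))"
proof -
  define p where "p x = x \<ominus>\<^bsub>V\<^esub> \<phi> x \<odot>\<^bsub>V\<^esub> e" for x
  have \<phi>_add: "\<phi> (x \<oplus>\<^bsub>V\<^esub> y) = \<phi> x + \<phi> y" if "x \<in> carrier V" "y \<in> carrier V" for x y
    using left_module_hom_add[OF \<phi> that] by simp
  have \<phi>_smult: "\<phi> (c \<odot>\<^bsub>V\<^esub> x) = c * \<phi> x" if "x \<in> carrier V" for c x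
    using left_module_hom_smult[OF \<phi> that, of c] by simp
  have p_closed: "p x \<in> carrier V" if "x \<in> carrier V" for x using that e by (simp add: p_def)
  have p_add: "p (x \<oplus>\<^bsub>V\<^esub> y) = p x \<oplus>\<^bsub>V\<^esub> p y" if "x \<in> carrier V" "y \<in> carrier V" for x y
    using that e smult_l_distr[of "\<phi> x" "\<phi> y" e] by (simp add: p_def \<phi>_add M.abelian_group_simps)
  have p_smult: "p (c \<odot>\<^bsub>V\<^esub> x) = c \<odot>\<^bsub>V\<^esub> p x" if "x \<in> carrier V" for c x
    using that e smult_assoc1[of c "\<phi> x" e] by (simp add: p_def \<phi>_smult left.smult_r_diff)
  show ?thesis
    unfolding nonarch_seminorm_def p_def[symmetric]
  proof (intro conjI ballI allI)
    fix x assume x: "x \<in> carrier V"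
    show "0 \<le> max (\<nu> (p x)) (v (\<phi> x))" by (simp add: le_max_iff_disj v_nonneg)
    have "\<nu> (p (c \<odot>\<^bsub>V\<^esub> x)) = v c * \<nu> (p x)" for c
      using \<nu> p_closed[OF x] p_smult[OF x] by (simp add: nonarch_seminorm_def)
    thus "max (\<nu> (p (c \<odot>\<^bsub>V\<^esub> x))) (v (\<phi> (c \<odot>\<^bsub>V\<^esub> x))) = v c * max (\<nu> (p x)) (v (\<phi> x))" for c
      using x v_nonneg[of c] by (simp add: \<phi>_smult v_mult max_mult_distrib_left)
    fix y assume y: "y \<in> carrier V"
    have "\<nu> (p (x \<oplus>\<^bsub>V\<^esub> y)) \<le> max (\<nu> (p x)) (\<nu> (p y))"
      using \<nu> p_closed x y by (simp add: nonarch_seminorm_def p_add)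
    thus "max (\<nu> (p (x \<oplus>\<^bsub>V\<^esub> y))) (v (\<phi> (x \<oplus>\<^bsub>V\<^esub> y))) \<le>
        max (max (\<nu> (p x)) (v (\<phi> x))) (max (\<nu> (p y)) (v (\<phi> y)))"
      using x y v_ultrametric[of "\<phi> x" "\<phi> y"] by (auto simp: \<phi>_add)
  qed
qed

lemma seminorm_definite_on_adjoin:
  assumes \<nu>: "nonarch_seminorm v V \<nu>" "\<And>x. x \<in> W \<Longrightarrow> \<nu> x = 0 \<Longrightarrow> x = \<zero>\<^bsub>V\<^esub>"
    and W: "left.submod W" and e: "e \<in> carrier V"
    and \<phi>: "\<phi> \<in> left_module_hom class_ring V (regular_module class_ring)"
      "\<And>w. w \<in> W \<Longrightarrow> \<phi> w = 0" "\<phi> e = 1"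
  obtains \<mu> where "nonarch_seminorm v V \<mu>"
    "\<And>x. x \<in> adjoin class_ring V W e \<Longrightarrow> \<mu> x = 0 \<Longrightarrow> x = \<zero>\<^bsub>V\<^esub>"
proof
  let ?\<mu> = "\<lambda>x. max (\<nu> (x \<ominus>\<^bsub>V\<^esub> \<phi> x \<odot>\<^bsub>V\<^esub> e)) (v (\<phi> x))"
  show "nonarch_seminorm v V ?\<mu>" by (rule nonarch_seminorm_max_functional[OF \<nu>(1) e \<phi>(1)])
  fix x assume x: "x \<in> adjoin class_ring V W e" "?\<mu> x = 0"
  obtain w c where w: "w \<in> W" "w \<in> carrier V" "x = w \<oplus>\<^bsub>V\<^esub> c \<odot>\<^bsub>V\<^esub> e"
    using left.adjoinE[OF W x(1)] by metis
  have c: "\<phi> x = c"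
    using w e \<phi>(2,3) left_module_hom_add[OF \<phi>(1) w(2), of "c \<odot>\<^bsub>V\<^esub> e"] left_module_hom_smult[OF \<phi>(1) e, of c]
    by simp
  hence "x \<ominus>\<^bsub>V\<^esub> \<phi> x \<odot>\<^bsub>V\<^esub> e = w" using w e by (simp add: M.add_minus_cancel)
  hence "\<nu> w \<le> 0" "v c \<le> 0" using x(2) c by (simp_all add: max_def split: if_splits)
  moreover have "0 \<le> \<nu> w" using \<nu>(1) w(2) by (simp add: nonarch_seminorm_def)
  ultimately have "w = \<zero>\<^bsub>V\<^esub>" "c = 0" using \<nu>(2)[OF w(1)] v_nonneg[of c] by (auto simp: order.antisym)
  thus "x = \<zero>\<^bsub>V\<^esub>" using w e by simp
qed

lemma norm_exists:
  assumes fd: fin_dim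
  obtains \<nu> where "nonarch_seminorm v V \<nu>" "\<And>x. x \<in> carrier V \<Longrightarrow> \<nu> x = 0 \<Longrightarrow> x = \<zero>\<^bsub>V\<^esub>"
proof -
  interpret finite_length_module class_ring V by (rule finite_length_if_fin_dim[OF fd])
  let ?P = "\<lambda>W. \<exists>\<nu>. nonarch_seminorm v V \<nu> \<and> (\<forall>x\<in>W. \<nu> x = 0 \<longrightarrow> x = \<zero>\<^bsub>V\<^esub>)"
  have "?P (carrier V)"
  proof (rule adjoin_induct[OF left.submodule_trivial, of ?P])
    show "?P {\<zero>\<^bsub>V\<^esub>}" by (intro exI[of _ "\<lambda>_. 0"]) (simp add: nonarch_seminorm_def)
    fix W e
    assume W: "left.submod W" and e: "e \<in> carrier V" "e \<notin> W" and "?P W"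
    then obtain \<nu> where \<nu>: "nonarch_seminorm v V \<nu>" "\<And>x. x \<in> W \<Longrightarrow> \<nu> x = 0 \<Longrightarrow> x = \<zero>\<^bsub>V\<^esub>" by blast
    obtain \<phi> where "\<phi> \<in> left_module_hom class_ring V (regular_module class_ring)"
      "\<And>w. w \<in> W \<Longrightarrow> \<phi> w = 0" "\<phi> e = 1"
      using separating_functional[OF fd W e] by auto
    from seminorm_definite_on_adjoin[OF \<nu> W e(1) this] show "?P (adjoin class_ring V W e)" by metis
  qed
  thus ?thesis using that by blast
qed

end

locale nonarch_normed_space = complete_nonarch_field v + nonarch_vector_space v V
  for v :: "'k::field \<Rightarrow> real" and V :: "('k, 'b, 'm) module_scheme" +
  fixes \<nu> :: "'b \<Rightarrow> real"
  assumes seminorm: "nonarch_seminorm v V \<nu>"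
    and definite: "x \<in> carrier V \<Longrightarrow> \<nu> x = 0 \<Longrightarrow> x = \<zero>\<^bsub>V\<^esub>"
begin

lemma norm_nonneg: "x \<in> carrier V \<Longrightarrow> 0 \<le> \<nu> x"
  and norm_add: "x \<in> carrier V \<Longrightarrow> y \<in> carrier V \<Longrightarrow> \<nu> (x \<oplus>\<^bsub>V\<^esub> y) \<le> max (\<nu> x) (\<nu> y)"
  and norm_smult: "x \<in> carrier V \<Longrightarrow> \<nu> (c \<odot>\<^bsub>V\<^esub> x) = v c * \<nu> x"
  using seminorm by (simp_all add: nonarch_seminorm_def)

lemma norm_zero [simp]: "\<nu> \<zero>\<^bsub>V\<^esub> = 0"
  using norm_smult[of "\<zero>\<^bsub>V\<^esub>" 0] by simp

lemma norm_minus: "x \<in> carrier V \<Longrightarrow> \<nu> (\<ominus>\<^bsub>V\<^esub> x) = \<nu> x"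
  using norm_smult[of x "- 1"] left.smult_l_minus[of 1 x] by (simp add: class_ring_simps del: scale_1) simp

lemma norm_diff: "x \<in> carrier V \<Longrightarrow> y \<in> carrier V \<Longrightarrow> \<nu> (x \<ominus>\<^bsub>V\<^esub> y) \<le> max (\<nu> x) (\<nu> y)"
  using norm_add[of x "\<ominus>\<^bsub>V\<^esub> y"] by (simp add: norm_minus M.minus_eq)

text \<open>A \<^const>\<open>Metric_space\<close> is required to be nonnegative and symmetric off its carrier as well.\<close>

definition norm_dist :: "'b \<Rightarrow> 'b \<Rightarrow> real" where
  "norm_dist x y = (if x \<in> carrier V \<and> y \<in> carrier V then \<nu> (x \<ominus>\<^bsub>V\<^esub> y) else 0)"

lemma Metric_space_norm_dist: "Metric_space (carrier V) norm_dist"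
proof
  show "0 \<le> norm_dist x y" for x y by (simp add: norm_dist_def norm_nonneg)
  show "norm_dist x y = norm_dist y x" for x y
    using norm_minus[of "y \<ominus>\<^bsub>V\<^esub> x"] by (auto simp: norm_dist_def M.abelian_group_simps)
  fix x y assume x: "x \<in> carrier V" and y: "y \<in> carrier V"
  show "norm_dist x y = 0 \<longleftrightarrow> x = y"
    using x y definite[of "x \<ominus>\<^bsub>V\<^esub> y"] M.minus_other_side[of x y]
    by (metis M.minus_closed norm_dist_def norm_zero)
  fix z assume z: "z \<in> carrier V"
  have "x \<ominus>\<^bsub>V\<^esub> z = (x \<ominus>\<^bsub>V\<^esub> y) \<oplus>\<^bsub>V\<^esub> (y \<ominus>\<^bsub>V\<^esub> z)" using x y z by (simp add: M.abelian_group_simps)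
  hence "\<nu> (x \<ominus>\<^bsub>V\<^esub> z) \<le> max (\<nu> (x \<ominus>\<^bsub>V\<^esub> y)) (\<nu> (y \<ominus>\<^bsub>V\<^esub> z))" using x y z norm_add by simp
  also have "\<dots> \<le> \<nu> (x \<ominus>\<^bsub>V\<^esub> y) + \<nu> (y \<ominus>\<^bsub>V\<^esub> z)" using x y z norm_nonneg by simp
  finally show "norm_dist x z \<le> norm_dist x y + norm_dist y z" using x y z by (simp add: norm_dist_def)
qed

lemma mcomplete_norm_dist_iff:
  assumes W: "left.submod W"
  shows "Metric_space.mcomplete W norm_dist \<longleftrightarrow> (\<forall>w. range w \<subseteq> W \<longrightarrow>
    (\<forall>\<epsilon>>0. \<exists>N. \<forall>m\<ge>N. \<forall>n\<ge>N. \<nu> (w m \<ominus>\<^bsub>V\<^esub> w n) < \<epsilon>) \<longrightarrow> (\<exists>l\<in>W. (\<lambda>n. \<nu> (w n \<ominus>\<^bsub>V\<^esub> l)) \<longlonglongrightarrow> 0))"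
proof -
  note WV = left.submodule_subset[OF W]
  interpret W: Metric_space W norm_dist by (rule Metric_space.subspace[OF Metric_space_norm_dist WV])
  have dist: "norm_dist x y = \<nu> (x \<ominus>\<^bsub>V\<^esub> y)" if "x \<in> W" "y \<in> W" for x y
    using that WV by (auto simp: norm_dist_def)
  have MCauchy_iff: "W.MCauchy w \<longleftrightarrow> range w \<subseteq> W \<and> (\<forall>\<epsilon>>0. \<exists>N. \<forall>m\<ge>N. \<forall>n\<ge>N. \<nu> (w m \<ominus>\<^bsub>V\<^esub> w n) < \<epsilon>)" for w
    unfolding W.MCauchy_def using dist by (auto simp: image_subset_iff)
  have limitin_iff: "limitin W.mtopology w l sequentially \<longleftrightarrow> l \<in> W \<and> (\<lambda>n. \<nu> (w n \<ominus>\<^bsub>V\<^esub> l)) \<longlonglongrightarrow> 0"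
    if "range w \<subseteq> W" for w l
  proof -
    have w: "w n \<in> W" for n using that by blast
    have "(\<lambda>n. norm_dist (w n) l) = (\<lambda>n. \<nu> (w n \<ominus>\<^bsub>V\<^esub> l))" if "l \<in> W"
      by (simp add: dist[OF w that])
    thus ?thesis by (auto simp: W.limitin_metric_dist_null w)
  qed
  show ?thesis
    by (simp add: W.mcomplete_def MCauchy_iff limitin_iff Bex_def imp_conjL cong: imp_cong)
qed

lemma complete_submodule_distance:
  assumes W: "left.submod W" "Metric_space.mcomplete W norm_dist" and e: "e \<in> carrier V" "e \<notin> W"
  obtains d where "d > 0" "\<And>w. w \<in> W \<Longrightarrow> d \<le> \<nu> (w \<oplus>\<^bsub>V\<^esub> e)"
proof -
  note WV = left.submodule_subset[OF W(1)]
  interpret Submetric "carrier V" norm_dist W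
    by (intro Submetric.intro Submetric_axioms.intro Metric_space_norm_dist WV)
  have "\<ominus>\<^bsub>V\<^esub> e \<notin> W" using left.submodule_minus[OF W(1), of "\<ominus>\<^bsub>V\<^esub> e"] e by auto
  then obtain d where d: "d > 0" "disjnt W (mball (\<ominus>\<^bsub>V\<^esub> e) d)"
    using mcomplete_imp_closedin[OF W(2)] e(1) unfolding closedin_metric by blast
  have "d \<le> \<nu> (w \<oplus>\<^bsub>V\<^esub> e)" if w: "w \<in> W" for w
  proof -
    have "\<not> norm_dist (\<ominus>\<^bsub>V\<^esub> e) w < d" using d(2) w WV e(1) by (auto simp: disjnt_iff)
    moreover have "norm_dist w (\<ominus>\<^bsub>V\<^esub> e) = \<nu> (w \<oplus>\<^bsub>V\<^esub> e)"
      using w WV e(1) by (auto simp: norm_dist_def M.minus_eq)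
    ultimately show ?thesis by (simp add: commute)
  qed
  thus ?thesis using that d(1) by blast
qed

lemma complete_submodule_coefficient_le:
  assumes W: "left.submod W" "Metric_space.mcomplete W norm_dist" and e: "e \<in> carrier V" "e \<notin> W"
  obtains d where "d > 0" "\<And>w c. w \<in> W \<Longrightarrow> d * v c \<le> \<nu> (w \<oplus>\<^bsub>V\<^esub> c \<odot>\<^bsub>V\<^esub> e)"
proof -
  obtain d where d: "d > 0" "\<And>w. w \<in> W \<Longrightarrow> d \<le> \<nu> (w \<oplus>\<^bsub>V\<^esub> e)"
    using complete_submodule_distance[OF assms] by blast
  have "d * v c \<le> \<nu> (w \<oplus>\<^bsub>V\<^esub> c \<odot>\<^bsub>V\<^esub> e)" if w: "w \<in> W" for w c
  proof -
    have wV: "w \<in> carrier V" using w left.submodule_subset[OF W(1)] by blast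
    show ?thesis
    proof (cases "c = 0")
      case True
      thus ?thesis using wV e norm_nonneg[of w] by simp
    next
      case False
      let ?y = "inverse c \<odot>\<^bsub>V\<^esub> w \<oplus>\<^bsub>V\<^esub> e"
      have "c \<odot>\<^bsub>V\<^esub> ?y = w \<oplus>\<^bsub>V\<^esub> c \<odot>\<^bsub>V\<^esub> e"
        using wV e False smult_assoc1[of c "inverse c" w] by (simp add: smult_r_distr)
      hence "\<nu> (w \<oplus>\<^bsub>V\<^esub> c \<odot>\<^bsub>V\<^esub> e) = v c * \<nu> ?y" using norm_smult[of ?y c] wV e by simp
      moreover have le: "d \<le> \<nu> ?y"
        using left.submodule_smult[OF W(1) _ w, of "inverse c"] by (intro d(2)) simp
      ultimately show ?thesis using mult_left_mono[OF le v_nonneg[of c]] by (simp add: mult.commute)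
    qed
  qed
  thus ?thesis using that d(1) by blast
qed

lemma complete_submodule_decomposition:
  assumes W: "left.submod W" "Metric_space.mcomplete W norm_dist" and e: "e \<in> carrier V" "e \<notin> W"
  obtains C where "C > 0"
    "\<And>w c. w \<in> W \<Longrightarrow> v c \<le> C * \<nu> (w \<oplus>\<^bsub>V\<^esub> c \<odot>\<^bsub>V\<^esub> e) \<and> \<nu> w \<le> C * \<nu> (w \<oplus>\<^bsub>V\<^esub> c \<odot>\<^bsub>V\<^esub> e)"
proof -
  obtain d where d: "d > 0" "\<And>w c. w \<in> W \<Longrightarrow> d * v c \<le> \<nu> (w \<oplus>\<^bsub>V\<^esub> c \<odot>\<^bsub>V\<^esub> e)"
    using complete_submodule_coefficient_le[OF assms] by blast
  define C where "C = max (1 / d) (max 1 (\<nu> e / d))"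
  have "v c \<le> C * \<nu> (w \<oplus>\<^bsub>V\<^esub> c \<odot>\<^bsub>V\<^esub> e) \<and> \<nu> w \<le> C * \<nu> (w \<oplus>\<^bsub>V\<^esub> c \<odot>\<^bsub>V\<^esub> e)" if w: "w \<in> W" for w c
  proof -
    have wV: "w \<in> carrier V" using w left.submodule_subset[OF W(1)] by blast
    let ?x = "w \<oplus>\<^bsub>V\<^esub> c \<odot>\<^bsub>V\<^esub> e"
    have x: "?x \<in> carrier V" "0 \<le> \<nu> ?x" using wV e by (simp_all add: norm_nonneg)
    have vc: "v c \<le> 1 / d * \<nu> ?x" using d(2)[OF w, of c] d(1) by (simp add: field_simps)
    have "w = ?x \<ominus>\<^bsub>V\<^esub> c \<odot>\<^bsub>V\<^esub> e" using wV e by (simp add: M.add_minus_cancel)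
    hence "\<nu> w \<le> max (\<nu> ?x) (v c * \<nu> e)" using norm_diff[OF x(1), of "c \<odot>\<^bsub>V\<^esub> e"] e by (simp add: norm_smult)
    also have "\<dots> \<le> max (1 * \<nu> ?x) (\<nu> e / d * \<nu> ?x)"
      using mult_right_mono[OF vc norm_nonneg[OF e(1)]] by (intro max.mono) (simp_all add: mult_ac)
    also have "\<dots> \<le> C * \<nu> ?x"
      using x(2) unfolding C_def by (intro max.boundedI mult_right_mono) auto
    finally show ?thesis
      using vc mult_right_mono[OF max.cobounded1 x(2), of "1 / d" "max 1 (\<nu> e / d)"] by (simp add: C_def)
  qed
  moreover have "C > 0" using d(1) by (simp add: C_def less_max_iff_disj)
  ultimately show ?thesis using that by blast
qed

lemma add_smult_diff:
  assumes "w \<in> carrier V" "w' \<in> carrier V" "e \<in> carrier V"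
  shows "(w \<oplus>\<^bsub>V\<^esub> c \<odot>\<^bsub>V\<^esub> e) \<ominus>\<^bsub>V\<^esub> (w' \<oplus>\<^bsub>V\<^esub> c' \<odot>\<^bsub>V\<^esub> e) = (w \<ominus>\<^bsub>V\<^esub> w') \<oplus>\<^bsub>V\<^esub> (c - c') \<odot>\<^bsub>V\<^esub> e"
  using assms by (simp add: scale_diff M.abelian_group_simps)

lemma tendsto_add_smult:
  assumes w: "\<And>n. w n \<in> carrier V" "(\<lambda>n. \<nu> (w n \<ominus>\<^bsub>V\<^esub> l)) \<longlonglongrightarrow> 0" "l \<in> carrier V"
    and c: "(\<lambda>n. v (c n - c')) \<longlonglongrightarrow> 0" and e: "e \<in> carrier V"
  shows "(\<lambda>n. \<nu> ((w n \<oplus>\<^bsub>V\<^esub> c n \<odot>\<^bsub>V\<^esub> e) \<ominus>\<^bsub>V\<^esub> (l \<oplus>\<^bsub>V\<^esub> c' \<odot>\<^bsub>V\<^esub> e))) \<longlonglongrightarrow> 0"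
proof -
  have "(\<lambda>n. max (\<nu> (w n \<ominus>\<^bsub>V\<^esub> l)) (v (c n - c') * \<nu> e)) \<longlonglongrightarrow> max 0 (0 * \<nu> e)"
    by (intro tendsto_intros w c)
  hence lim: "(\<lambda>n. max (\<nu> (w n \<ominus>\<^bsub>V\<^esub> l)) (v (c n - c') * \<nu> e)) \<longlonglongrightarrow> 0" by simp
  have upper: "\<nu> ((w n \<oplus>\<^bsub>V\<^esub> c n \<odot>\<^bsub>V\<^esub> e) \<ominus>\<^bsub>V\<^esub> (l \<oplus>\<^bsub>V\<^esub> c' \<odot>\<^bsub>V\<^esub> e)) \<le> max (\<nu> (w n \<ominus>\<^bsub>V\<^esub> l)) (v (c n - c') * \<nu> e)"
    for n
    using norm_add[of "w n \<ominus>\<^bsub>V\<^esub> l" "(c n - c') \<odot>\<^bsub>V\<^esub> e"] w e by (simp add: add_smult_diff norm_smult)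
  have "0 \<le> \<nu> ((w n \<oplus>\<^bsub>V\<^esub> c n \<odot>\<^bsub>V\<^esub> e) \<ominus>\<^bsub>V\<^esub> (l \<oplus>\<^bsub>V\<^esub> c' \<odot>\<^bsub>V\<^esub> e))" for n using w e by (simp add: norm_nonneg)
  thus ?thesis by (intro tendsto_sandwich[OF _ _ tendsto_const lim] always_eventually allI upper)
qed

lemma mcomplete_adjoin:
  assumes W: "left.submod W" "Metric_space.mcomplete W norm_dist" and e: "e \<in> carrier V" "e \<notin> W"
  shows "Metric_space.mcomplete (adjoin class_ring V W e) norm_dist"
  unfolding mcomplete_norm_dist_iff[OF left.submodule_adjoin[OF W(1) e(1)]]
proof (intro allI impI)
  fix x :: "nat \<Rightarrow> 'b"
  assume "range x \<subseteq> adjoin class_ring V W e"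
    and Cauchy: "\<forall>\<epsilon>>0. \<exists>N. \<forall>m\<ge>N. \<forall>n\<ge>N. \<nu> (x m \<ominus>\<^bsub>V\<^esub> x n) < \<epsilon>"
  hence "x n \<in> adjoin class_ring V W e" for n by blast
  hence "\<exists>w c. w \<in> W \<and> x n = w \<oplus>\<^bsub>V\<^esub> c \<odot>\<^bsub>V\<^esub> e" for n unfolding adjoin_def by blast
  then obtain w c where w: "\<And>n. w n \<in> W" and x: "\<And>n. x n = w n \<oplus>\<^bsub>V\<^esub> c n \<odot>\<^bsub>V\<^esub> e" by metis
  note WV = subsetD[OF left.submodule_subset[OF W(1)]]
  obtain C where C: "C > 0"
    "\<And>w c. w \<in> W \<Longrightarrow> v c \<le> C * \<nu> (w \<oplus>\<^bsub>V\<^esub> c \<odot>\<^bsub>V\<^esub> e) \<and> \<nu> w \<le> C * \<nu> (w \<oplus>\<^bsub>V\<^esub> c \<odot>\<^bsub>V\<^esub> e)"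
    using complete_submodule_decomposition[OF assms] by blast
  have coords: "\<exists>N. \<forall>m\<ge>N. \<forall>n\<ge>N. v (c m - c n) < \<epsilon> \<and> \<nu> (w m \<ominus>\<^bsub>V\<^esub> w n) < \<epsilon>" if \<epsilon>: "\<epsilon> > 0" for \<epsilon>
  proof -
    obtain N where N: "\<forall>m\<ge>N. \<forall>n\<ge>N. \<nu> (x m \<ominus>\<^bsub>V\<^esub> x n) < \<epsilon> / C" using Cauchy \<epsilon> C(1) by (meson divide_pos_pos)
    have "v (c m - c n) < \<epsilon> \<and> \<nu> (w m \<ominus>\<^bsub>V\<^esub> w n) < \<epsilon>" if "m \<ge> N" "n \<ge> N" for m n
    proof -
      have "C * \<nu> (x m \<ominus>\<^bsub>V\<^esub> x n) < \<epsilon>" using N that C(1) by (simp add: field_simps)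
      thus ?thesis
        using C(2)[OF left.submodule_diff[OF W(1) w w], of "c m - c n" m n]
        by (simp add: x add_smult_diff WV[OF w] e(1))
    qed
    thus ?thesis by blast
  qed
  obtain c' where c': "(\<lambda>n. v (c n - c')) \<longlonglongrightarrow> 0" using Cauchy_convergent[of c] coords by meson
  have "range w \<subseteq> W" using w by blast
  then obtain l where l: "l \<in> W" "(\<lambda>n. \<nu> (w n \<ominus>\<^bsub>V\<^esub> l)) \<longlonglongrightarrow> 0"
    using W(2) coords unfolding mcomplete_norm_dist_iff[OF W(1)] by meson
  have "(\<lambda>n. \<nu> (x n \<ominus>\<^bsub>V\<^esub> (l \<oplus>\<^bsub>V\<^esub> c' \<odot>\<^bsub>V\<^esub> e))) \<longlonglongrightarrow> 0"
    unfolding x by (rule tendsto_add_smult[OF WV[OF w] l(2) WV[OF l(1)] c' e(1)])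
  moreover have "l \<oplus>\<^bsub>V\<^esub> c' \<odot>\<^bsub>V\<^esub> e \<in> adjoin class_ring V W e" using left.adjoinI[OF l(1)] by simp
  ultimately show "\<exists>y\<in>adjoin class_ring V W e. (\<lambda>n. \<nu> (x n \<ominus>\<^bsub>V\<^esub> y)) \<longlonglongrightarrow> 0" by blast
qed

lemma mcomplete_trivial: "Metric_space.mcomplete {\<zero>\<^bsub>V\<^esub>} norm_dist"
proof -
  have "(\<lambda>n. \<nu> (w n \<ominus>\<^bsub>V\<^esub> \<zero>\<^bsub>V\<^esub>)) = (\<lambda>_. 0)" if "range w \<subseteq> {\<zero>\<^bsub>V\<^esub>}" for w :: "nat \<Rightarrow> 'b"
    using that by (auto simp: image_subset_iff M.minus_zero_right)
  thus ?thesis unfolding mcomplete_norm_dist_iff[OF left.submodule_trivial] by simp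
qed

lemma norm_dominates_on_adjoin:
  assumes W: "left.submod W" "Metric_space.mcomplete W norm_dist" and e: "e \<in> carrier V" "e \<notin> W"
    and add: "\<And>w c. w \<in> W \<Longrightarrow> \<phi> (w \<oplus>\<^bsub>V\<^esub> c \<odot>\<^bsub>V\<^esub> e) \<le> max (\<phi> w) (\<phi> (c \<odot>\<^bsub>V\<^esub> e))"
    and C: "C > 0" "\<And>w. w \<in> W \<Longrightarrow> \<phi> w \<le> C * \<nu> w" and B: "\<And>c. \<phi> (c \<odot>\<^bsub>V\<^esub> e) \<le> v c * B"
  obtains C' :: real where "C' > 0" "\<And>x. x \<in> adjoin class_ring V W e \<Longrightarrow> \<phi> x \<le> C' * \<nu> x"
proof -
  obtain D where D: "D > 0"
    "\<And>w c. w \<in> W \<Longrightarrow> v c \<le> D * \<nu> (w \<oplus>\<^bsub>V\<^esub> c \<odot>\<^bsub>V\<^esub> e) \<and> \<nu> w \<le> D * \<nu> (w \<oplus>\<^bsub>V\<^esub> c \<odot>\<^bsub>V\<^esub> e)"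
    using complete_submodule_decomposition[OF W e] by blast
  have "\<phi> x \<le> max C \<bar>B\<bar> * D * \<nu> x" if x_in: "x \<in> adjoin class_ring V W e" for x
  proof -
    obtain w c where w: "w \<in> W" "w \<in> carrier V" and x: "x = w \<oplus>\<^bsub>V\<^esub> c \<odot>\<^bsub>V\<^esub> e"
      using left.adjoinE[OF W(1) x_in] by metis
    have bounds: "v c \<le> D * \<nu> x" "\<nu> w \<le> D * \<nu> x" unfolding x using D(2)[OF w(1)] by auto
    have "\<phi> w \<le> max C \<bar>B\<bar> * (D * \<nu> x)"
      by (rule order.trans[OF C(2)[OF w(1)] mult_mono])
         (use C(1) bounds(2) norm_nonneg[OF w(2)] in auto)
    moreover have "\<phi> (c \<odot>\<^bsub>V\<^esub> e) \<le> max C \<bar>B\<bar> * (D * \<nu> x)"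
    proof -
      have "v c * B \<le> \<bar>B\<bar> * v c" using v_nonneg[of c] by (metis abs_ge_self mult.commute mult_right_mono)
      also have "\<dots> \<le> max C \<bar>B\<bar> * (D * \<nu> x)" using bounds(1) v_nonneg[of c] by (intro mult_mono) auto
      finally show ?thesis using B[of c] by simp
    qed
    ultimately show ?thesis using add[OF w(1), of c] by (simp add: x mult.assoc)
  qed
  moreover have "max C \<bar>B\<bar> * D > 0" using C(1) D(1) by simp
  ultimately show ?thesis using that by blast
qed

lemma norm_dominates:
  assumes fd: fin_dim
    and add: "\<And>x y. x \<in> carrier V \<Longrightarrow> y \<in> carrier V \<Longrightarrow> \<phi> (x \<oplus>\<^bsub>V\<^esub> y) \<le> max (\<phi> x) (\<phi> y)"
    and lines: "\<And>x. x \<in> carrier V \<Longrightarrow> \<exists>B. \<forall>c. \<phi> (c \<odot>\<^bsub>V\<^esub> x) \<le> v c * B"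
  obtains C :: real where "C > 0" "\<And>x. x \<in> carrier V \<Longrightarrow> \<phi> x \<le> C * \<nu> x"
proof -
  interpret finite_length_module class_ring V by (rule finite_length_if_fin_dim[OF fd])
  let ?P = "\<lambda>W. Metric_space.mcomplete W norm_dist \<and> (\<exists>C>0. \<forall>x\<in>W. \<phi> x \<le> C * \<nu> x)"
  have "?P (carrier V)"
  proof (rule adjoin_induct[OF left.submodule_trivial, of ?P])
    obtain B where "\<forall>c. \<phi> (c \<odot>\<^bsub>V\<^esub> \<zero>\<^bsub>V\<^esub>) \<le> v c * B" using lines by blast
    from this[rule_format, of 0] have "\<phi> \<zero>\<^bsub>V\<^esub> \<le> 1 * \<nu> \<zero>\<^bsub>V\<^esub>" by simp
    thus "?P {\<zero>\<^bsub>V\<^esub>}" using mcomplete_trivial by (intro conjI exI[of _ 1]) auto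
    fix W e
    assume W: "left.submod W" and e: "e \<in> carrier V" "e \<notin> W" and P: "?P W"
    obtain C where C: "C > 0" "\<And>x. x \<in> W \<Longrightarrow> \<phi> x \<le> C * \<nu> x" using P by blast
    obtain B where B: "\<And>c. \<phi> (c \<odot>\<^bsub>V\<^esub> e) \<le> v c * B" using lines[OF e(1)] by blast
    have "\<phi> (w \<oplus>\<^bsub>V\<^esub> c \<odot>\<^bsub>V\<^esub> e) \<le> max (\<phi> w) (\<phi> (c \<odot>\<^bsub>V\<^esub> e))" if "w \<in> W" for w c
      using that left.submodule_subset[OF W] e(1) by (intro add) auto
    then obtain C' where "C' > 0" "\<And>x. x \<in> adjoin class_ring V W e \<Longrightarrow> \<phi> x \<le> C' * \<nu> x"
      using norm_dominates_on_adjoin[OF W conjunct1[OF P] e _ C B] by blast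
    thus "?P (adjoin class_ring V W e)" using mcomplete_adjoin[OF W _ e] P by blast
  qed
  thus ?thesis using that by blast
qed

lemma norm_dominates_norm:
  assumes fd: fin_dim and \<mu>: "nonarch_normed_space v V \<mu>"
  obtains C :: real where "C > 0" "\<And>x. x \<in> carrier V \<Longrightarrow> \<mu> x \<le> C * \<nu> x"
proof -
  interpret \<mu>: nonarch_normed_space v V \<mu> by (rule \<mu>)
  show ?thesis by (rule norm_dominates[OF fd \<mu>.norm_add]) (use \<mu>.norm_smult that in auto)
qed

end


section \<open>Twisted polynomials\<close>

lemma twisted_ring_simps [simp]:
  "carrier (twisted_ring \<delta>) = UNIV" "\<zero>\<^bsub>twisted_ring \<delta>\<^esub> = 0" "\<one>\<^bsub>twisted_ring \<delta>\<^esub> = 1"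
  "add (twisted_ring \<delta>) = (+)" "mult (twisted_ring \<delta>) = twisted_act Polynomial.smult (T_mult \<delta>)"
  by (simp_all add: twisted_ring_def)

lemma diff_eq_0_or_degree_less:
  fixes p q :: "'a::ab_group_add poly"
  assumes "degree p = degree q" "lead_coeff p = lead_coeff q"
  shows "p - q = 0 \<or> degree (p - q) < degree p"
proof (cases "degree p = 0")
  case True
  hence "p = q" using assms degree_0_id[of p] degree_0_id[of q] by metis
  thus ?thesis by simp
next
  case False
  have "degree (p - q) \<le> degree p" using assms(1) degree_diff_le[of p "degree p" q] by simp
  moreover have "coeff (p - q) (degree p) = 0" using assms by simp
  ultimately show ?thesis by (metis le_neq_implies_less leading_coeff_0_iff)
qed

context derivation
begin

abbreviation tmult (infixl \<open>\<odot>t\<close> 70) where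
  "p \<odot>t q \<equiv> twisted_act Polynomial.smult (T_mult \<delta>) p q"

lemma twisted_ring_minus [simp]: "p \<ominus>\<^bsub>twisted_ring \<delta>\<^esub> q = p - q"
proof -
  interpret R: ring "twisted_ring \<delta>" by (rule ring_twisted_ring)
  have "\<ominus>\<^bsub>twisted_ring \<delta>\<^esub> q = - q" by (rule R.minus_equality) simp_all
  thus ?thesis by (simp add: a_minus_def)
qed

lemma tmult_const: "[:a:] \<odot>t q = Polynomial.smult a q"
  by (simp add: twisted_act_def)

lemma tmult_T: "p \<odot>t [:0, 1:] = pCons 0 p"
proof -
  have "(T_mult \<delta> ^^ i) [:0, 1:] = monom 1 (Suc i)" for i
    using Lpow_T[of "Suc i"] Lpow_T[of 1] by (simp add: funpow_swap1 monom_Suc flip: one_pCons)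
  hence "p \<odot>t [:0, 1:] = pCons 0 (\<Sum>i\<le>degree p. monom (coeff p i) i)"
    by (simp add: twisted_act_def smult_monom monom_Suc)
       (simp add: poly_eq_iff coeff_sum coeff_pCons split: nat.split)
  thus ?thesis by (simp add: poly_as_sum_of_monoms)
qed

lemma monom_tmult: "monom c m \<odot>t q = Polynomial.smult c ((T_mult \<delta> ^^ m) q)"
proof (cases "c = 0")
  case False
  thus ?thesis
    by (simp add: twisted_act_def degree_monom_eq if_distrib[of "\<lambda>z. Polynomial.smult z _"] cong: if_cong)
qed (simp add: twisted_act_def)

lemma T_mult_leading:
  assumes "q \<noteq> 0"
  shows "degree (T_mult \<delta> q) = Suc (degree q)" "lead_coeff (T_mult \<delta> q) = lead_coeff q"
proof -
  have "degree (map_poly \<delta> q) \<le> degree q"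
    by (rule degree_le) (simp add: coeff_map_poly d_zero coeff_eq_0)
  moreover have "degree (pCons 0 q) = Suc (degree q)" using assms by simp
  ultimately show deg: "degree (T_mult \<delta> q) = Suc (degree q)"
    by (simp add: T_mult_def degree_add_eq_left)
  show "lead_coeff (T_mult \<delta> q) = lead_coeff q"
    by (simp add: deg) (simp add: T_mult_def coeff_map_poly d_zero coeff_eq_0)
qed

lemma T_mult_pow_leading:
  assumes "q \<noteq> 0"
  shows "degree ((T_mult \<delta> ^^ m) q) = degree q + m \<and> lead_coeff ((T_mult \<delta> ^^ m) q) = lead_coeff q"
proof (induction m)
  case (Suc m)
  hence "(T_mult \<delta> ^^ m) q \<noteq> 0" using assms by force
  from T_mult_leading[OF this] Suc show ?case by (metis add_Suc_right funpow.simps(2) o_apply)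
qed simp

lemma twisted_division:
  assumes P: "P \<noteq> 0"
  shows "\<exists>u r. q = u \<odot>t P + r \<and> (r = 0 \<or> degree r < degree P)"
proof (induction "degree q" arbitrary: q rule: less_induct)
  case less
  interpret R: twisted_action \<delta> Polynomial.smult "T_mult \<delta>" by (rule twisted_action_poly)
  show ?case
  proof (cases "q = 0 \<or> degree q < degree P")
    case True
    thus ?thesis by (intro exI[of _ 0] exI[of _ q]) (auto simp: R.act_0)
  next
    case False
    define m where "m = degree q - degree P"
    define c where "c = lead_coeff q / lead_coeff P"
    have c: "c \<noteq> 0" using False P by (simp add: c_def)
    have "degree (monom c m \<odot>t P) = degree q" "lead_coeff (monom c m \<odot>t P) = lead_coeff q"
      using T_mult_pow_leading[OF P, of m] c P False by (auto simp: monom_tmult m_def c_def)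
    hence "q - monom c m \<odot>t P = 0 \<or> degree (q - monom c m \<odot>t P) < degree q"
      by (intro diff_eq_0_or_degree_less) simp_all
    then obtain u r where "q - monom c m \<odot>t P = u \<odot>t P + r" "r = 0 \<or> degree r < degree P"
      using less.hyps[of "q - monom c m \<odot>t P"] R.act_0 by (metis add_0)
    thus ?thesis
      by (intro exI[of _ "u + monom c m"] exI[of _ r]) (simp add: R.act_add_left algebra_simps)
  qed
qed

end


section \<open>Differential modules\<close>

lemma base_space_simps [simp]:
  "carrier (base_space M) = carrier M" "add (base_space M) = add M" "\<zero>\<^bsub>base_space M\<^esub> = \<zero>\<^bsub>M\<^esub>"
  "c \<odot>\<^bsub>base_space M\<^esub> x = [:c:] \<odot>\<^bsub>M\<^esub> x" "base_space (M\<lparr>carrier := N\<rparr>) = base_space M\<lparr>carrier := N\<rparr>"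
  by (simp_all add: base_space_def)

lemma base_space_minus [simp]: "x \<ominus>\<^bsub>base_space M\<^esub> y = x \<ominus>\<^bsub>M\<^esub> y"
  by (simp add: a_minus_def a_inv_def m_inv_def)

locale diff_module = derivation \<delta> + left_module "twisted_ring \<delta>" M
  for \<delta> :: "'k::field_char_0 \<Rightarrow> 'k" and M :: "('k poly, 'b, 'm) module_scheme" (structure)
begin

abbreviation act (infixr \<open>\<cdot>\<close> 75) where "p \<cdot> x \<equiv> p \<odot>\<^bsub>M\<^esub> x"
abbreviation T where "T \<equiv> \<lambda>x. [:0, 1:] \<odot>\<^bsub>M\<^esub> x"

lemma act_closed [simp, intro]: "x \<in> carrier M \<Longrightarrow> p \<cdot> x \<in> carrier M"
  using smult_closed by simp

lemma act_add_left: "x \<in> carrier M \<Longrightarrow> (p + q) \<cdot> x = p \<cdot> x \<oplus> q \<cdot> x"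
  using smult_l_distr[of p q x] by simp

lemma act_add_right: "x \<in> carrier M \<Longrightarrow> y \<in> carrier M \<Longrightarrow> p \<cdot> (x \<oplus> y) = p \<cdot> x \<oplus> p \<cdot> y"
  using smult_r_distr[of p x y] by simp

lemma act_diff_left: "x \<in> carrier M \<Longrightarrow> (p - q) \<cdot> x = p \<cdot> x \<ominus> q \<cdot> x"
  using smult_l_diff[of p q x] by simp

lemma act_diff_right: "x \<in> carrier M \<Longrightarrow> y \<in> carrier M \<Longrightarrow> p \<cdot> (x \<ominus> y) = p \<cdot> x \<ominus> p \<cdot> y"
  using smult_r_diff[of p x y] by simp

lemma act_mult: "x \<in> carrier M \<Longrightarrow> (p \<odot>t q) \<cdot> x = p \<cdot> (q \<cdot> x)"
  using smult_assoc[of p q x] by simp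

lemma act_0 [simp]: "x \<in> carrier M \<Longrightarrow> 0 \<cdot> x = \<zero>"
  using smult_l_zero[of x] by simp

lemma act_1 [simp]: "x \<in> carrier M \<Longrightarrow> [:1:] \<cdot> x = x"
  using smult_one[of x] by (simp add: one_pCons)

lemma smult_act: "x \<in> carrier M \<Longrightarrow> Polynomial.smult a p \<cdot> x = [:a:] \<cdot> p \<cdot> x"
  using act_mult[of x "[:a:]" p] by (simp add: tmult_const)

lemma T_const: "x \<in> carrier M \<Longrightarrow> T ([:a:] \<cdot> x) = [:a:] \<cdot> T x \<oplus> [:\<delta> a:] \<cdot> x"
proof -
  assume x: "x \<in> carrier M"
  have "T ([:a:] \<cdot> x) = (Polynomial.smult a [:0, 1:] + [:\<delta> a:]) \<cdot> x"
    using act_mult[OF x, of "[:0, 1:]" "[:a:]"] by (simp add: T_mult_right)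
  thus ?thesis by (simp only: act_add_left[OF x] smult_act[OF x])
qed

lemma pCons_act: "x \<in> carrier M \<Longrightarrow> pCons c p \<cdot> x = [:c:] \<cdot> x \<oplus> p \<cdot> T x"
proof -
  assume x: "x \<in> carrier M"
  have "pCons c p \<cdot> x = ([:c:] + pCons 0 p) \<cdot> x" by simp
  also have "\<dots> = [:c:] \<cdot> x \<oplus> (p \<odot>t [:0, 1:]) \<cdot> x" by (simp only: act_add_left[OF x] tmult_T)
  finally show ?thesis by (simp only: act_mult[OF x])
qed

lemma Tpow_closed: "x \<in> carrier M \<Longrightarrow> (T ^^ i) x \<in> carrier M"
  by (induction i) auto

lemma Tpow_add:
  "x \<in> carrier M \<Longrightarrow> y \<in> carrier M \<Longrightarrow>
    (T ^^ i) (x \<oplus> y) = (T ^^ i) x \<oplus> (T ^^ i) y"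
  by (induction i) (simp_all add: act_add_right Tpow_closed)

lemma Tpow_diff:
  "x \<in> carrier M \<Longrightarrow> y \<in> carrier M \<Longrightarrow>
    (T ^^ i) (x \<ominus> y) = (T ^^ i) x \<ominus> (T ^^ i) y"
  by (induction i) (simp_all add: act_diff_right Tpow_closed)

lemma vectorspace_base: "vectorspace class_ring (base_space M)"
proof -
  have "abelian_group (base_space M)"
  proof (rule abelian_groupI)
    fix x assume "x \<in> carrier (base_space M)"
    thus "\<exists>y\<in>carrier (base_space M). y \<oplus>\<^bsub>base_space M\<^esub> x = \<zero>\<^bsub>base_space M\<^esub>"
      by (auto simp: M.l_neg intro!: bexI[of _ "\<ominus> x"])
  qed (auto simp: M.a_ac)
  moreover have "[:a + b:] \<cdot> x = [:a:] \<cdot> x \<oplus> [:b:] \<cdot> x" "[:a * b:] \<cdot> x = [:a:] \<cdot> [:b:] \<cdot> x"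
    if "x \<in> carrier M" for a b x
    using act_add_left[OF that, of "[:a:]" "[:b:]"] smult_act[OF that, of a "[:b:]"] by simp_all
  ultimately have "Module.module class_ring (base_space M)"
    using class_field by (intro Module.moduleI) (auto simp: act_add_right field_def domain_def)
  thus ?thesis using class_field by (intro vectorspace.intro)
qed

sublocale base: vectorspace "class_ring :: 'k ring" "base_space M"
  by (rule vectorspace_base)

lemma submodule_iff_T_stable: "submod N \<longleftrightarrow> base.left.submod N \<and> (\<forall>x\<in>N. T x \<in> N)"
proof (intro iffI conjI ballI)
  assume N: "submod N"
  show "base.left.submod N"
    using submodule_subset[OF N] submodule_zero[OF N] submodule_add[OF N] submodule_smult[OF N]
    by (intro base.left.submoduleI) auto
  show "T x \<in> N" if "x \<in> N" for x using submodule_smult[OF N _ that] by simp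
next
  assume N: "base.left.submod N \<and> (\<forall>x\<in>N. T x \<in> N)"
  note base = base.left.submodule_subset[of N] base.left.submodule_zero[of N]
    base.left.submodule_add[of N] base.left.submodule_smult[of N]
  have "p \<cdot> x \<in> N" if "x \<in> N" for p x
    using that
  proof (induction p arbitrary: x)
    case 0
    thus ?case using base(1,2) N by auto
  next
    case (pCons c p)
    hence "[:c:] \<cdot> x \<in> N" "p \<cdot> T x \<in> N" using base(4)[of c x] N by auto
    hence "[:c:] \<cdot> x \<oplus> p \<cdot> T x \<in> N" using base(3) N by simp
    thus ?case using pCons_act[of x c p] pCons.prems base(1) N by auto
  qed
  thus "submod N" using base N by (intro submoduleI) auto
qed

lemma T_equivariant_imp_equivariant:
  assumes N: "diff_module \<delta> N"
    and base: "h \<in> left_module_hom class_ring (base_space M) (base_space N)"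
    and T: "\<And>x. x \<in> carrier M \<Longrightarrow> h (T x) = [:0, 1:] \<odot>\<^bsub>N\<^esub> h x" and x: "x \<in> carrier M"
  shows "h (p \<cdot> x) = p \<odot>\<^bsub>N\<^esub> h x"
proof -
  interpret N: diff_module \<delta> N by (rule N)
  have closed: "h x \<in> carrier N" if "x \<in> carrier M" for x
    using left_module_hom_closed[OF base] that by simp
  have add: "h (x \<oplus> y) = h x \<oplus>\<^bsub>N\<^esub> h y" if "x \<in> carrier M" "y \<in> carrier M" for x y
    using left_module_hom_add[OF base] that by simp
  have const: "h ([:c:] \<cdot> x) = [:c:] \<odot>\<^bsub>N\<^esub> h x" if "x \<in> carrier M" for c x
    using left_module_hom_smult[OF base, of x c] that by simp
  show ?thesis
    using x
  proof (induction p arbitrary: x)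
    case 0
    have "h \<zero> = \<zero>\<^bsub>N\<^esub>" using base.left.hom_zero[OF N.base.left.left_module_axioms base] by simp
    thus ?case using 0 closed[OF 0] by simp
  next
    case (pCons c p)
    note Tx = act_closed[OF pCons.prems, of "[:0, 1:]"]
    have "h (pCons c p \<cdot> x) = h ([:c:] \<cdot> x) \<oplus>\<^bsub>N\<^esub> h (p \<cdot> T x)"
      by (subst pCons_act[OF pCons.prems]) (rule add[OF act_closed[OF pCons.prems] act_closed[OF Tx]])
    also have "h ([:c:] \<cdot> x) = [:c:] \<odot>\<^bsub>N\<^esub> h x"
      by (rule const[OF pCons.prems])
    also have "h (p \<cdot> T x) = p \<odot>\<^bsub>N\<^esub> h (T x)"
      by (rule pCons.IH[OF Tx])
    also have "h (T x) = [:0, 1:] \<odot>\<^bsub>N\<^esub> h x"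
      by (rule T[OF pCons.prems])
    also have "[:c:] \<odot>\<^bsub>N\<^esub> h x \<oplus>\<^bsub>N\<^esub> p \<odot>\<^bsub>N\<^esub> ([:0, 1:] \<odot>\<^bsub>N\<^esub> h x) = pCons c p \<odot>\<^bsub>N\<^esub> h x"
      by (rule N.pCons_act[OF closed[OF pCons.prems], symmetric])
    finally show ?case .
  qed
qed

lemma hom_iff_T_equivariant:
  assumes N: "diff_module \<delta> N"
  shows "h \<in> left_module_hom (twisted_ring \<delta>) M N \<longleftrightarrow>
    h \<in> left_module_hom class_ring (base_space M) (base_space N) \<and>
    (\<forall>x\<in>carrier M. h (T x) = [:0, 1:] \<odot>\<^bsub>N\<^esub> h x)"
proof (intro iffI conjI ballI)
  assume h: "h \<in> left_module_hom (twisted_ring \<delta>) M N"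
  show "h \<in> left_module_hom class_ring (base_space M) (base_space N)"
    using left_module_hom_closed[OF h] left_module_hom_add[OF h] left_module_hom_smult[OF h]
    by (intro left_module_homI) auto
  show "h (T x) = [:0, 1:] \<odot>\<^bsub>N\<^esub> h x" if "x \<in> carrier M" for x
    using left_module_hom_smult[OF h that] by simp
next
  assume "h \<in> left_module_hom class_ring (base_space M) (base_space N) \<and>
    (\<forall>x\<in>carrier M. h (T x) = [:0, 1:] \<odot>\<^bsub>N\<^esub> h x)"
  hence base: "h \<in> left_module_hom class_ring (base_space M) (base_space N)"
    and T: "\<And>x. x \<in> carrier M \<Longrightarrow> h (T x) = [:0, 1:] \<odot>\<^bsub>N\<^esub> h x" by blast+
  show "h \<in> left_module_hom (twisted_ring \<delta>) M N"
  proof (rule left_module_homI)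
    fix x assume x: "x \<in> carrier M"
    show "h x \<in> carrier N" using left_module_hom_closed[OF base] x by simp
    show "h (p \<cdot> x) = p \<odot>\<^bsub>N\<^esub> h x" for p by (rule T_equivariant_imp_equivariant[OF N base T x])
    show "h (x \<oplus> y) = h x \<oplus>\<^bsub>N\<^esub> h y" if "y \<in> carrier M" for y
      using left_module_hom_add[OF base, of x y] x that by simp
  qed
qed

lemma diff_module_submodule: "submod N \<Longrightarrow> diff_module \<delta> (M\<lparr>carrier := N\<rparr>)"
  by (intro diff_module.intro derivation_axioms left_module_submodule)

lemma diff_module_quotient: "submod N \<Longrightarrow> diff_module \<delta> (quotient_module M N)"
  by (intro diff_module.intro derivation_axioms left_module_quotient)

end

locale fd_diff_module = diff_module +
  assumes fin_dim: "base.fin_dim"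
begin

interpretation base: finite_length_module class_ring "base_space M"
  by (rule base.finite_length_if_fin_dim[OF fin_dim])

sublocale finite_length_module "twisted_ring \<delta>" M
proof unfold_locales
  obtain rank :: "'b set \<Rightarrow> nat"
    where "\<And>U U'. base.left.submod U \<Longrightarrow> base.left.submod U' \<Longrightarrow> U \<subset> U' \<Longrightarrow> rank U < rank U'"
    using base.finite_length by blast
  thus "\<exists>rank :: 'b set \<Rightarrow> nat. \<forall>U U'. submod U \<longrightarrow> submod U' \<longrightarrow> U \<subset> U' \<longrightarrow> rank U < rank U'"
    by (intro exI[of _ rank]) (simp add: submodule_iff_T_stable)
qed

lemma fd_diff_module_submodule:
  assumes N: "submod N"
  shows "fd_diff_module \<delta> (M\<lparr>carrier := N\<rparr>)"
  using base.fin_dim_submodule[OF fin_dim, of N] N submodule_iff_T_stable diff_module_submodule[OF N]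
  by (intro fd_diff_module.intro fd_diff_module_axioms.intro) auto

lemma fd_diff_module_quotient:
  assumes N: "submod N"
  shows "fd_diff_module \<delta> (quotient_module M N)"
proof -
  let ?Q = "quotient_module M N"
  interpret Q: diff_module \<delta> ?Q by (rule diff_module_quotient[OF N])
  have "(\<lambda>x. N +>\<^bsub>M\<^esub> x) \<in> left_module_hom class_ring (base_space M) (base_space ?Q)"
    using quotient_projection_hom[OF N] hom_iff_T_equivariant[OF Q.diff_module_axioms] by blast
  hence "(\<lambda>x. N +>\<^bsub>M\<^esub> x) \<in> module_hom class_ring (base_space M) (base_space ?Q)"
    by (auto simp: left_module_hom_def hom_def module_hom_def)
  then interpret linear_map class_ring "base_space M" "base_space ?Q" "\<lambda>x. N +>\<^bsub>M\<^esub> x"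
    by (intro linear_map.intro mod_hom.intro mod_hom_axioms.intro base.vectorspace_axioms
        Q.base.vectorspace_axioms base.module_axioms Q.base.module_axioms)
  have "Q.base.fin_dim" by (rule surj_fin_dim[OF fin_dim]) (simp add: quotient_carrier[OF N])
  thus ?thesis by (intro fd_diff_module.intro Q.diff_module_axioms fd_diff_module_axioms.intro)
qed

lemma annihilator_nonzero:
  assumes e: "e \<in> carrier M"
  obtains P where "P \<noteq> 0" "P \<cdot> e = \<zero>"
proof -
  define W where "W j = {q \<cdot> e | q. \<forall>i\<ge>j. coeff q i = 0}" for j :: nat
  have W: "base.left.submod (W j)" for j
  proof (rule base.left.submoduleI)
    show "\<zero>\<^bsub>base_space M\<^esub> \<in> W j" unfolding W_def using e by (auto intro!: exI[of _ 0])
    fix x assume "x \<in> W j"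
    then obtain q where q: "\<forall>i\<ge>j. coeff q i = 0" "x = q \<cdot> e" by (auto simp: W_def)
    have "[:c:] \<cdot> x = Polynomial.smult c q \<cdot> e" for c using q(2) e by (simp add: smult_act)
    thus "c \<odot>\<^bsub>base_space M\<^esub> x \<in> W j" for c using q(1) by (fastforce simp: W_def)
    fix y assume "y \<in> W j"
    then obtain q' where q': "\<forall>i\<ge>j. coeff q' i = 0" "y = q' \<cdot> e" by (auto simp: W_def)
    have "x \<oplus> y = (q + q') \<cdot> e" using q(2) q'(2) e by (simp add: act_add_left)
    thus "x \<oplus>\<^bsub>base_space M\<^esub> y \<in> W j" using q(1) q'(1) by (fastforce simp: W_def)
  qed (use e in \<open>auto simp: W_def\<close>)
  obtain V where V: "V \<in> range W" and max: "\<And>V'. V' \<in> range W \<Longrightarrow> V \<subseteq> V' \<Longrightarrow> V' = V"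
    by (rule base.maximal_submodule[of "\<lambda>V. V \<in> range W" "W 0"]) (use W in auto)
  then obtain j where j: "V = W j" by blast
  have "W j \<subseteq> W (Suc j)" unfolding W_def using Suc_leD by blast
  moreover have "monom 1 j \<cdot> e \<in> W (Suc j)" unfolding W_def by auto
  ultimately have "monom 1 j \<cdot> e \<in> W j" using max[of "W (Suc j)"] j by blast
  then obtain q where q: "\<forall>i\<ge>j. coeff q i = 0" "monom 1 j \<cdot> e = q \<cdot> e" by (auto simp: W_def)
  have "coeff (monom 1 j - q) j = 1" using q(1) by simp
  hence "monom 1 j - q \<noteq> 0" by (metis coeff_0 zero_neq_one)
  moreover have "(monom 1 j - q) \<cdot> e = \<zero>" using q(2) e by (simp add: act_diff_left)
  ultimately show ?thesis using that by blast
qed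

lemma conductor_principal:
  assumes U: "submod U" and e: "e \<in> carrier M"
  obtains P where "P \<noteq> 0" "P \<cdot> e \<in> U" "\<And>q. q \<cdot> e \<in> U \<Longrightarrow> \<exists>u. q = u \<odot>t P"
proof -
  obtain P0 where "P0 \<noteq> 0 \<and> P0 \<cdot> e \<in> U" using annihilator_nonzero[OF e] submodule_zero[OF U] by metis
  then obtain P where P: "P \<noteq> 0" "P \<cdot> e \<in> U"
    and min: "\<And>q. q \<noteq> 0 \<and> q \<cdot> e \<in> U \<Longrightarrow> degree P \<le> degree q"
    using ex_has_least_nat[of "\<lambda>q. q \<noteq> 0 \<and> q \<cdot> e \<in> U" P0 degree] by metis
  have "\<exists>u. q = u \<odot>t P" if q: "q \<cdot> e \<in> U" for q
  proof -
    obtain u r where ur: "q = u \<odot>t P + r" "r = 0 \<or> degree r < degree P"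
      using twisted_division[OF P(1)] by blast
    have "r = q - u \<odot>t P" using ur(1) by simp
    hence "r \<cdot> e = q \<cdot> e \<ominus> u \<cdot> P \<cdot> e" by (simp add: act_diff_left[OF e] act_mult[OF e])
    hence "r \<cdot> e \<in> U" using submodule_diff[OF U q submodule_smult[OF U _ P(2)]] by simp
    hence "r = 0" using min[of r] ur(2) by linarith
    thus ?thesis using ur(1) by auto
  qed
  thus ?thesis using that P by blast
qed

end


section \<open>Solutions in formal power series\<close>

lemma fps_module_simps [simp]:
  "carrier (fps_module \<delta>) = UNIV" "add (fps_module \<delta>) = (+)" "\<zero>\<^bsub>fps_module \<delta>\<^esub> = 0"
  "smult (fps_module \<delta>) = twisted_act (\<lambda>c F. taylor \<delta> c * F) fps_deriv"
  by (simp_all add: fps_module_def)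

abbreviation solutions ::
  "('k::field_char_0 \<Rightarrow> 'k) \<Rightarrow> ('k poly, 'b, 'm) module_scheme \<Rightarrow> ('b \<Rightarrow> 'k fps) set" where
  "solutions \<delta> M \<equiv> left_module_hom (twisted_ring \<delta>) M (fps_module \<delta>)"

context derivation
begin

sublocale fps: diff_module \<delta> "fps_module \<delta>"
  by (intro diff_module.intro derivation_axioms left_module_fps)

lemma fps_act_const: "fps_act [:c:] F = taylor \<delta> c * F"
  by (simp add: twisted_act_def)

lemma fps_act_T: "fps_act [:0, 1:] F = fps_deriv F"
  by (simp add: twisted_act_def taylor_one)

lemma fps_module_minus [simp]: "F \<ominus>\<^bsub>fps_module \<delta>\<^esub> G = F - G"
proof -
  have "\<ominus>\<^bsub>fps_module \<delta>\<^esub> G = - G" by (rule fps.M.minus_equality) simp_all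
  thus ?thesis by (simp add: a_minus_def)
qed

end

context diff_module
begin

lemma solution_iff:
  "h \<in> solutions \<delta> M \<longleftrightarrow> (\<forall>x\<in>carrier M. \<forall>y\<in>carrier M. h (x \<oplus> y) = h x + h y) \<and>
    (\<forall>c. \<forall>x\<in>carrier M. h ([:c:] \<cdot> x) = taylor \<delta> c * h x) \<and> (\<forall>x\<in>carrier M. h (T x) = fps_deriv (h x))"
  unfolding hom_iff_T_equivariant[OF fps.diff_module_axioms]
  by (auto simp: left_module_hom_def hom_def fps_act_const fps_act_T)

lemma
  assumes "h \<in> solutions \<delta> M" "x \<in> carrier M"
  shows solution_add: "y \<in> carrier M \<Longrightarrow> h (x \<oplus> y) = h x + h y"
    and solution_const: "h ([:c:] \<cdot> x) = taylor \<delta> c * h x"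
    and solution_T: "h (T x) = fps_deriv (h x)"
  using assms unfolding solution_iff by auto

lemma solution_zero: "h \<in> solutions \<delta> M \<Longrightarrow> h \<zero> = 0"
  using hom_zero[OF fps.left_module_axioms] by simp

lemma solution_coeff:
  assumes h: "h \<in> solutions \<delta> M" and x: "x \<in> carrier M"
  shows "fps_nth (h x) i = fps_nth (h ((T ^^ i) x)) 0 / fact i"
  using x
proof (induction i arbitrary: x)
  case (Suc i)
  have "of_nat (Suc i) * fps_nth (h x) (Suc i) = fps_nth (h (T x)) i"
    using solution_T[OF h Suc.prems] by simp
  also have "\<dots> = fps_nth (h ((T ^^ Suc i) x)) 0 / fact i"
    using Suc by (simp add: funpow_swap1)
  finally show ?case by (simp add: fact_Suc field_simps del: of_nat_Suc)
qed simp

lemma constant_term_functional: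
  "h \<in> solutions \<delta> M \<Longrightarrow>
    (\<lambda>x. fps_nth (h x) 0) \<in> left_module_hom class_ring (base_space M) (regular_module class_ring)"
  by (intro left_module_homI) (auto simp: solution_add solution_const taylor_def)

definition taylor_solution :: "('b \<Rightarrow> 'k) \<Rightarrow> 'b \<Rightarrow> 'k fps" where
  "taylor_solution \<phi> x = Abs_fps (\<lambda>i. \<phi> ((T ^^ i) x) / fact i)"

lemma taylor_solution_nth: "fps_nth (taylor_solution \<phi> x) i = \<phi> ((T ^^ i) x) / fact i"
  by (simp add: taylor_solution_def)

lemma taylor_solution_T: "taylor_solution \<phi> (T x) = fps_deriv (taylor_solution \<phi> x)"
proof (rule fps_ext)
  fix n
  have "of_nat (Suc n) * (z / fact (Suc n)) = z / fact n" for z :: 'k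
    by (simp add: fact_Suc del: of_nat_Suc)
  thus "fps_nth (taylor_solution \<phi> (T x)) n = fps_nth (fps_deriv (taylor_solution \<phi> x)) n"
    by (simp add: taylor_solution_nth funpow_swap1 del: of_nat_Suc)
qed

context
  fixes \<phi> :: "'b \<Rightarrow> 'k"
  assumes \<phi>: "\<phi> \<in> left_module_hom class_ring (base_space M) (regular_module class_ring)"
begin

lemma taylor_solution_add:
  assumes "x \<in> carrier M" "y \<in> carrier M"
  shows "taylor_solution \<phi> (x \<oplus> y) = taylor_solution \<phi> x + taylor_solution \<phi> y"
  using left_module_hom_add[OF \<phi>] assms
  by (intro fps_ext) (simp add: taylor_solution_nth Tpow_add Tpow_closed add_divide_distrib)

lemma taylor_solution_const:
  assumes "x \<in> carrier M"
  shows "taylor_solution \<phi> ([:c:] \<cdot> x) = taylor \<delta> c * taylor_solution \<phi> x"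
proof (rule fps_ext)
  fix n
  show "fps_nth (taylor_solution \<phi> ([:c:] \<cdot> x)) n = fps_nth (taylor \<delta> c * taylor_solution \<phi> x) n"
    using assms
  proof (induction n arbitrary: c x)
    case 0
    thus ?case using left_module_hom_smult[OF \<phi>, of x c] by (simp add: taylor_solution_nth taylor_def)
  next
    case (Suc n)
    note x = Suc.prems act_closed[OF Suc.prems]
    have "of_nat (Suc n) * fps_nth (taylor_solution \<phi> ([:c:] \<cdot> x)) (Suc n)
        = fps_nth (taylor_solution \<phi> (T ([:c:] \<cdot> x))) n"
      by (simp add: taylor_solution_T)
    also have "\<dots> = fps_nth (taylor_solution \<phi> ([:c:] \<cdot> T x)) n
        + fps_nth (taylor_solution \<phi> ([:\<delta> c:] \<cdot> x)) n"
      using x by (simp add: T_const taylor_solution_add)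
    also have "\<dots> = fps_nth (taylor \<delta> c * taylor_solution \<phi> (T x) + taylor \<delta> (\<delta> c) * taylor_solution \<phi> x) n"
      by (simp add: Suc.IH[OF x(1)] Suc.IH[OF x(2)])
    also have "\<dots> = fps_nth (fps_deriv (taylor \<delta> c * taylor_solution \<phi> x)) n"
      by (simp add: taylor_solution_T fps_deriv_taylor)
    also have "\<dots> = of_nat (Suc n) * fps_nth (taylor \<delta> c * taylor_solution \<phi> x) (Suc n)"
      by (simp only: fps_deriv_nth Suc_eq_plus1)
    finally show ?case by (simp del: of_nat_Suc)
  qed
qed

lemma taylor_solution_in_solutions: "taylor_solution \<phi> \<in> solutions \<delta> M"
  unfolding solution_iff using taylor_solution_add taylor_solution_const taylor_solution_T by blast

end

end

context fd_diff_module
begin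

text \<open>Solutions correspond to linear functionals through their constant terms, and functionals extend.\<close>

lemma solution_extends:
  assumes N: "submod N" and h: "h \<in> solutions \<delta> (M\<lparr>carrier := N\<rparr>)"
  obtains g where "g \<in> solutions \<delta> M" "\<And>x. x \<in> N \<Longrightarrow> g x = h x"
proof -
  interpret N: diff_module \<delta> "M\<lparr>carrier := N\<rparr>" by (rule diff_module_submodule[OF N])
  have "(\<lambda>x. fps_nth (h x) 0) \<in>
      left_module_hom class_ring (base_space M\<lparr>carrier := N\<rparr>) (regular_module class_ring)"
    using N.constant_term_functional[OF h] by simp
  then obtain \<phi> where \<phi>: "\<phi> \<in> left_module_hom class_ring (base_space M) (regular_module class_ring)"
    "\<And>x. x \<in> N \<Longrightarrow> \<phi> x = fps_nth (h x) 0"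
    using base.functional_extends[OF fin_dim] N submodule_iff_T_stable by metis
  have "taylor_solution \<phi> x = h x" if x: "x \<in> N" for x
  proof (rule fps_ext)
    fix i
    have "(T ^^ i) x \<in> N" using N.Tpow_closed[of x i] x by simp
    thus "fps_nth (taylor_solution \<phi> x) i = fps_nth (h x) i"
      using N.solution_coeff[OF h, of x i] x by (simp add: taylor_solution_nth \<phi>(2))
  qed
  thus ?thesis using that taylor_solution_in_solutions[OF \<phi>(1)] by blast
qed

lemma nonzero_solution_exists:
  assumes "carrier M \<noteq> {\<zero>}"
  obtains h x where "h \<in> solutions \<delta> M" "x \<in> carrier M" "h x \<noteq> 0"
proof -
  obtain x where x: "x \<in> carrier M" "x \<noteq> \<zero>" using assms M.zero_closed by blast
  obtain \<phi> where \<phi>: "\<phi> \<in> left_module_hom class_ring (base_space M) (regular_module class_ring)" "\<phi> x = 1"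
    using base.separating_functional[OF fin_dim base.left.submodule_trivial, of x] x by auto
  have "fps_nth (taylor_solution \<phi> x) 0 = 1" using \<phi>(2) by (simp add: taylor_solution_nth)
  hence "taylor_solution \<phi> x \<noteq> 0" by auto
  thus ?thesis using that taylor_solution_in_solutions[OF \<phi>(1)] x(1) by blast
qed

end


section \<open>Modules of convergent and overconvergent series\<close>

context residue_char_0_diff_field
begin

lemma fps_bounded_antimono: "0 < s \<Longrightarrow> s \<le> s' \<Longrightarrow> F \<in> fps_bounded v s' \<Longrightarrow> F \<in> fps_bounded v s"
  unfolding fps_bounded_iff using gauss_bound_antimono by blast

lemma submodule_fps_bounded:
  assumes s: "0 < s" "s * \<sigma> < 1"
  shows "fps.submod (fps_bounded v s)"
  unfolding fps.submodule_iff_T_stable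
proof (intro conjI ballI)
  show "fps.base.left.submod (fps_bounded v s)"
  proof (rule fps.base.left.submoduleI)
    show "\<zero>\<^bsub>base_space (fps_module \<delta>)\<^esub> \<in> fps_bounded v s"
      using gauss_bound_0 by (auto simp: fps_bounded_iff)
    fix F assume "F \<in> fps_bounded v s"
    then obtain C where F: "gauss_bound v s C F" by (auto simp: fps_bounded_iff)
    from gauss_bound_taylor_mult[OF s this]
    show "c \<odot>\<^bsub>base_space (fps_module \<delta>)\<^esub> F \<in> fps_bounded v s" for c
      by (auto simp: fps_bounded_iff fps_act_const)
    fix G assume "G \<in> fps_bounded v s"
    then obtain D where "gauss_bound v s D G" by (auto simp: fps_bounded_iff)
    from gauss_bound_add[OF s(1) F this]
    show "F \<oplus>\<^bsub>base_space (fps_module \<delta>)\<^esub> G \<in> fps_bounded v s" by (auto simp: fps_bounded_iff)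
  qed simp
  fix F assume "F \<in> fps_bounded v s"
  then obtain C where "gauss_bound v s C F" by (auto simp: fps_bounded_iff)
  from gauss_bound_deriv[OF s(1) this]
  show "[:0, 1:] \<odot>\<^bsub>fps_module \<delta>\<^esub> F \<in> fps_bounded v s" by (auto simp: fps_bounded_iff fps_act_T)
qed

lemma fps_overconvE:
  assumes "0 < t" "t * \<sigma> < 1" "F \<in> fps_overconv v t"
  obtains s where "t < s" "s * \<sigma> < 1" "F \<in> fps_bounded v s"
proof -
  obtain s' where s': "t < s'" "F \<in> fps_bounded v s'" using assms(3) by (auto simp: fps_overconv_def)
  obtain s where s: "t < s" "s < s'" "s * \<sigma> < 1" by (rule radius_margin[OF assms(2) s'(1)])
  have "F \<in> fps_bounded v s" using fps_bounded_antimono[OF _ _ s'(2), of s] s assms(1) by simp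
  thus ?thesis using that s by blast
qed

lemma submodule_fps_overconv:
  assumes t: "0 < t" "t * \<sigma> < 1"
  shows "fps.submod (fps_overconv v t)"
proof (rule fps.submoduleI)
  have "(0 :: 'k fps) \<in> fps_bounded v (t + 1)" using gauss_bound_0 by (auto simp: fps_bounded_iff)
  thus "\<zero>\<^bsub>fps_module \<delta>\<^esub> \<in> fps_overconv v t" by (auto simp: fps_overconv_def intro!: bexI[of _ "t + 1"])
  fix F assume "F \<in> fps_overconv v t"
  then obtain s where s: "t < s" "s * \<sigma> < 1" "F \<in> fps_bounded v s" using fps_overconvE[OF t] by blast
  hence "fps.submod (fps_bounded v s)" using t(1) by (intro submodule_fps_bounded) auto
  thus "p \<odot>\<^bsub>fps_module \<delta>\<^esub> F \<in> fps_overconv v t" for p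
    using fps.submodule_smult[of "fps_bounded v s" p F] s by (auto simp: fps_overconv_def)
  fix G assume "G \<in> fps_overconv v t"
  then obtain s' where s': "t < s'" "s' * \<sigma> < 1" "G \<in> fps_bounded v s'" using fps_overconvE[OF t] by blast
  let ?m = "min s s'"
  have m: "t < ?m" "?m * \<sigma> < 1" using s s' by (auto simp: min_def)
  hence "fps.submod (fps_bounded v ?m)" using t(1) by (intro submodule_fps_bounded) auto
  moreover have "F \<in> fps_bounded v ?m" "G \<in> fps_bounded v ?m"
    using fps_bounded_antimono[of ?m s F] fps_bounded_antimono[of ?m s' G] s s' m(1) t(1) by auto
  ultimately have "F + G \<in> fps_bounded v ?m" using fps.submodule_add[of "fps_bounded v ?m" F G] by simp
  thus "F \<oplus>\<^bsub>fps_module \<delta>\<^esub> G \<in> fps_overconv v t" using m(1) by (auto simp: fps_overconv_def)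
qed simp

lemma radius_mult_less_1:
  assumes "s < r" "r * \<sigma> \<le> 1"
  shows "s * \<sigma> < 1"
proof (cases "\<sigma> = 0")
  case False
  hence "s * \<sigma> < r * \<sigma>"
    using assms(1) derivation.spectral_norm_nonneg by (intro mult_strict_right_mono) auto
  thus ?thesis using assms(2) by simp
qed simp

lemma submodule_fps_conv:
  assumes "r * \<sigma> \<le> 1"
  shows "fps.submod (fps_conv v r)"
proof -
  have bounded: "fps.submod (fps_bounded v s)" if "s \<in> {0<..<r}" for s
    using that radius_mult_less_1[OF _ assms] by (intro submodule_fps_bounded) auto
  show ?thesis
  proof (rule fps.submoduleI)
    show "\<zero>\<^bsub>fps_module \<delta>\<^esub> \<in> fps_conv v r"
      unfolding fps_conv_def using fps.submodule_zero[OF bounded] by blast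
    fix F assume F: "F \<in> fps_conv v r"
    show "p \<odot>\<^bsub>fps_module \<delta>\<^esub> F \<in> fps_conv v r" for p
      unfolding fps_conv_def
    proof
      fix s assume s: "s \<in> {0<..<r}"
      show "p \<odot>\<^bsub>fps_module \<delta>\<^esub> F \<in> fps_bounded v s"
        by (rule fps.submodule_smult[OF bounded[OF s]]) (use F s in \<open>auto simp: fps_conv_def\<close>)
    qed
    fix G assume G: "G \<in> fps_conv v r"
    show "F \<oplus>\<^bsub>fps_module \<delta>\<^esub> G \<in> fps_conv v r"
      unfolding fps_conv_def
    proof
      fix s assume s: "s \<in> {0<..<r}"
      show "F \<oplus>\<^bsub>fps_module \<delta>\<^esub> G \<in> fps_bounded v s"
        by (rule fps.submodule_add[OF bounded[OF s]]) (use F G s in \<open>auto simp: fps_conv_def\<close>)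
    qed
  qed simp
qed

lemma fps_conv_iff_overconv: "F \<in> fps_conv v r \<longleftrightarrow> (\<forall>t\<in>{0<..<r}. F \<in> fps_overconv v t)"
proof (intro iffI ballI)
  fix t assume F: "F \<in> fps_conv v r" and t: "t \<in> {0<..<r}"
  obtain s where "t < s" "s < r" using t dense by auto
  thus "F \<in> fps_overconv v t" using t F by (auto simp: fps_conv_def fps_overconv_def)
next
  assume F: "\<forall>t\<in>{0<..<r}. F \<in> fps_overconv v t"
  have "F \<in> fps_bounded v t" if t: "t \<in> {0<..<r}" for t
  proof -
    obtain s where "t < s" "F \<in> fps_bounded v s" using bspec[OF F t] by (auto simp: fps_overconv_def)
    thus ?thesis using fps_bounded_antimono[of t s F] t by auto
  qed
  thus "F \<in> fps_conv v r" by (simp add: fps_conv_def)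
qed

lemma gauss_norm_add:
  assumes "0 < s" "F \<in> fps_bounded v s" "G \<in> fps_bounded v s"
  shows "gauss_norm v s (F + G) \<le> max (gauss_norm v s F) (gauss_norm v s G)"
  using assms gauss_bound_gauss_norm unfolding fps_bounded_iff by (metis gauss_norm_le gauss_bound_add)

lemma gauss_norm_eq_0:
  assumes "0 < s" "F \<in> fps_bounded v s" "gauss_norm v s F = 0"
  shows "F = 0"
  using assms gauss_bound_gauss_norm gauss_bound_0_iff unfolding fps_bounded_iff by metis

lemma gauss_norm_deriv:
  assumes "0 < s" "F \<in> fps_bounded v s"
  shows "gauss_norm v s (fps_deriv F) \<le> 1 / s * gauss_norm v s F"
  using assms gauss_norm_le[OF gauss_bound_deriv[OF assms(1) gauss_bound_gauss_norm]]
  by (auto simp: fps_bounded_iff)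

lemma gauss_norm_taylor_mult_le:
  assumes "0 < s" "s * \<sigma> < 1" "F \<in> fps_bounded v s"
  shows "gauss_norm v s (taylor \<delta> c * F) \<le> v c * gauss_norm v s F"
  using assms(3) gauss_norm_le[OF gauss_bound_taylor_mult[OF assms(1,2) gauss_bound_gauss_norm]]
  by (auto simp: fps_bounded_iff)

lemma gauss_norm_taylor_mult:
  assumes s: "0 < s" "s * \<sigma> < 1" and F: "F \<in> fps_bounded v s"
  shows "gauss_norm v s (taylor \<delta> c * F) = v c * gauss_norm v s F"
proof (cases "c = 0")
  case True
  thus ?thesis using gauss_norm_taylor_mult_le[OF assms, of 0] gauss_norm_nonneg[of s 0] by simp
next
  case False
  have cF: "taylor \<delta> c * F \<in> fps_bounded v s"
    using fps.submodule_smult[OF submodule_fps_bounded[OF s] _ F, of "[:c:]"] by (simp add: fps_act_const)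
  have "taylor \<delta> (1 / c) * (taylor \<delta> c * F) = (taylor \<delta> c * taylor \<delta> (1 / c)) * F"
    by (simp only: mult_ac)
  also have "\<dots> = F" by (simp add: taylor_inverse[OF False])
  finally have "gauss_norm v s F \<le> v (1 / c) * gauss_norm v s (taylor \<delta> c * F)"
    using gauss_norm_taylor_mult_le[OF s cF, of "1 / c"] by (simp only:)
  hence "v c * gauss_norm v s F \<le> gauss_norm v s (taylor \<delta> c * F)"
    using v_pos[OF False] by (simp add: v_divide field_simps)
  thus ?thesis using gauss_norm_taylor_mult_le[OF assms, of c] by simp
qed

end

locale residue_char_0_diff_module = residue_char_0_diff_field v \<delta> + fd_diff_module \<delta> M
  for v :: "'k::field_char_0 \<Rightarrow> real" and \<delta> :: "'k \<Rightarrow> 'k"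
    and M :: "('k poly, 'b, 'm) module_scheme" (structure)
begin

lemma overconv_solution_extends:
  assumes N: "submod N" and t: "0 < t" "t * \<sigma> < 1"
    and h: "h \<in> solutions \<delta> (M\<lparr>carrier := N\<rparr>)" "\<And>x. x \<in> N \<Longrightarrow> h x \<in> fps_overconv v t"
  obtains g where "g \<in> solutions \<delta> M" "\<And>x. x \<in> carrier M \<Longrightarrow> g x \<in> fps_overconv v t"
    "\<And>x. x \<in> N \<Longrightarrow> g x = h x"
proof -
  let ?O = "fps_module \<delta>\<lparr>carrier := fps_overconv v t\<rparr>"
  have hom_iff: "g \<in> left_module_hom (twisted_ring \<delta>) L ?O \<longleftrightarrow>
      g \<in> solutions \<delta> L \<and> (\<forall>x\<in>carrier L. g x \<in> fps_overconv v t)"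
    for g and L :: "('k poly, 'b, 'm) module_scheme"
    by (rule left_module_hom_codomain_iff) simp
  have hO: "h \<in> left_module_hom (twisted_ring \<delta>) (M\<lparr>carrier := N\<rparr>) ?O" using h by (simp add: hom_iff)
  obtain g where "g \<in> left_module_hom (twisted_ring \<delta>) M ?O" "\<And>x. x \<in> N \<Longrightarrow> g x = h x"
  proof (rule hom_extends[OF fps.left_module_submodule[OF submodule_fps_overconv[OF t]] _ N hO])
    fix W g e
    assume W: "submod W" and e: "e \<in> carrier M"
      and "g \<in> left_module_hom (twisted_ring \<delta>) (M\<lparr>carrier := W\<rparr>) ?O"
    hence g: "g \<in> solutions \<delta> (M\<lparr>carrier := W\<rparr>)" "\<And>x. x \<in> W \<Longrightarrow> g x \<in> fps_overconv v t"
      by (simp_all add: hom_iff)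
    obtain P where P: "P \<noteq> 0" "P \<cdot> e \<in> W" "\<And>q. q \<cdot> e \<in> W \<Longrightarrow> \<exists>u. q = u \<odot>t P"
      using conductor_principal[OF W e] by blast
    obtain F where F: "F \<in> fps_overconv v t" "fps_act P F = g (P \<cdot> e)"
      by (rule twisted_poly_surj_overconv[OF P(1) t g(2)[OF P(2)]])
    have "g (q \<cdot> e) = fps_act q F" if q: "q \<cdot> e \<in> W" for q
    proof -
      obtain u where u: "q = u \<odot>t P" using P(3)[OF q] by blast
      have "g (q \<cdot> e) = g (u \<cdot> P \<cdot> e)" unfolding u by (simp only: act_mult[OF e])
      also have "\<dots> = fps_act u (g (P \<cdot> e))" using left_module_hom_smult[OF g(1), of "P \<cdot> e" u] P(2) by simp
      also have "\<dots> = fps_act q F" using fps.act_mult[of F u P] by (simp add: F(2) u)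
      finally show ?thesis .
    qed
    thus "\<exists>y\<in>carrier ?O. \<forall>q\<in>carrier (twisted_ring \<delta>). q \<cdot> e \<in> W \<longrightarrow> g (q \<cdot> e) = q \<odot>\<^bsub>?O\<^esub> y"
      using F(1) by auto
  qed blast
  thus ?thesis using that[of g] by (simp add: hom_iff)
qed

end


section \<open>The spectral norm of a differential module\<close>

locale nonarch_diff_module = complete_nonarch_diff_field v \<delta> + fd_diff_module \<delta> M
  for v :: "'k::field_char_0 \<Rightarrow> real" and \<delta> :: "'k \<Rightarrow> 'k"
    and M :: "('k poly, 'b, 'm) module_scheme" (structure)
begin

lemma module_norm_iff: "module_norm v M \<nu> \<longleftrightarrow> nonarch_normed_space v (base_space M) \<nu>"
proof
  assume \<nu>: "module_norm v M \<nu>"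
  show "nonarch_normed_space v (base_space M) \<nu>"
    by unfold_locales (use \<nu> in \<open>auto simp: module_norm_def nonarch_seminorm_def\<close>)
next
  assume "nonarch_normed_space v (base_space M) \<nu>"
  then interpret nonarch_normed_space v "base_space M" \<nu> .
  show "module_norm v M \<nu>"
    using seminorm definite norm_zero by (auto simp: module_norm_def nonarch_seminorm_def)
qed

lemma nonarch_normed_space_some_norm:
  "nonarch_normed_space v (base_space M) (SOME \<nu>. module_norm v M \<nu>)"
proof -
  interpret nonarch_vector_space v "base_space M" by unfold_locales
  obtain \<nu> where "nonarch_seminorm v (base_space M) \<nu>" "\<And>x. x \<in> carrier M \<Longrightarrow> \<nu> x = 0 \<Longrightarrow> x = \<zero>"
    using norm_exists[OF fin_dim] by auto
  hence "module_norm v M \<nu>" unfolding module_norm_iff by unfold_locales auto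
  thus ?thesis unfolding module_norm_iff[symmetric] by (rule someI[of "module_norm v M" \<nu>])
qed

lemma bounded_operator_T:
  assumes \<nu>: "nonarch_normed_space v (base_space M) \<nu>" and ne: "carrier M \<noteq> {\<zero>}"
  shows "bounded_operator (carrier M) \<nu> T"
proof
  interpret normed: nonarch_normed_space v "base_space M" \<nu> by (rule \<nu>)
  show "\<exists>x\<in>carrier M. \<nu> x \<noteq> 0" using ne normed.definite M.zero_closed by auto
  show "0 \<le> \<nu> x" if "x \<in> carrier M" for x using normed.norm_nonneg that by simp
  obtain B where B: "\<And>x. v (\<delta> x) \<le> B * v x" using d_bounded by blast
  obtain C where "\<And>x. x \<in> carrier M \<Longrightarrow> \<nu> (T x) \<le> C * \<nu> x"
  proof (rule normed.norm_dominates[OF fin_dim, of "\<lambda>x. \<nu> (T x)"])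
    show "\<nu> (T (x \<oplus>\<^bsub>base_space M\<^esub> y)) \<le> max (\<nu> (T x)) (\<nu> (T y))"
      if "x \<in> carrier (base_space M)" "y \<in> carrier (base_space M)" for x y
      using that normed.norm_add[of "T x" "T y"] by (simp add: act_add_right)
    fix x assume "x \<in> carrier (base_space M)"
    hence x: "x \<in> carrier M" by simp
    have "\<nu> (T ([:c:] \<cdot> x)) \<le> v c * max (\<nu> (T x)) (B * \<nu> x)" for c
    proof -
      have "\<nu> (T ([:c:] \<cdot> x)) \<le> max (v c * \<nu> (T x)) (v (\<delta> c) * \<nu> x)"
        using normed.norm_add[of "[:c:] \<cdot> T x" "[:\<delta> c:] \<cdot> x"] normed.norm_smult[of x "\<delta> c"]
          normed.norm_smult[of "T x" c] x by (simp add: T_const)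
      also have "\<dots> \<le> max (v c * \<nu> (T x)) (v c * (B * \<nu> x))"
        using mult_right_mono[OF B[of c] normed.norm_nonneg[of x]] x
        by (intro max.mono) (simp_all add: mult_ac)
      also have "\<dots> = v c * max (\<nu> (T x)) (B * \<nu> x)"
        using v_nonneg[of c] by (simp add: max_mult_distrib_left)
      finally show ?thesis .
    qed
    thus "\<exists>B. \<forall>c. \<nu> (T (c \<odot>\<^bsub>base_space M\<^esub> x)) \<le> v c * B" by auto
  qed (use that in auto)
  thus "\<exists>C. \<forall>x\<in>carrier M. \<nu> (T x) \<le> C * \<nu> x" by blast
qed auto

lemma T_geometric_growth:
  assumes ne: "carrier M \<noteq> {\<zero>}" and \<beta>: "T_spectral_norm v M < \<beta>"
  obtains \<nu> C where "nonarch_normed_space v (base_space M) \<nu>" "C > 0" "\<beta> > 0"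
    "\<And>i x. x \<in> carrier M \<Longrightarrow> \<nu> ((T ^^ i) x) \<le> C * \<beta> ^ i * \<nu> x"
proof -
  define \<nu> where "\<nu> = (SOME \<nu>. module_norm v M \<nu>)"
  have \<nu>: "nonarch_normed_space v (base_space M) \<nu>"
    unfolding \<nu>_def by (rule nonarch_normed_space_some_norm)
  interpret B: bounded_operator "carrier M" \<nu> T by (rule bounded_operator_T[OF \<nu> ne])
  have \<beta>: "spectral_norm (carrier M) \<nu> T < \<beta>"
    using \<beta> by (simp add: T_spectral_norm_def \<nu>_def)
  have "\<beta> > 0" using B.spectral_norm_nonneg \<beta> by linarith
  thus ?thesis
    using that[OF \<nu>] B.geometric_growth_if_spectral_norm_less[OF \<beta>]
    unfolding B.geometric_growth_def by blast
qed

lemma T_spectral_norm_le: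
  assumes \<mu>: "nonarch_normed_space v (base_space M) \<mu>" and ne: "carrier M \<noteq> {\<zero>}" and b: "0 \<le> b"
    and T: "\<And>x. x \<in> carrier M \<Longrightarrow> \<mu> (T x) \<le> b * \<mu> x"
  shows "T_spectral_norm v M \<le> b"
proof -
  define \<nu> where "\<nu> = (SOME \<nu>. module_norm v M \<nu>)"
  have \<nu>: "nonarch_normed_space v (base_space M) \<nu>"
    unfolding \<nu>_def by (rule nonarch_normed_space_some_norm)
  interpret B: bounded_operator "carrier M" \<nu> T by (rule bounded_operator_T[OF \<nu> ne])
  interpret B': bounded_operator "carrier M" \<mu> T by (rule bounded_operator_T[OF \<mu> ne])
  obtain C where C: "C > 0" "\<And>x. x \<in> carrier M \<Longrightarrow> \<nu> x \<le> C * \<mu> x"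
    using nonarch_normed_space.norm_dominates_norm[OF \<mu> fin_dim \<nu>] by auto
  obtain D where D: "D > 0" "\<And>x. x \<in> carrier M \<Longrightarrow> \<mu> x \<le> D * \<nu> x"
    using nonarch_normed_space.norm_dominates_norm[OF \<nu> fin_dim \<mu>] by auto
  have "\<nu> ((T ^^ i) x) \<le> (C * D) * b ^ i * \<nu> x" if x: "x \<in> carrier M" for i x
  proof -
    have "\<nu> ((T ^^ i) x) \<le> C * \<mu> ((T ^^ i) x)" by (rule C(2)[OF Tpow_closed[OF x]])
    also have "\<dots> \<le> C * (b ^ i * \<mu> x)" using B'.pow_le[OF b T x] C(1) by simp
    also have "\<dots> \<le> C * (b ^ i * (D * \<nu> x))" using D(2)[OF x] C(1) b by (simp add: mult_left_mono)
    finally show ?thesis by (simp add: mult_ac)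
  qed
  hence "B.geometric_growth b" unfolding B.geometric_growth_def using C(1) D(1) by (metis mult_pos_pos)
  thus ?thesis
    using B.spectral_norm_le_if_geometric_growth[OF b] by (simp add: T_spectral_norm_def \<nu>_def)
qed

text \<open>The Leibniz rule gives \<open>\<delta> c y = T (c y) - c T y\<close>, so derivatives of \<open>c\<close> are traded for powers of \<open>T\<close>.\<close>

lemma derivation_pow_act_le:
  assumes \<nu>: "nonarch_normed_space v (base_space M) \<nu>" and pos: "C > 0" "\<beta> > 0"
    and growth: "\<And>i x. x \<in> carrier M \<Longrightarrow> \<nu> ((T ^^ i) x) \<le> C * \<beta> ^ i * \<nu> x"
    and x: "x \<in> carrier M"
  shows "\<nu> ((T ^^ a) ([:(\<delta> ^^ i) c:] \<cdot> (T ^^ b) x)) \<le> C * C * \<beta> ^ (a + i + b) * v c * \<nu> x"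
proof -
  interpret nonarch_normed_space v "base_space M" \<nu> by (rule \<nu>)
  show ?thesis
  proof (induction i arbitrary: a b)
    case 0
    have "\<nu> ((T ^^ a) ([:c:] \<cdot> (T ^^ b) x)) \<le> C * \<beta> ^ a * \<nu> ([:c:] \<cdot> (T ^^ b) x)"
      by (rule growth[OF act_closed[OF Tpow_closed[OF x]]])
    also have "\<dots> = C * \<beta> ^ a * (v c * \<nu> ((T ^^ b) x))"
      using norm_smult[of "(T ^^ b) x" c] Tpow_closed[OF x] by simp
    also have "\<dots> \<le> C * \<beta> ^ a * (v c * (C * \<beta> ^ b * \<nu> x))"
      using pos growth[OF x] v_nonneg by (intro mult_left_mono) auto
    finally show ?case by (simp add: power_add mult_ac)
  next
    case (Suc i)
    let ?y = "(T ^^ b) x" and ?d = "(\<delta> ^^ i) c"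
    have y: "?y \<in> carrier M" by (rule Tpow_closed[OF x])
    have "[:\<delta> ?d:] \<cdot> ?y = T ([:?d:] \<cdot> ?y) \<ominus> [:?d:] \<cdot> T ?y"
      using y by (simp add: T_const M.abelian_group_simps)
    hence "(T ^^ a) ([:\<delta> ?d:] \<cdot> ?y) = (T ^^ a) (T ([:?d:] \<cdot> ?y)) \<ominus> (T ^^ a) ([:?d:] \<cdot> T ?y)"
      using Tpow_diff y by simp
    hence "(T ^^ a) ([:(\<delta> ^^ Suc i) c:] \<cdot> ?y)
        = (T ^^ Suc a) ([:?d:] \<cdot> (T ^^ b) x) \<ominus> (T ^^ a) ([:?d:] \<cdot> (T ^^ Suc b) x)"
      by (simp add: funpow_swap1)
    hence "\<nu> ((T ^^ a) ([:(\<delta> ^^ Suc i) c:] \<cdot> ?y)) \<le>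
        max (\<nu> ((T ^^ Suc a) ([:?d:] \<cdot> (T ^^ b) x))) (\<nu> ((T ^^ a) ([:?d:] \<cdot> (T ^^ Suc b) x)))"
      using norm_diff[of "(T ^^ Suc a) ([:?d:] \<cdot> (T ^^ b) x)" "(T ^^ a) ([:?d:] \<cdot> (T ^^ Suc b) x)"]
        Tpow_closed act_closed x by (metis base_space_minus base_space_simps(1))
    also have "\<dots> \<le> C * C * \<beta> ^ (a + Suc i + b) * v c * \<nu> x"
      using Suc[of "Suc a" b] Suc[of a "Suc b"] by (intro max.boundedI) simp_all
    finally show ?case .
  qed
qed

lemma derivation_spectral_norm_le_T:
  assumes ne: "carrier M \<noteq> {\<zero>}"
  shows "\<sigma> \<le> T_spectral_norm v M"
proof (rule dense_ge)
  fix \<beta> assume "T_spectral_norm v M < \<beta>"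
  then obtain \<nu> C where \<nu>: "nonarch_normed_space v (base_space M) \<nu>" and pos: "C > 0" "\<beta> > 0"
    and growth: "\<And>i x. x \<in> carrier M \<Longrightarrow> \<nu> ((T ^^ i) x) \<le> C * \<beta> ^ i * \<nu> x"
    using T_geometric_growth[OF ne] by blast
  interpret nonarch_normed_space v "base_space M" \<nu> by (rule \<nu>)
  obtain x where x: "x \<in> carrier M" "x \<noteq> \<zero>" using ne M.zero_closed by blast
  hence "\<nu> x > 0" using norm_nonneg[of x] definite[of x] by fastforce
  hence "v ((\<delta> ^^ i) c) \<le> C * C * \<beta> ^ i * v c" for i c
    using derivation_pow_act_le[OF \<nu> pos growth x(1), of 0 i c 0] norm_smult[of x "(\<delta> ^^ i) c"] x(1) by simp
  hence "derivation.geometric_growth \<beta>"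
    unfolding derivation.geometric_growth_def using pos(1) by (metis mult_pos_pos)
  thus "\<sigma> \<le> \<beta>" using pos(2) by (intro derivation.spectral_norm_le_if_geometric_growth) auto
qed

end

sublocale residue_char_0_diff_module \<subseteq> nonarch_diff_module v \<delta> M
  by unfold_locales

context residue_char_0_diff_module
begin

lemma solution_overconv:
  assumes ne: "carrier M \<noteq> {\<zero>}" and t: "0 < t" "T_spectral_norm v M * t < 1"
    and h: "h \<in> solutions \<delta> M" and x: "x \<in> carrier M"
  shows "h x \<in> fps_overconv v t"
proof -
  have "T_spectral_norm v M < 1 / t" using t by (simp add: field_simps)
  then obtain \<beta> where \<beta>: "T_spectral_norm v M < \<beta>" "\<beta> < 1 / t" using dense by blast
  obtain \<nu> C where \<nu>: "nonarch_normed_space v (base_space M) \<nu>" and pos: "C > 0" "\<beta> > 0"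
    and growth: "\<And>i x. x \<in> carrier M \<Longrightarrow> \<nu> ((T ^^ i) x) \<le> C * \<beta> ^ i * \<nu> x"
    using T_geometric_growth[OF ne \<beta>(1)] by blast
  obtain D where D: "D > 0" "\<And>x. x \<in> carrier (base_space M) \<Longrightarrow> v (fps_nth (h x) 0) \<le> D * \<nu> x"
    by (rule nonarch_normed_space.norm_dominates[OF \<nu> fin_dim, of "\<lambda>x. v (fps_nth (h x) 0)"])
       (use solution_add[OF h] solution_const[OF h] v_ultrametric in \<open>auto simp: v_mult taylor_def\<close>)
  have "gauss_bound v (1 / \<beta>) (D * C * \<nu> x) (h x)"
    unfolding gauss_bound_def
  proof
    fix i
    have "v (fps_nth (h x) i) \<le> D * \<nu> ((T ^^ i) x)"
      using D(2) Tpow_closed[OF x] solution_coeff[OF h x, of i] by (simp add: v_divide)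
    also have "\<dots> \<le> D * (C * \<beta> ^ i * \<nu> x)" using growth[OF x, of i] D(1) by (intro mult_left_mono) auto
    finally show "v (fps_nth (h x) i) * (1 / \<beta>) ^ i \<le> D * C * \<nu> x" using pos(2) by (simp add: field_simps)
  qed
  moreover have "t < 1 / \<beta>" using pos(2) \<beta>(2) t(1) by (simp add: field_simps)
  ultimately show ?thesis using fps_overconv_iff by blast
qed

lemma overconv_solution_uniformly_bounded:
  assumes t: "0 < t" "t * \<sigma> < 1"
    and g: "g \<in> solutions \<delta> M" "\<And>x. x \<in> carrier M \<Longrightarrow> g x \<in> fps_overconv v t"
  obtains s where "t < s" "s * \<sigma> < 1" "\<And>x. x \<in> carrier M \<Longrightarrow> g x \<in> fps_bounded v s"
proof -
  interpret base: finite_length_module class_ring "base_space M"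
    by (rule base.finite_length_if_fin_dim[OF fin_dim])
  let ?P = "\<lambda>W. \<exists>s>t. s * \<sigma> < 1 \<and> (\<forall>x\<in>W. g x \<in> fps_bounded v s)"
  have "?P (carrier (base_space M))"
  proof (rule base.adjoin_induct[OF base.left.submodule_trivial, of ?P])
    obtain s where "t < s" "s * \<sigma> < 1" using radius_margin[OF t(2), of "t + 1"] by auto
    thus "?P {\<zero>\<^bsub>base_space M\<^esub>}"
      using solution_zero[OF g(1)] gauss_bound_0 by (auto simp: fps_bounded_iff)
    fix W e
    assume W: "base.left.submod W" and "e \<in> carrier (base_space M)" and P: "?P W"
    hence e: "e \<in> carrier M" by simp
    obtain s1 where s1: "t < s1" "s1 * \<sigma> < 1" "\<And>x. x \<in> W \<Longrightarrow> g x \<in> fps_bounded v s1"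
      using P by blast
    obtain s2 where s2: "t < s2" "s2 * \<sigma> < 1" "g e \<in> fps_bounded v s2"
      using fps_overconvE[OF t g(2)[OF e]] by blast
    define s where "s = min s1 s2"
    have s: "t < s" "s * \<sigma> < 1" using s1 s2 by (auto simp: s_def min_def)
    hence sub: "fps.submod (fps_bounded v s)" using t(1) by (intro submodule_fps_bounded) auto
    have "g x \<in> fps_bounded v s" if x: "x \<in> adjoin class_ring (base_space M) W e" for x
    proof -
      obtain w c where w: "w \<in> W" "w \<in> carrier M" and x: "x = w \<oplus> [:c:] \<cdot> e"
        using base.left.adjoinE[OF W x] by (metis base_space_simps(1,2,4))
      have "g w \<in> fps_bounded v s" "g e \<in> fps_bounded v s"
        using fps_bounded_antimono[of s s1 "g w"] fps_bounded_antimono[of s s2 "g e"]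
          s1(3)[OF w(1)] s2(3) s(1) t(1)
        by (auto simp: s_def)
      hence "g w + fps_act [:c:] (g e) \<in> fps_bounded v s"
        using fps.submodule_add[OF sub] fps.submodule_smult[OF sub] by simp
      thus ?thesis
        using solution_add[OF g(1) w(2)] solution_const[OF g(1) e] e by (simp add: x fps_act_const)
    qed
    thus "?P (adjoin class_ring (base_space M) W e)" using s by blast
  qed
  thus ?thesis using that by auto
qed

lemma irreducible_solution_injective:
  assumes irr: "irreducible_module (twisted_ring \<delta>) M" and g: "g \<in> solutions \<delta> M"
    and ne: "x0 \<in> carrier M" "g x0 \<noteq> 0" and x: "x \<in> carrier M" "g x = 0"
  shows "x = \<zero>"
proof -
  have "submod {x \<in> carrier M. g x = 0}"
    using submodule_kernel[OF fps.left_module_axioms g] by simp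
  hence "{x \<in> carrier M. g x = 0} = {\<zero>} \<or> {x \<in> carrier M. g x = 0} = carrier M"
    using irr unfolding irreducible_module_def by blast
  thus ?thesis using ne x by blast
qed

text \<open>The Gauss norm pulled back along an injective solution is a norm for which \<open>T\<close> has norm at most
  \<open>1 / s\<close>, with \<open>s\<close> slightly larger than \<open>t\<close>.\<close>

lemma T_spectral_norm_less_if_overconv_solution:
  assumes irr: "irreducible_module (twisted_ring \<delta>) M" and t: "0 < t" "t * \<sigma> < 1"
    and g: "g \<in> solutions \<delta> M" "\<And>x. x \<in> carrier M \<Longrightarrow> g x \<in> fps_overconv v t"
    and ne: "x0 \<in> carrier M" "g x0 \<noteq> 0"
  shows "T_spectral_norm v M * t < 1"
proof -
  obtain s where s: "t < s" "s * \<sigma> < 1" and bounded: "\<And>x. x \<in> carrier M \<Longrightarrow> g x \<in> fps_bounded v s"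
    using overconv_solution_uniformly_bounded[OF t g] by blast
  have pos: "0 < s" using s t by simp
  define \<mu> where "\<mu> x = gauss_norm v s (g x)" for x
  have "nonarch_seminorm v (base_space M) \<mu>"
    using gauss_norm_add[OF pos] gauss_norm_taylor_mult[OF pos s(2)] bounded
    by (auto simp: nonarch_seminorm_def \<mu>_def gauss_norm_nonneg
        solution_add[OF g(1)] solution_const[OF g(1)])
  moreover have "x = \<zero>" if "x \<in> carrier M" "\<mu> x = 0" for x
    using irreducible_solution_injective[OF irr g(1) ne] gauss_norm_eq_0[OF pos bounded] that
    by (simp add: \<mu>_def)
  ultimately have \<mu>: "nonarch_normed_space v (base_space M) \<mu>" by unfold_locales auto
  have "carrier M \<noteq> {\<zero>}" using irr by (simp add: irreducible_module_def)
  moreover have "\<mu> (T x) \<le> 1 / s * \<mu> x" if "x \<in> carrier M" for x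
    using gauss_norm_deriv[OF pos bounded[OF that]] solution_T[OF g(1) that] by (simp add: \<mu>_def)
  ultimately have "T_spectral_norm v M \<le> 1 / s" using pos by (intro T_spectral_norm_le[OF \<mu>]) auto
  hence "T_spectral_norm v M * t \<le> 1 / s * t" using t(1) by (intro mult_right_mono) auto
  also have "\<dots> < 1" using s pos by simp
  finally show ?thesis .
qed

end


section \<open>Modules that are pure of a given radius\<close>

locale convergence_radius = residue_char_0_diff_field v \<delta>
  for v :: "'k::field_char_0 \<Rightarrow> real" and \<delta> :: "'k \<Rightarrow> 'k" +
  fixes r :: real
  assumes r_pos: "0 < r" and r_le: "r \<le> diff_radius v \<delta>"
begin

definition pure :: "('k poly, 'b, 'm) module_scheme \<Rightarrow> bool" where
  "pure M \<longleftrightarrow> F_sol v \<delta> r M = carrier M"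

lemma diff_radius_eq: "diff_radius v \<delta> = 1 / \<sigma>"
  using residue_char_0 by (simp add: diff_radius_def omega_def)

lemma \<sigma>_pos: "0 < \<sigma>"
  using r_pos r_le derivation.spectral_norm_nonneg unfolding diff_radius_eq
  by (cases "\<sigma> = 0") auto

lemma r_\<sigma>_le_1: "r * \<sigma> \<le> 1"
  using r_le \<sigma>_pos unfolding diff_radius_eq by (simp add: field_simps)

lemma less_diff_radius_iff: "r < diff_radius v \<delta> \<longleftrightarrow> r * \<sigma> < 1"
  using \<sigma>_pos unfolding diff_radius_eq by (simp add: field_simps)

lemma F_sol_iff:
  "x \<in> F_sol v \<delta> r M \<longleftrightarrow> x \<in> carrier M \<and> (\<forall>h\<in>solutions \<delta> M. h x \<in> fps_conv v r) \<and>
    (r * \<sigma> < 1 \<longrightarrow> (\<forall>h\<in>solutions \<delta> M. (\<forall>y\<in>carrier M. h y \<in> fps_overconv v r) \<longrightarrow> h x = 0))"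
proof -
  have "h \<in> left_module_hom (twisted_ring \<delta>) M (fps_module \<delta>\<lparr>carrier := fps_overconv v r\<rparr>) \<longleftrightarrow>
      h \<in> solutions \<delta> M \<and> (\<forall>y\<in>carrier M. h y \<in> fps_overconv v r)" for h
    by (rule left_module_hom_codomain_iff) simp
  thus ?thesis by (auto simp: F_sol_def F_le_def F_ge_def less_diff_radius_iff)
qed

lemma
  assumes "x \<in> F_sol v \<delta> r M"
  shows F_sol_carrier: "x \<in> carrier M"
    and F_sol_conv: "h \<in> solutions \<delta> M \<Longrightarrow> h x \<in> fps_conv v r"
    and F_sol_vanish: "r * \<sigma> < 1 \<Longrightarrow> h \<in> solutions \<delta> M \<Longrightarrow>
      (\<And>y. y \<in> carrier M \<Longrightarrow> h y \<in> fps_overconv v r) \<Longrightarrow> h x = 0"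
  using assms by (simp_all add: F_sol_iff)

lemma pureI:
  assumes "\<And>h x. h \<in> solutions \<delta> M \<Longrightarrow> x \<in> carrier M \<Longrightarrow> h x \<in> fps_conv v r"
    and "\<And>h x. r * \<sigma> < 1 \<Longrightarrow> h \<in> solutions \<delta> M \<Longrightarrow>
      (\<And>y. y \<in> carrier M \<Longrightarrow> h y \<in> fps_overconv v r) \<Longrightarrow> x \<in> carrier M \<Longrightarrow> h x = 0"
  shows "pure M"
  using assms by (auto simp: pure_def F_sol_iff)

lemma
  assumes "pure M" "h \<in> solutions \<delta> M" "x \<in> carrier M"
  shows pure_conv: "h x \<in> fps_conv v r"
    and pure_vanish: "r * \<sigma> < 1 \<Longrightarrow> (\<And>y. y \<in> carrier M \<Longrightarrow> h y \<in> fps_overconv v r) \<Longrightarrow> h x = 0"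
proof -
  have x: "x \<in> F_sol v \<delta> r M" using assms(1,3) by (simp add: pure_def)
  show "h x \<in> fps_conv v r" by (rule F_sol_conv[OF x assms(2)])
  show "h x = 0" if "r * \<sigma> < 1" "\<And>y. y \<in> carrier M \<Longrightarrow> h y \<in> fps_overconv v r"
    using F_sol_vanish[OF x that(1) assms(2) that(2)] .
qed

context
  fixes M :: "('k poly, 'b, 'm) module_scheme"
  assumes fd: "fd_diff_module \<delta> M"
begin

interpretation M: residue_char_0_diff_module v \<delta> M
  by (intro residue_char_0_diff_module.intro residue_char_0_diff_field_axioms fd)

lemma pure_if_trivial:
  assumes "carrier M = {\<zero>\<^bsub>M\<^esub>}"
  shows "pure M"
proof (rule pureI)
  fix h x assume h: "h \<in> solutions \<delta> M" and "x \<in> carrier M"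
  thus "h x = 0" using M.solution_zero[OF h] assms by simp
  thus "h x \<in> fps_conv v r" using fps.submodule_zero[OF submodule_fps_conv[OF r_\<sigma>_le_1]] by simp
qed

lemma submodule_F_sol: "M.submod (F_sol v \<delta> r M)"
proof (rule M.submoduleI)
  note conv = submodule_fps_conv[OF r_\<sigma>_le_1]
  show "F_sol v \<delta> r M \<subseteq> carrier M" by (rule subsetI) (rule F_sol_carrier)
  have "h \<zero>\<^bsub>M\<^esub> \<in> fps_conv v r" if "h \<in> solutions \<delta> M" for h
    using M.solution_zero[OF that] fps.submodule_zero[OF conv] by simp
  thus "\<zero>\<^bsub>M\<^esub> \<in> F_sol v \<delta> r M" using M.solution_zero by (auto simp: F_sol_iff)
  fix x assume x: "x \<in> F_sol v \<delta> r M"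
  note xM = F_sol_carrier[OF x]
  show "p \<odot>\<^bsub>M\<^esub> x \<in> F_sol v \<delta> r M" for p
    unfolding F_sol_iff
  proof (intro conjI ballI impI)
    fix h assume h: "h \<in> solutions \<delta> M"
    have eq: "h (p \<odot>\<^bsub>M\<^esub> x) = p \<odot>\<^bsub>fps_module \<delta>\<^esub> h x" using left_module_hom_smult[OF h xM] by simp
    show "h (p \<odot>\<^bsub>M\<^esub> x) \<in> fps_conv v r"
      unfolding eq by (rule fps.submodule_smult[OF conv _ F_sol_conv[OF x h]]) simp
    show "h (p \<odot>\<^bsub>M\<^esub> x) = 0" if "r * \<sigma> < 1" "\<forall>y\<in>carrier M. h y \<in> fps_overconv v r"
      unfolding eq using F_sol_vanish[OF x that(1) h] that(2) fps.smult_r_zero[of p] by simp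
  qed (simp add: xM)
  fix y assume y: "y \<in> F_sol v \<delta> r M"
  note yM = F_sol_carrier[OF y]
  show "x \<oplus>\<^bsub>M\<^esub> y \<in> F_sol v \<delta> r M"
    unfolding F_sol_iff
  proof (intro conjI ballI impI)
    fix h assume h: "h \<in> solutions \<delta> M"
    have eq: "h (x \<oplus>\<^bsub>M\<^esub> y) = h x + h y" by (rule M.solution_add[OF h xM yM])
    show "h (x \<oplus>\<^bsub>M\<^esub> y) \<in> fps_conv v r"
      using fps.submodule_add[OF conv F_sol_conv[OF x h] F_sol_conv[OF y h]] by (simp add: eq)
    show "h (x \<oplus>\<^bsub>M\<^esub> y) = 0" if "r * \<sigma> < 1" "\<forall>y\<in>carrier M. h y \<in> fps_overconv v r"
      unfolding eq using F_sol_vanish[OF x that(1) h] F_sol_vanish[OF y that(1) h] that(2) by simp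
  qed (simp add: xM yM)
qed

lemma pure_submodule_iff:
  assumes N: "M.submod N"
  shows "pure (M\<lparr>carrier := N\<rparr>) \<longleftrightarrow> N \<subseteq> F_sol v \<delta> r M"
proof
  note NM = M.submodule_subset[OF N]
  assume pure: "pure (M\<lparr>carrier := N\<rparr>)"
  show "N \<subseteq> F_sol v \<delta> r M"
  proof
    fix x assume x: "x \<in> N"
    have h: "h \<in> solutions \<delta> (M\<lparr>carrier := N\<rparr>)" if "h \<in> solutions \<delta> M" for h
      by (rule left_module_hom_restrict[OF that NM])
    show "x \<in> F_sol v \<delta> r M"
      using pure_conv[OF pure h, of _ x] pure_vanish[OF pure h, of _ x] x NM by (auto simp: F_sol_iff)
  qed
next
  assume sub: "N \<subseteq> F_sol v \<delta> r M"
  show "pure (M\<lparr>carrier := N\<rparr>)"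
  proof (rule pureI; simp)
    fix h x assume h: "h \<in> solutions \<delta> (M\<lparr>carrier := N\<rparr>)" and x: "x \<in> N"
    obtain g where "g \<in> solutions \<delta> M" "\<And>x. x \<in> N \<Longrightarrow> g x = h x" by (rule M.solution_extends[OF N h]) blast
    thus "h x \<in> fps_conv v r" using F_sol_conv[of x M g] sub x by auto
  next
    fix h x assume r: "r * \<sigma> < 1" and h: "h \<in> solutions \<delta> (M\<lparr>carrier := N\<rparr>)"
      "\<And>y. y \<in> N \<Longrightarrow> h y \<in> fps_overconv v r" and x: "x \<in> N"
    obtain g where "g \<in> solutions \<delta> M" "\<And>x. x \<in> carrier M \<Longrightarrow> g x \<in> fps_overconv v r"
      "\<And>x. x \<in> N \<Longrightarrow> g x = h x"
      using M.overconv_solution_extends[OF N r_pos r h] by blast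
    thus "h x = 0" using F_sol_vanish[of x M g] r sub x by auto
  qed
qed

lemma pure_quotient:
  assumes N: "M.submod N" and pure: "pure M"
  shows "pure (quotient_module M N)"
proof (rule pureI)
  let ?Q = "quotient_module M N" and ?\<pi> = "\<lambda>x. N +>\<^bsub>M\<^esub> x"
  have pullback: "(\<lambda>x. h (?\<pi> x)) \<in> solutions \<delta> M" if "h \<in> solutions \<delta> ?Q" for h
    by (rule left_module_hom_compose[OF M.quotient_projection_hom[OF N] that])
  note carrier = M.quotient_carrier[OF N]
  show "h X \<in> fps_conv v r" if "h \<in> solutions \<delta> ?Q" "X \<in> carrier ?Q" for h X
    using pure_conv[OF pure pullback[OF that(1)]] that(2) by (auto simp: carrier)
  show "h X = 0" if "r * \<sigma> < 1" "h \<in> solutions \<delta> ?Q" "\<And>Y. Y \<in> carrier ?Q \<Longrightarrow> h Y \<in> fps_overconv v r"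
    "X \<in> carrier ?Q" for h X
    using pure_vanish[OF pure pullback[OF that(2)] _ that(1)] that(3,4) by (auto simp: carrier)
qed

lemma solution_overconv_if_pure_pieces:
  assumes N: "M.submod N" and pure: "pure (M\<lparr>carrier := N\<rparr>)" "pure (quotient_module M N)"
    and t: "t \<in> {0<..<r}" and h: "h \<in> solutions \<delta> M" and x: "x \<in> carrier M"
  shows "h x \<in> fps_overconv v t"
proof -
  have t': "0 < t" "t * \<sigma> < 1" using t radius_mult_less_1[OF _ r_\<sigma>_le_1] by auto
  have hN: "h \<in> solutions \<delta> (M\<lparr>carrier := N\<rparr>)"
    by (rule left_module_hom_restrict[OF h M.submodule_subset[OF N]])
  have "h y \<in> fps_overconv v t" if "y \<in> N" for y
    using pure_conv[OF pure(1) hN, of y] that t by (simp add: fps_conv_iff_overconv)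
  then obtain g where g: "g \<in> solutions \<delta> M" "\<And>y. y \<in> carrier M \<Longrightarrow> g y \<in> fps_overconv v t"
    "\<And>y. y \<in> N \<Longrightarrow> g y = h y"
    using M.overconv_solution_extends[OF N t' hN] by blast
  have diff: "(\<lambda>y. h y - g y) \<in> solutions \<delta> M"
    using M.left_module_hom_difference[OF fps.left_module_axioms h g(1)] by simp
  obtain k where k: "k \<in> solutions \<delta> (quotient_module M N)" "\<And>y. y \<in> carrier M \<Longrightarrow> k (N +>\<^bsub>M\<^esub> y) = h y - g y"
    by (rule M.hom_descends[OF N fps.left_module_axioms diff]) (use g(3) in auto)
  have "N +>\<^bsub>M\<^esub> x \<in> carrier (quotient_module M N)" using x by (simp add: M.quotient_carrier[OF N])
  hence "h x - g x \<in> fps_overconv v t"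
    using pure_conv[OF pure(2) k(1)] k(2)[OF x] t by (metis fps_conv_iff_overconv)
  from fps.submodule_add[OF submodule_fps_overconv[OF t'] this g(2)[OF x]] show ?thesis by simp
qed

lemma pure_iff_submodule_quotient:
  assumes N: "M.submod N"
  shows "pure M \<longleftrightarrow> pure (M\<lparr>carrier := N\<rparr>) \<and> pure (quotient_module M N)"
proof
  assume "pure M"
  thus "pure (M\<lparr>carrier := N\<rparr>) \<and> pure (quotient_module M N)"
    using pure_quotient[OF N] pure_submodule_iff[OF N] M.submodule_subset[OF N] by (simp add: pure_def)
next
  assume pure: "pure (M\<lparr>carrier := N\<rparr>) \<and> pure (quotient_module M N)"
  show "pure M"
  proof (rule pureI)
    show "h x \<in> fps_conv v r" if "h \<in> solutions \<delta> M" "x \<in> carrier M" for h x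
      using solution_overconv_if_pure_pieces[OF N _ _ _ that] pure by (simp add: fps_conv_iff_overconv)
    fix h x assume r: "r * \<sigma> < 1" and h: "h \<in> solutions \<delta> M" "\<And>y. y \<in> carrier M \<Longrightarrow> h y \<in> fps_overconv v r"
      and x: "x \<in> carrier M"
    have hN: "h \<in> solutions \<delta> (M\<lparr>carrier := N\<rparr>)"
      by (rule left_module_hom_restrict[OF h(1) M.submodule_subset[OF N]])
    have "h y = 0" if "y \<in> N" for y
      using pure_vanish[OF conjunct1[OF pure] hN, of y] r h(2) that M.submodule_subset[OF N] by auto
    then obtain k where k: "k \<in> solutions \<delta> (quotient_module M N)" "\<And>y. y \<in> carrier M \<Longrightarrow> k (N +>\<^bsub>M\<^esub> y) = h y"
      using M.hom_descends[OF N fps.left_module_axioms h(1)] by auto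
    have "k (N +>\<^bsub>M\<^esub> x) = 0"
    proof (rule pure_vanish[OF conjunct2[OF pure] k(1) _ r])
      show "k Y \<in> fps_overconv v r" if "Y \<in> carrier (quotient_module M N)" for Y
        using that h(2) k(2) by (auto simp: M.quotient_carrier[OF N])
    qed (use x in \<open>simp add: M.quotient_carrier[OF N]\<close>)
    thus "h x = 0" using k(2)[OF x] by simp
  qed
qed

lemma pure_if_T_spectral_norm:
  assumes irr: "irreducible_module (twisted_ring \<delta>) M" and T: "T_spectral_norm v M * r = 1"
  shows "pure M"
proof (rule pureI)
  have ne: "carrier M \<noteq> {\<zero>\<^bsub>M\<^esub>}" using irr by (simp add: irreducible_module_def)
  have \<rho>: "0 < T_spectral_norm v M" using zero_less_mult_pos2[of "T_spectral_norm v M" r] T r_pos by simp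
  fix h x assume h: "h \<in> solutions \<delta> M" and x: "x \<in> carrier M"
  have "h x \<in> fps_overconv v t" if t: "t \<in> {0<..<r}" for t
  proof (rule M.solution_overconv[OF ne _ _ h x])
    show "T_spectral_norm v M * t < 1" using mult_strict_left_mono[of t r, OF _ \<rho>] t T by simp
  qed (use t in simp)
  thus "h x \<in> fps_conv v r" by (simp add: fps_conv_iff_overconv)
next
  fix h x assume r: "r * \<sigma> < 1" and h: "h \<in> solutions \<delta> M" "\<And>y. y \<in> carrier M \<Longrightarrow> h y \<in> fps_overconv v r"
    and x: "x \<in> carrier M"
  show "h x = 0"
    using M.T_spectral_norm_less_if_overconv_solution[OF irr r_pos r h x] T by linarith
qed

lemma T_spectral_norm_if_pure:
  assumes irr: "irreducible_module (twisted_ring \<delta>) M" and pure: "pure M"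
  shows "T_spectral_norm v M * r = 1"
proof -
  have ne: "carrier M \<noteq> {\<zero>\<^bsub>M\<^esub>}" using irr by (simp add: irreducible_module_def)
  obtain h x where h: "h \<in> solutions \<delta> M" and x: "x \<in> carrier M" "h x \<noteq> 0"
    by (rule M.nonzero_solution_exists[OF ne])
  consider (less) "T_spectral_norm v M * r < 1" | (equal) "T_spectral_norm v M * r = 1"
    | (greater) "1 < T_spectral_norm v M * r" by linarith
  thus ?thesis
  proof cases
    case less
    have "\<sigma> * r \<le> T_spectral_norm v M * r"
      using M.derivation_spectral_norm_le_T[OF ne] r_pos by (intro mult_right_mono) auto
    hence "r * \<sigma> < 1" using less by (simp add: mult.commute)
    hence "h x = 0"
      using pure_vanish[OF pure h x(1)] M.solution_overconv[OF ne r_pos less h] by blast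
    thus ?thesis using x(2) by simp
  next
    case greater
    hence \<rho>: "0 < T_spectral_norm v M" using zero_less_mult_pos2[of "T_spectral_norm v M" r] r_pos by simp
    define t where "t = 1 / T_spectral_norm v M"
    have t: "t \<in> {0<..<r}" using \<rho> greater by (simp add: t_def field_simps)
    hence "h y \<in> fps_overconv v t" if "y \<in> carrier M" for y
      using pure_conv[OF pure h that] by (simp add: fps_conv_iff_overconv)
    hence "T_spectral_norm v M * t < 1"
      using t radius_mult_less_1[OF _ r_\<sigma>_le_1] h x
      by (intro M.T_spectral_norm_less_if_overconv_solution[OF irr]) auto
    thus ?thesis using \<rho> by (simp add: t_def)
  qed
qed

end

lemma
  assumes fd: "fd_diff_module \<delta> M" and Ns: "composition_series (twisted_ring \<delta>) M Ns"
    and i: "Suc i < length Ns"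
  shows fd_diff_module_composition_factor: "fd_diff_module \<delta> (composition_factor M Ns i)"
    and pure_composition_series_step: "pure (M\<lparr>carrier := Ns ! Suc i\<rparr>) \<longleftrightarrow>
      pure (M\<lparr>carrier := Ns ! i\<rparr>) \<and> T_spectral_norm v (composition_factor M Ns i) * r = 1"
proof -
  interpret M: fd_diff_module \<delta> M by (rule fd)
  note step = M.composition_series_step[OF Ns i]
  interpret U: fd_diff_module \<delta> "M\<lparr>carrier := Ns ! Suc i\<rparr>" by (rule M.fd_diff_module_submodule[OF step(2)])
  have sub: "U.submod (Ns ! i)" using M.submodule_restrict_iff[OF step(2)] step by simp
  show fd_factor: "fd_diff_module \<delta> (composition_factor M Ns i)"
    unfolding composition_factor_def by (rule U.fd_diff_module_quotient[OF sub])
  have "pure (composition_factor M Ns i) \<longleftrightarrow> T_spectral_norm v (composition_factor M Ns i) * r = 1"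
    using pure_if_T_spectral_norm[OF fd_factor step(4)] T_spectral_norm_if_pure[OF fd_factor step(4)]
    by blast
  thus "pure (M\<lparr>carrier := Ns ! Suc i\<rparr>) \<longleftrightarrow>
      pure (M\<lparr>carrier := Ns ! i\<rparr>) \<and> T_spectral_norm v (composition_factor M Ns i) * r = 1"
    using pure_iff_submodule_quotient[OF U.fd_diff_module_axioms sub] by (simp add: composition_factor_def)
qed

lemma pure_iff_composition_factors:
  assumes fd: "fd_diff_module \<delta> M" and Ns: "composition_series (twisted_ring \<delta>) M Ns"
  shows "pure M \<longleftrightarrow> (\<forall>i. Suc i < length Ns \<longrightarrow> T_spectral_norm v (composition_factor M Ns i) * r = 1)"
proof -
  interpret M: fd_diff_module \<delta> M by (rule fd)
  have Ns': "Ns \<noteq> []" "Ns ! 0 = {\<zero>\<^bsub>M\<^esub>}" "Ns ! (length Ns - 1) = carrier M"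
    using Ns by (auto simp: composition_series_def hd_conv_nth last_conv_nth)
  have "pure (M\<lparr>carrier := Ns ! i\<rparr>) \<longleftrightarrow> (\<forall>j<i. T_spectral_norm v (composition_factor M Ns j) * r = 1)"
    if "i < length Ns" for i
    using that
  proof (induction i)
    case 0
    have "pure (M\<lparr>carrier := {\<zero>\<^bsub>M\<^esub>}\<rparr>)"
      by (rule pure_if_trivial[OF M.fd_diff_module_submodule[OF M.submodule_trivial]]) simp
    thus ?case by (simp add: Ns'(2))
  next
    case (Suc i)
    thus ?case using pure_composition_series_step[OF fd Ns] by (auto simp: less_Suc_eq)
  qed
  from this[of "length Ns - 1"] show ?thesis using Ns'(1,3) by (auto simp: less_diff_conv)
qed

lemma mult_irreducible_nonzero_iff:
  assumes fd: "fd_diff_module \<delta> L" and irr: "irreducible_module (twisted_ring \<delta>) L"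
  shows "mult_irreducible v L r' \<noteq> 0 \<longleftrightarrow> r' = 1 / T_spectral_norm v L"
proof -
  interpret L: fd_diff_module \<delta> L by (rule fd)
  have "L.base.dim \<noteq> 0" using L.base.dim_nonzero[OF L.fin_dim] irr by (simp add: irreducible_module_def)
  thus ?thesis using residue_char_0 by (simp add: mult_irreducible_def omega_def)
qed

lemma pure_iff_mult_function_support:
  assumes fd: "fd_diff_module \<delta> M"
  shows "pure M \<longleftrightarrow> {r'. mult_function v \<delta> M r' \<noteq> 0} \<subseteq> {r}"
proof -
  interpret M: fd_diff_module \<delta> M by (rule fd)
  define Ns where "Ns = (SOME Ns. composition_series (twisted_ring \<delta>) M Ns)"
  have Ns: "composition_series (twisted_ring \<delta>) M Ns"
    unfolding Ns_def by (rule someI_ex[OF M.composition_series_exists])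
  have "mult_function v \<delta> M r' \<noteq> 0 \<longleftrightarrow>
      (\<exists>i. Suc i < length Ns \<and> r' = 1 / T_spectral_norm v (composition_factor M Ns i))" for r'
  proof -
    have "mult_function v \<delta> M r' \<noteq> 0 \<longleftrightarrow>
        (\<exists>i. Suc i < length Ns \<and> mult_irreducible v (composition_factor M Ns i) r' \<noteq> 0)"
      by (simp add: mult_function_def flip: Ns_def) (auto simp: less_diff_conv)
    thus ?thesis
      using mult_irreducible_nonzero_iff fd_diff_module_composition_factor[OF fd Ns]
        M.composition_series_step(4)[OF Ns] by blast
  qed
  hence "{r'. mult_function v \<delta> M r' \<noteq> 0} \<subseteq> {r} \<longleftrightarrow>
      (\<forall>i. Suc i < length Ns \<longrightarrow> 1 / T_spectral_norm v (composition_factor M Ns i) = r)" by auto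
  also have "\<dots> \<longleftrightarrow> (\<forall>i. Suc i < length Ns \<longrightarrow> T_spectral_norm v (composition_factor M Ns i) * r = 1)"
    using r_pos by (auto simp: divide_eq_eq mult.commute)
  finally show ?thesis using pure_iff_composition_factors[OF fd Ns] by simp
qed

end

theorem theorem6p5:
  fixes v :: "'k::field_char_0 \<Rightarrow> real" and \<delta> :: "'k \<Rightarrow> 'k"
    and M :: "('k poly, 'm) module" and r :: real
  assumes "complete_nonarch_diff_field v \<delta>"
    and "residue_char v = 0"
    and "fd_module \<delta> M"
    and "0 < r" and "r \<le> diff_radius v \<delta>"
  shows "F_sp v \<delta> r M = F_sol v \<delta> r M"
proof -
  interpret complete_nonarch_diff_field v \<delta> by fact
  interpret convergence_radius v \<delta> r by unfold_locales fact+
  have fd: "fd_diff_module \<delta> M"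
    using assms(3) derivation_axioms
    by (auto simp: fd_module_def intro!: fd_diff_module.intro diff_module.intro fd_diff_module_axioms.intro)
  interpret M: fd_diff_module \<delta> M by (rule fd)
  have "M.submod N \<and> {r'. mult_function v \<delta> (M\<lparr>carrier := N\<rparr>) r' \<noteq> 0} \<subseteq> {r}
      \<longleftrightarrow> M.submod N \<and> N \<subseteq> F_sol v \<delta> r M" for N
    using pure_iff_mult_function_support[OF M.fd_diff_module_submodule] pure_submodule_iff[OF fd] by blast
  thus ?thesis
    unfolding F_sp_def using submodule_F_sol[OF fd] by (auto intro!: Greatest_equality)
qed

end
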